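(* For fixed $c\in(0,1]$, let $\Omega$ be a regular domain such that $\{\rho^2x^2+y^2\le\beta_-^2\}\subset\Omega\subset\{\rho^2x^2+y^2\le\beta_+^2\}$ with $\frac{\beta_-^2}{\beta_+^2}=c$. For any $\rho\in(0,\underline\rho_*(c)]$ let $u=u^{(\lambda)}\equiv u_{\rho,\mu,c}$, for $\lambda\in[0,\lambda_{\rho,c}]$, be the associated solution of $P(\lambda,\Omega)$ and of $Q(\mu,\Omega)$ with $\lambda=\mu\int_\Omega e^u$. Then the linearized problem $$-\Delta\varphi-\lambda\,\omega(u)\varphi+\lambda\,\omega(u)\langle\varphi\rangle_\omega=0\ \text{ in }\Omega,\qquad\varphi=0\ \text{ on }\partial\Omega,$$ has only the trivial solution, and in particular the first eigenvalues of the linearized problems for $P(\lambda,\Omega)$ and $Q(\mu,\Omega)$ at $u=u^{(\lambda)}\equiv u_{\rho,\mu,c}$ are strictly positive. Moreover, let $\Omega$ be a regular and convex domain with $N(\Omega)>\bar N$ and let $u^{(\lambda)}$, for $0\le\lambda=\mu\int_\Omega e^{u^{(\lambda)}}\le\lambda_N$, be the associated solution of $P(\lambda,\Omega)$ and of $Q(\mu,\Omega)$. Then the first eigenvalues of the linearized problems for $P(\lambda,\Omega)$ and $Q(\mu,\Omega)$ at $u=u^{(\lambda)}$ are strictly positive.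
   Context: A bounded, open, simply connected set $\Omega\subset\mathbb{R}^2$ is called simple if $\partial\Omega$ is the support of a simple and rectifiable Jordan curve. A simple domain is called regular if: (i) $\partial\Omega$ is the support of a continuous, piecewise $C^2$ curve with bounded first derivative and at most finitely many corner-type points $p_1,\dots,p_m$, i.e. the inner angle $\theta_j$ formed by the limiting tangents at $p_j$ is well defined and $\theta_j\in(0,2\pi)\setminus\{\pi\}$; (ii) for each $p_j$ there is a conformal bijection from an open neighborhood $U$ of $p_j$ which maps $U\cap\partial\Omega$ onto a curve of class $C^2$. $N(\Omega)=L^2(\partial\Omega)/A(\Omega)$ is the isoperimetric ratio ($L$ length, $A$ area). $P(\lambda,\Omega)$: $-\Delta u=\lambda e^u/\int_\Omega e^u$ in $\Omega$, $u=0$ on $\partial\Omega$. $Q(\mu,\Omega)$: $-\Delta u=\mu e^u$ in $\Omega$, $u=0$ on $\partial\Omega$. On regular domains solutions are $H^1_0(\Omega)$ weak solutions. $P(\lambda,\Omega)$ is invariant under translations, rotations and dilations. Linearized problems. $\omega=\omega(u)=e^u/\int_\Omega e^u$ and $\langle f\rangle_\omega=\int_\Omega\omega(u)f$. An eigenvalue of the linearized problem for $P(\lambda,\Omega)$ at $u$ is a number $\tau\in\mathbb{R}$ for which there is a weak solution $\phi\in H^1_0(\Omega)\setminus\{0\}$ of $-\Delta\phi-\lambda\omega(u)\phi+\lambda\omega(u)\langle\phi\rangle_\omega=\tau\,\omega(u)\phi$ in $\Omega$. An eigenvalue of the linearized problem for $Q(\mu,\Omega)$ at $u$ is a number $\nu\in\mathbb{R}$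 for which there is a weak solution $\phi\in H^1_0(\Omega)\setminus\{0\}$ of $-\Delta\phi-\mu e^u\phi=\nu e^u\phi$ in $\Omega$. The first eigenvalue is the smallest one. Constants. For $\rho\in(0,1)$, $c\in(0,1]$ let $\overline\mu_\rho=\frac{(1+\rho^2)^2}{2}$ and, for $\mu\in(0,\overline\mu_\rho]$, let $\gamma^+_\rho(\mu),\gamma^-_{\rho,c}(\mu)>0$ be given by $$(\gamma^+_\rho(\mu))^2=\frac{2(1+\rho^2)-\mu-2\sqrt{(1+\rho^2)^2-2\mu}}{\mu+4(1-\rho^2)},\qquad(\gamma^-_{\rho,c}(\mu))^2=\frac{\mu c-2(1+\rho^2)+2\sqrt{(1+\rho^2)^2-2\rho^2\mu c}}{4(1-\rho^2)-\mu c}.$$ Let $\underline\lambda_{\rho,c}=\frac{c(1+\rho^2)^2}{2}\frac{\pi}{\rho}\big(1+(\gamma^-_{\rho,c}(\overline\mu_\rho))^2\big)$. The number $\underline\rho_*(c)\in(0,\frac1{2\sqrt{10}})$ is determined by $\underline\lambda_{\underline\rho_*(c),c}=8\pi$ ($\underline\lambda_{\rho,c}$ is strictly decreasing in $\rho\in(0,\frac{1}{2\sqrt{10}}]$). Solutions $u^{(\lambda)}$ and threshold $\lambda_{\rho,c}$. Let $\rho\in(0,\underline\rho_*(c)]$ and let $\Omega$ lie between the two ellipses as in the claim. Assume first (dilating) $\beta_+=1$. For $\mu\in(0,\overline\mu_\rho]$, $u_{\rho,\mu,c}$ denotes the solution of $Q(\mu,\Omega)$ obtained by the sub-supersolution method,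 satisfying in $\Omega$ $$v^-_\mu\le u_{\rho,\mu,c}\le v^+_\mu,\quad v^+_\mu=2\log\frac{1+\gamma^2}{1+\gamma^2(\rho^2x^2+y^2)}\ (\gamma=\gamma^+_\rho(\mu)),$$ $$v^-_\mu=2\log\frac{1+\gamma^2}{1+\frac{\gamma^2}{c}(\rho^2x^2+y^2)}\ (\gamma=\gamma^-_{\rho,c}(\mu))\ \text{if }\rho^2x^2+y^2\le c,\quad v^-_\mu=0\text{ otherwise}.$$ It solves $P(\lambda,\Omega)$ with $\lambda=\lambda_{\rho,c}(\mu):=\mu\int_\Omega e^{u_{\rho,\mu,c}}$. Put $\lambda_{\rho,c}:=\lambda_{\rho,c}(\overline\mu_\rho)$. For $\lambda\in(0,\lambda_{\rho,c}]$, $u^{(\lambda)}$ denotes $u_{\rho,\mu,c}$ with $\lambda_{\rho,c}(\mu)=\lambda$; $u^{(0)}=0$ (with $\mu=0$). For general $\beta_+$, $u^{(\lambda)}$ and $\lambda_{\rho,c}$ are obtained from those of $\beta_+^{-1}\Omega$ by dilation (with $\mu=\lambda/\int_\Omega e^{u^{(\lambda)}}$). Convex case. $\bar N>\frac{512}{\pi}$ is the number with $\varphi(\bar N)=\underline\rho_*(\frac14)$, where $\varphi(N)=\frac{64+\frac{8192\sqrt2}{\pi N}}{\pi N-64-\frac{8192\sqrt2}{\pi N}}$. If $\Omega$ is open, bounded, convex with $N=N(\Omega)\ge\bar N$, then after a rigid motion its John (maximal area inscribed) ellipse is $\{x^2/a^2+y^2/b^2\le1\}$ with $0<b\le a$,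 and $\Omega\subset\{x^2/a^2+y^2/b^2\le4\}$; with $\rho_N=b/a\le\underline\rho_*(\frac14)$ the previous construction applies with $c=\frac14$, $\rho=\rho_N$, $\beta_-=b$, $\beta_+=2b$, and gives $u^{(\lambda)}$ and $\lambda_N:=\lambda_{\rho_N,1/4}$. *)

theory Defs
  imports "HOL-Analysis.Analysis"
begin

text \<open>The plane is \<^typ>\<open>complex\<close>, with coordinates $x$ = \<^const>\<open>Re\<close> and $y$ = \<^const>\<open>Im\<close>.\<close>

section \<open>Regular domains\<close>

definition curve_length :: "(real \<Rightarrow> complex) \<Rightarrow> ennreal" where
  "curve_length g =
     (SUP ts\<in>{ts. sorted ts \<and> set ts \<subseteq> {0..1}}.
        \<Sum>i<length ts - 1. ennreal (dist (g (ts ! i)) (g (ts ! Suc i))))"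

definition jordan_parametrization :: "complex set \<Rightarrow> (real \<Rightarrow> complex) \<Rightarrow> bool" where
  "jordan_parametrization \<Omega> g \<longleftrightarrow>
     simple_path g \<and> pathfinish g = pathstart g \<and> path_image g = frontier \<Omega>"

definition simple_domain :: "complex set \<Rightarrow> bool" where
  "simple_domain \<Omega> \<longleftrightarrow> bounded \<Omega> \<and> open \<Omega> \<and> simply_connected \<Omega> \<and>
     (\<exists>g. jordan_parametrization \<Omega> g \<and> curve_length g < \<infinity>)"

text \<open>\<open>T\<close> is open in all uses. The velocity is required not to vanish, so that class $C^2$ is a
  property of the curve as a set: otherwise cusps and corners would admit $C^2$ parametrizations.\<close>

definition C2_curve_on :: "real set \<Rightarrow> (real \<Rightarrow> complex) \<Rightarrow> bool" where
  "C2_curve_on T g \<longleftrightarrow>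
     (\<forall>t\<in>T. g differentiable (at t) \<and> vector_derivative g (at t) \<noteq> 0 \<and>
            (\<lambda>s. vector_derivative g (at s)) differentiable (at t)) \<and>
     continuous_on T (\<lambda>t. vector_derivative (\<lambda>s. vector_derivative g (at s)) (at t))"

text \<open>\<open>T\<^sub>1\<close>, \<open>T\<^sub>2\<close> are the unit tangents to the boundary at \<open>p\<close>, both pointing away from \<open>p\<close>.
  The two sector conditions single out the angle on the side of \<open>\<Omega>\<close>.\<close>

definition inner_angle :: "complex set \<Rightarrow> complex \<Rightarrow> complex \<Rightarrow> complex \<Rightarrow> real \<Rightarrow> bool" where
  "inner_angle \<Omega> p T\<^sub>1 T\<^sub>2 \<theta> \<longleftrightarrow>
     (\<exists>\<alpha>. {T\<^sub>1, T\<^sub>2} = {cis \<alpha>, cis (\<alpha> + \<theta>)} \<and>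
        (\<forall>\<beta>. \<alpha> < \<beta> \<and> \<beta> < \<alpha> + \<theta> \<longrightarrow> (\<forall>\<^sub>F r in at_right 0. p + r *\<^sub>R cis \<beta> \<in> \<Omega>)) \<and>
        (\<forall>\<beta>. \<alpha> + \<theta> < \<beta> \<and> \<beta> < \<alpha> + 2 * pi \<longrightarrow> (\<forall>\<^sub>F r in at_right 0. p + r *\<^sub>R cis \<beta> \<notin> \<Omega>)))"

text \<open>A map that is conformal in a full neighborhood of a corner preserves the angle, hence cannot
  straighten the corner. The conformal bijection is therefore taken on the part of the
  neighborhood inside \<open>\<Omega>\<close>, extending to a homeomorphism up to the boundary (for a straight corner
  of inner angle $\theta$ at $p$, the map $z \mapsto (z-p)^{\pi/\theta}$).\<close>

definition conformally_C2_at :: "complex set \<Rightarrow> complex \<Rightarrow> bool" where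
  "conformally_C2_at \<Omega> p \<longleftrightarrow>
     (\<exists>U f. open U \<and> p \<in> U \<and> f holomorphic_on (U \<inter> \<Omega>) \<and>
        (\<exists>V k. homeomorphism (U \<inter> closure \<Omega>) V f k) \<and>
        (\<exists>h. C2_curve_on {0<..<1} h \<and> inj_on h {0<..<1} \<and>
             h ` {0<..<1} = f ` (U \<inter> frontier \<Omega>)))"

text \<open>The boundary curve is parametrized as a 1-periodic function, so that its base point plays no
  special role; the corners are the points \<open>g s\<close> with \<open>s \<in> S\<close>.\<close>

definition regular_domain :: "complex set \<Rightarrow> bool" where
  "regular_domain \<Omega> \<longleftrightarrow> simple_domain \<Omega> \<and>
     (\<exists>g S. jordan_parametrization \<Omega> g \<and> (\<forall>t. g (t + 1) = g t) \<and>
        finite S \<and> S \<subseteq> {0..<1} \<and>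
        C2_curve_on {t. frac t \<notin> S} g \<and>
        bounded ((\<lambda>t. vector_derivative g (at t)) ` {t. frac t \<notin> S}) \<and>
        (\<forall>s\<in>S.
           (\<exists>Tm Tp \<theta>.
              ((\<lambda>t. sgn (vector_derivative g (at t))) \<longlongrightarrow> Tm) (at_left s) \<and>
              ((\<lambda>t. sgn (vector_derivative g (at t))) \<longlongrightarrow> Tp) (at_right s) \<and>
              inner_angle \<Omega> (g s) Tp (- Tm) \<theta> \<and> 0 < \<theta> \<and> \<theta> < 2 * pi \<and> \<theta> \<noteq> pi) \<and>
           conformally_C2_at \<Omega> (g s)))"

text \<open>All Jordan parametrizations of the boundary have the same length.\<close>

definition boundary_length :: "complex set \<Rightarrow> real" where
  "boundary_length \<Omega> = enn2real (curve_length (SOME g. jordan_parametrization \<Omega> g))"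

definition isoperimetric_ratio :: "complex set \<Rightarrow> real" where
  "isoperimetric_ratio \<Omega> = (boundary_length \<Omega>)\<^sup>2 / measure lebesgue \<Omega>"

section \<open>Weak solutions in $H^1_0$\<close>

definition L2_on :: "complex set \<Rightarrow> (complex \<Rightarrow> 'a::euclidean_space) \<Rightarrow> bool" where
  "L2_on \<Omega> f \<longleftrightarrow> f \<in> borel_measurable (lebesgue_on \<Omega>) \<and>
     integrable (lebesgue_on \<Omega>) (\<lambda>x. (norm (f x))\<^sup>2)"

text \<open>\<open>\<phi>\<close> is in $C^1_c(\Omega)$, with gradient \<open>D\<close>.\<close>

definition test_function :: "complex set \<Rightarrow> (complex \<Rightarrow> real) \<Rightarrow> (complex \<Rightarrow> complex) \<Rightarrow> bool" where
  "test_function \<Omega> \<phi> D \<longleftrightarrow> (\<forall>x. GDERIV \<phi> x :> D x) \<and> continuous_on UNIV D \<and>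
     compact (closure {x. \<phi> x \<noteq> 0}) \<and> closure {x. \<phi> x \<noteq> 0} \<subseteq> \<Omega>"

text \<open>$H^1_0(\Omega)$ is the closure of $C^1_c(\Omega)$ in $H^1(\Omega)$: \<open>H10 \<Omega> u G\<close> says that \<open>u\<close> belongs
  to it and has weak gradient \<open>G\<close> (an $L^2$ limit of gradients is automatically the weak gradient
  of the limit, and it is determined by \<open>u\<close> almost everywhere in \<open>\<Omega>\<close>). Functions are considered on
  \<open>\<Omega>\<close> only, up to null sets.\<close>

definition H10 :: "complex set \<Rightarrow> (complex \<Rightarrow> real) \<Rightarrow> (complex \<Rightarrow> complex) \<Rightarrow> bool" where
  "H10 \<Omega> u G \<longleftrightarrow> L2_on \<Omega> u \<and> L2_on \<Omega> G \<and>
     (\<exists>\<phi> D. (\<forall>n::nat. test_function \<Omega> (\<phi> n) (D n)) \<and>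
        (\<lambda>n. LINT x|lebesgue_on \<Omega>. (\<phi> n x - u x)\<^sup>2) \<longlonglongrightarrow> 0 \<and>
        (\<lambda>n. LINT x|lebesgue_on \<Omega>. (norm (D n x - G x))\<^sup>2) \<longlonglongrightarrow> 0)"

text \<open>\<open>u\<close> is an $H^1_0(\Omega)$ weak solution of $-\Delta u = f$ in \<open>\<Omega>\<close>, $u = 0$ on the boundary.\<close>

definition dirichlet_solution :: "complex set \<Rightarrow> (complex \<Rightarrow> real) \<Rightarrow> (complex \<Rightarrow> real) \<Rightarrow> bool" where
  "dirichlet_solution \<Omega> f u \<longleftrightarrow>
     (\<exists>G. H10 \<Omega> u G \<and>
        (\<forall>\<psi> H. H10 \<Omega> \<psi> H \<longrightarrow>
           integrable (lebesgue_on \<Omega>) (\<lambda>x. f x * \<psi> x) \<and>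
           (LINT x|lebesgue_on \<Omega>. G x \<bullet> H x) = (LINT x|lebesgue_on \<Omega>. f x * \<psi> x)))"

definition exp_integral :: "complex set \<Rightarrow> (complex \<Rightarrow> real) \<Rightarrow> real" where
  "exp_integral \<Omega> u = (LINT x|lebesgue_on \<Omega>. exp (u x))"

definition weight :: "complex set \<Rightarrow> (complex \<Rightarrow> real) \<Rightarrow> complex \<Rightarrow> real" where
  "weight \<Omega> u x = exp (u x) / exp_integral \<Omega> u"

definition weighted_mean :: "complex set \<Rightarrow> (complex \<Rightarrow> real) \<Rightarrow> (complex \<Rightarrow> real) \<Rightarrow> real" where
  "weighted_mean \<Omega> u f = (LINT x|lebesgue_on \<Omega>. weight \<Omega> u x * f x)"

definition solves_P :: "real \<Rightarrow> complex set \<Rightarrow> (complex \<Rightarrow> real) \<Rightarrow> bool" where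
  "solves_P lam \<Omega> u \<longleftrightarrow> integrable (lebesgue_on \<Omega>) (\<lambda>x. exp (u x)) \<and>
     dirichlet_solution \<Omega> (\<lambda>x. lam * exp (u x) / exp_integral \<Omega> u) u"

definition solves_Q :: "real \<Rightarrow> complex set \<Rightarrow> (complex \<Rightarrow> real) \<Rightarrow> bool" where
  "solves_Q \<mu> \<Omega> u \<longleftrightarrow> integrable (lebesgue_on \<Omega>) (\<lambda>x. exp (u x)) \<and>
     dirichlet_solution \<Omega> (\<lambda>x. \<mu> * exp (u x)) u"

section \<open>Linearized problems\<close>

definition linearized_P ::
    "real \<Rightarrow> complex set \<Rightarrow> (complex \<Rightarrow> real) \<Rightarrow> real \<Rightarrow> (complex \<Rightarrow> real) \<Rightarrow> bool" where
  "linearized_P lam \<Omega> u \<tau> \<phi> \<longleftrightarrow>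
     dirichlet_solution \<Omega>
       (\<lambda>x. lam * weight \<Omega> u x * \<phi> x - lam * weight \<Omega> u x * weighted_mean \<Omega> u \<phi>
            + \<tau> * weight \<Omega> u x * \<phi> x) \<phi>"

definition linearized_Q ::
    "real \<Rightarrow> complex set \<Rightarrow> (complex \<Rightarrow> real) \<Rightarrow> real \<Rightarrow> (complex \<Rightarrow> real) \<Rightarrow> bool" where
  "linearized_Q \<mu> \<Omega> u \<nu> \<phi> \<longleftrightarrow>
     dirichlet_solution \<Omega> (\<lambda>x. \<mu> * exp (u x) * \<phi> x + \<nu> * exp (u x) * \<phi> x) \<phi>"

definition trivial_on :: "complex set \<Rightarrow> (complex \<Rightarrow> real) \<Rightarrow> bool" where
  "trivial_on \<Omega> \<phi> \<longleftrightarrow> (AE x in lebesgue_on \<Omega>. \<phi> x = 0)"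

definition eigenvalue_P :: "real \<Rightarrow> complex set \<Rightarrow> (complex \<Rightarrow> real) \<Rightarrow> real \<Rightarrow> bool" where
  "eigenvalue_P lam \<Omega> u \<tau> \<longleftrightarrow> (\<exists>\<phi>. linearized_P lam \<Omega> u \<tau> \<phi> \<and> \<not> trivial_on \<Omega> \<phi>)"

definition eigenvalue_Q :: "real \<Rightarrow> complex set \<Rightarrow> (complex \<Rightarrow> real) \<Rightarrow> real \<Rightarrow> bool" where
  "eigenvalue_Q \<mu> \<Omega> u \<nu> \<longleftrightarrow> (\<exists>\<phi>. linearized_Q \<mu> \<Omega> u \<nu> \<phi> \<and> \<not> trivial_on \<Omega> \<phi>)"

definition first_eigenvalue_P :: "real \<Rightarrow> complex set \<Rightarrow> (complex \<Rightarrow> real) \<Rightarrow> real \<Rightarrow> bool" where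
  "first_eigenvalue_P lam \<Omega> u \<tau> \<longleftrightarrow>
     eigenvalue_P lam \<Omega> u \<tau> \<and> (\<forall>\<sigma>. eigenvalue_P lam \<Omega> u \<sigma> \<longrightarrow> \<tau> \<le> \<sigma>)"

definition first_eigenvalue_Q :: "real \<Rightarrow> complex set \<Rightarrow> (complex \<Rightarrow> real) \<Rightarrow> real \<Rightarrow> bool" where
  "first_eigenvalue_Q \<mu> \<Omega> u \<nu> \<longleftrightarrow>
     eigenvalue_Q \<mu> \<Omega> u \<nu> \<and> (\<forall>\<sigma>. eigenvalue_Q \<mu> \<Omega> u \<sigma> \<longrightarrow> \<nu> \<le> \<sigma>)"

section \<open>Constants\<close>

definition mu_bar :: "real \<Rightarrow> real" where
  "mu_bar \<rho> = (1 + \<rho>\<^sup>2)\<^sup>2 / 2"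

definition gamma_plus :: "real \<Rightarrow> real \<Rightarrow> real" where
  "gamma_plus \<rho> \<mu> =
     sqrt ((2 * (1 + \<rho>\<^sup>2) - \<mu> - 2 * sqrt ((1 + \<rho>\<^sup>2)\<^sup>2 - 2 * \<mu>)) / (\<mu> + 4 * (1 - \<rho>\<^sup>2)))"

definition gamma_minus :: "real \<Rightarrow> real \<Rightarrow> real \<Rightarrow> real" where
  "gamma_minus \<rho> c \<mu> =
     sqrt ((\<mu> * c - 2 * (1 + \<rho>\<^sup>2) + 2 * sqrt ((1 + \<rho>\<^sup>2)\<^sup>2 - 2 * \<rho>\<^sup>2 * \<mu> * c))
           / (4 * (1 - \<rho>\<^sup>2) - \<mu> * c))"

definition lambda_lower :: "real \<Rightarrow> real \<Rightarrow> real" where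
  "lambda_lower \<rho> c =
     c * (1 + \<rho>\<^sup>2)\<^sup>2 / 2 * (pi / \<rho>) * (1 + (gamma_minus \<rho> c (mu_bar \<rho>))\<^sup>2)"

definition rho_star :: "real \<Rightarrow> real" where
  "rho_star c = (THE \<rho>. 0 < \<rho> \<and> \<rho> < 1 / (2 * sqrt 10) \<and> lambda_lower \<rho> c = 8 * pi)"

definition phi_N :: "real \<Rightarrow> real" where
  "phi_N N = (64 + 8192 * sqrt 2 / (pi * N)) / (pi * N - 64 - 8192 * sqrt 2 / (pi * N))"

definition N_bar :: real where
  "N_bar = (THE N. N > 512 / pi \<and> phi_N N = rho_star (1 / 4))"

section \<open>The solutions $u_{\rho,\mu,c}$ and $u^{(\lambda)}$\<close>

definition ell :: "real \<Rightarrow> complex \<Rightarrow> real" where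
  "ell \<rho> z = \<rho>\<^sup>2 * (Re z)\<^sup>2 + (Im z)\<^sup>2"

definition v_plus :: "real \<Rightarrow> real \<Rightarrow> complex \<Rightarrow> real" where
  "v_plus \<rho> \<mu> z =
     2 * ln ((1 + (gamma_plus \<rho> \<mu>)\<^sup>2) / (1 + (gamma_plus \<rho> \<mu>)\<^sup>2 * ell \<rho> z))"

definition v_minus :: "real \<Rightarrow> real \<Rightarrow> real \<Rightarrow> complex \<Rightarrow> real" where
  "v_minus \<rho> c \<mu> z =
     (if ell \<rho> z \<le> c
      then 2 * ln ((1 + (gamma_minus \<rho> c \<mu>)\<^sup>2) / (1 + (gamma_minus \<rho> c \<mu>)\<^sup>2 / c * ell \<rho> z))
      else 0)"

text \<open>\<open>u\<close> is the solution $u_{\rho,\mu,c}$ on a domain with $\beta_+ = 1$. A solution of the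
  sub-supersolution method is a solution in the order interval between the two barriers; for the
  parameters in question there is exactly one. The value \<open>\<mu> = 0\<close> corresponds to $u^{(0)} = 0$.\<close>

definition normalized_solution ::
    "complex set \<Rightarrow> real \<Rightarrow> real \<Rightarrow> real \<Rightarrow> (complex \<Rightarrow> real) \<Rightarrow> bool" where
  "normalized_solution \<Omega> \<rho> c \<mu> u \<longleftrightarrow>
     \<mu> = 0 \<and> trivial_on \<Omega> u \<or>
     0 < \<mu> \<and> \<mu> \<le> mu_bar \<rho> \<and> solves_Q \<mu> \<Omega> u \<and>
       (AE x in lebesgue_on \<Omega>. v_minus \<rho> c \<mu> x \<le> u x \<and> u x \<le> v_plus \<rho> \<mu> x)"

text \<open>\<open>\<beta>p\<close> is $\beta_+$. The function \<open>u\<close> on \<open>\<Omega>\<close> is $u^{(\lambda)}$, the dilate of the normalized solution on $\beta_+^{-1}\Omega$ whose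
  parameter \<open>m\<close> satisfies $\lambda_{\rho,c}(m) = \lambda$. (The parameter of \<open>u\<close> itself as a solution
  of $Q(\mu,\Omega)$ is $\mu = m / \beta_+^2$.)\<close>

definition branch_solution ::
    "complex set \<Rightarrow> real \<Rightarrow> real \<Rightarrow> real \<Rightarrow> real \<Rightarrow> (complex \<Rightarrow> real) \<Rightarrow> bool" where
  "branch_solution \<Omega> \<rho> c \<beta>p lam u \<longleftrightarrow>
     (\<exists>m. normalized_solution ((\<lambda>z. z /\<^sub>R \<beta>p) ` \<Omega>) \<rho> c m (\<lambda>z. u (\<beta>p *\<^sub>R z)) \<and>
          lam = m * exp_integral ((\<lambda>z. z /\<^sub>R \<beta>p) ` \<Omega>) (\<lambda>z. u (\<beta>p *\<^sub>R z)))"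

text \<open>\<open>\<Lambda>\<close> is the threshold $\lambda_{\rho,c} = \lambda_{\rho,c}(\overline\mu_\rho)$.\<close>

definition branch_threshold :: "complex set \<Rightarrow> real \<Rightarrow> real \<Rightarrow> real \<Rightarrow> real \<Rightarrow> bool" where
  "branch_threshold \<Omega> \<rho> c \<beta>p \<Lambda> \<longleftrightarrow>
     (\<exists>w. normalized_solution ((\<lambda>z. z /\<^sub>R \<beta>p) ` \<Omega>) \<rho> c (mu_bar \<rho>) w \<and>
          \<Lambda> = mu_bar \<rho> * exp_integral ((\<lambda>z. z /\<^sub>R \<beta>p) ` \<Omega>) w)"

section \<open>John ellipse\<close>

definition is_ellipse :: "complex set \<Rightarrow> bool" where
  "is_ellipse E \<longleftrightarrow> (\<exists>p (L :: complex \<Rightarrow> complex). linear L \<and> bij L \<and> E = (\<lambda>z. p + L z) ` cball 0 1)"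

text \<open>Ellipses are closed and inscribed in the closure, since the maximal one touches the boundary.\<close>

definition john_ellipse :: "complex set \<Rightarrow> complex set \<Rightarrow> bool" where
  "john_ellipse \<Omega> E \<longleftrightarrow> is_ellipse E \<and> E \<subseteq> closure \<Omega> \<and>
     (\<forall>E'. is_ellipse E' \<and> E' \<subseteq> closure \<Omega> \<longrightarrow> measure lebesgue E' \<le> measure lebesgue E)"

definition rigid_motion :: "real \<Rightarrow> complex \<Rightarrow> complex \<Rightarrow> complex" where
  "rigid_motion \<alpha> p z = cis \<alpha> * z + p"

end

theory Submission
  imports Defs "HOL-Complex_Analysis.Great_Picard"
begin

text \<open>Write $w = e^u$. Since $\lambda\omega(u) = \mu w$, both linearized problems are of the form
  $-\Delta\varphi + s\,w \int w\varphi = \kappa w\varphi$ with $s \ge 0$, and it is enough to show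
  that every eigenvalue satisfies $\kappa > \mu$. The nonlocal term is nonnegative, so this follows
  from $\int \mu e^u\varphi^2 \le \frac{8}{9}\int|\nabla\varphi|^2$. When $\beta_+ = 1$ the upper
  barrier gives $\mu e^u \le \mu(1 + \gamma_+^2)^2 \le 2$ as soon as $\rho \le 2/5$, whereas
  $\Omega$ lies in the strip $|y| \le 1$, where the Poincare inequality holds with constant
  $9/4 < \pi^2/4$. In the convex case $\rho \le 2/5$ follows from $N(\Omega) > 512/\pi$ by comparing
  length and area of $\Omega$ with those of boxes outside and inside. First eigenvalues exist because
  the Rayleigh quotient attains its minimum, by Rellich's theorem.\<close>

section \<open>The constants\<close>

text \<open>The thresholds of the statement leave a lot of room, and the proof lives on it: the only
  facts extracted from the constants are \<open>rho_star c < 0.16\<close> and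
  \<open>N_bar > 512 / pi\<close>. Both numbers are definite descriptions, however, so even these
  bounds need existence and uniqueness, that is, monotonicity and the intermediate value theorem.
  The value 2/5 serves both halves. It exceeds 0.16, and it exceeds (3 - sqrt 5) / 2 = 0.38..., the
  axis ratio at which the crude bounds on length and area give an isoperimetric ratio of 160, which
  is at most 512 / pi. At 2/5 the quantity \<open>m * (1 + gamma_plus^2)^2\<close> is still below
  1.52. The constant 9/4 is the square of 3/2 < pi / 2, and 8/9 is 2 divided by 9/4.
  \<open>H10\<close> is described by approximating sequences, so every inequality is proved for test
  functions and carried to the limit. Dilation and rigid motion are treated at once: in both halves
  the domain is an image under \<open>z -> t + a * z\<close> of a normalized domain, with complex
  \<open>a\<close>.\<close>

definition lamK :: "real \<Rightarrow> real \<Rightarrow> real" where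
  "lamK c \<rho> = 4 * (\<rho> * (1 - \<rho>\<^sup>2)) / (1 + \<rho>\<^sup>2)\<^sup>2 - c * \<rho> / 2"

text \<open>At \<open>mu_bar\<close> the square of \<open>gamma_minus\<close> is a quotient
  \<open>n / D\<close>, so \<open>1 + gamma_minus^2 = (n + D) / D\<close>. Here \<open>lamN\<close>
  is \<open>n + D\<close>, and \<open>lamK\<close> is \<open>D\<close> multiplied by
  \<open>rho / (1 + rho^2)^2\<close>. Grouped in this way, numerator and denominator are monotone in
  opposite directions.\<close>

definition lamN :: "real \<Rightarrow> real \<Rightarrow> real" where
  "lamN c \<rho> = 4 - 4 * \<rho>\<^sup>2 - 2 * (1 + \<rho>\<^sup>2) * (1 - sqrt (1 - \<rho>\<^sup>2 * c))"

lemma rho_max_square: "0 < \<rho> \<Longrightarrow> \<rho> \<le> 1 / (2 * sqrt 10) \<Longrightarrow> \<rho>\<^sup>2 \<le> 1 / 40"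
  using power_mono[of \<rho> "1 / (2 * sqrt 10)" 2] by (simp add: power_divide power_mult_distrib)

lemma rho_max_bounds: "(15 / 100 :: real) < 1 / (2 * sqrt 10)" "1 / (2 * sqrt 10) < (16 / 100 :: real)"
proof -
  have "sqrt 10 < 33 / 10"
    by (rule real_less_lsqrt) (auto simp: power2_eq_square)
  moreover have "315 / 100 < sqrt 10"
    by (rule real_less_rsqrt) (auto simp: power2_eq_square)
  ultimately show "(15 / 100 :: real) < 1 / (2 * sqrt 10)" "1 / (2 * sqrt 10) < (16 / 100 :: real)"
    by (auto simp: field_simps)
qed

lemma lambda_lower_eq:
  assumes c: "0 < c" "c \<le> 1" and \<rho>: "0 < \<rho>" "\<rho>\<^sup>2 \<le> 1 / 40"
  shows "lambda_lower \<rho> c = c * pi / 2 * lamN c \<rho> / lamK c \<rho>" "0 < lamK c \<rho>"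
proof -
  define r where "r = \<rho>\<^sup>2"
  define s where "s = sqrt (1 - r * c)"
  have r: "0 < r" "r \<le> 1 / 40" using \<rho> by (auto simp: r_def)
  have rc: "0 \<le> r * c" "r * c \<le> 1 / 40"
    using c r mult_mono[of r "1/40" c 1] by auto
  define D where "D = 4 * (1 - r) - (1 + r)\<^sup>2 / 2 * c"
  have A2: "(1 + r)\<^sup>2 \<le> 2" using r power_mono[of "1 + r" "41/40" 2] by (simp add: power2_eq_square)
  have "(1 + r)\<^sup>2 / 2 * c \<le> 1 * 1" using A2 c by (intro mult_mono) auto
  then have D: "0 < D" using r by (simp add: D_def)
  have s1: "s \<le> 1" unfolding s_def using rc by simp
  \<comment> \<open>A number in [0,1] is at most its square root.\<close>
  have s2: "1 - r * c \<le> s"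
  proof -
    have "(1 - r * c)\<^sup>2 \<le> 1 - r * c"
      unfolding power2_eq_square using rc by (intro mult_left_le_one_le) auto
    then show ?thesis unfolding s_def by (rule real_le_rsqrt)
  qed
  have sq: "sqrt ((1 + \<rho>\<^sup>2)\<^sup>2 - 2 * \<rho>\<^sup>2 * mu_bar \<rho> * c) = (1 + r) * s"
  proof -
    have "(1 + \<rho>\<^sup>2)\<^sup>2 - 2 * \<rho>\<^sup>2 * mu_bar \<rho> * c = (1 + r)\<^sup>2 * (1 - r * c)"
      by (simp add: mu_bar_def r_def algebra_simps power2_eq_square)
    then show ?thesis using r by (simp add: real_sqrt_mult s_def)
  qed
  define n where "n = (1 + r)\<^sup>2 / 2 * c - 2 * (1 + r) + 2 * ((1 + r) * s)"
  \<comment> \<open>\<open>gamma_minus\<close> is a square root, so squaring it returns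
    \<open>n / D\<close> only if this quotient is nonnegative.\<close>
  have "n \<ge> 0"
  proof -
    have "n \<ge> (1 + r)\<^sup>2 / 2 * c - 2 * (1 + r) + 2 * ((1 + r) * (1 - r * c))"
      unfolding n_def using s2 r by (intro add_left_mono mult_left_mono) auto
    also have "(1 + r)\<^sup>2 / 2 * c - 2 * (1 + r) + 2 * ((1 + r) * (1 - r * c)) = (1 + r) * c * ((1 + r) / 2 - 2 * r)"
      by (simp add: algebra_simps power2_eq_square)
    also have "\<dots> \<ge> 0" using r c by (intro mult_nonneg_nonneg) auto
    finally show ?thesis by simp
  qed
  have g: "(gamma_minus \<rho> c (mu_bar \<rho>))\<^sup>2 = n / D"
  proof -
    have "mu_bar \<rho> * c - 2 * (1 + \<rho>\<^sup>2) + 2 * ((1 + r) * s) = n" "4 * (1 - \<rho>\<^sup>2) - mu_bar \<rho> * c = D"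
      by (simp_all add: n_def D_def mu_bar_def r_def)
    then show ?thesis unfolding gamma_minus_def sq using \<open>n \<ge> 0\<close> D by simp
  qed
  have nD: "n + D = lamN c \<rho>" by (simp add: n_def D_def lamN_def r_def s_def algebra_simps)
  have K: "lamK c \<rho> = \<rho> * D / (1 + r)\<^sup>2"
  proof -
    have "(1 + r)\<^sup>2 > 0" using r by simp
    then show ?thesis by (simp add: lamK_def D_def r_def[symmetric] field_simps)
  qed
  show "0 < lamK c \<rho>" unfolding K using \<rho> D r by (intro divide_pos_pos mult_pos_pos) auto
  have "1 + n / D = lamN c \<rho> / D" using D nD by (simp add: field_simps)
  then show "lambda_lower \<rho> c = c * pi / 2 * lamN c \<rho> / lamK c \<rho>"
    unfolding lambda_lower_def g K r_def[symmetric] using \<rho> D r by (simp add: field_simps)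
qed

text \<open>For \<open>rho^2 <= 1/40\<close> the derivative of the fraction in \<open>lamK\<close>
  exceeds 1, whereas the linear term takes away only \<open>c / 2 <= 1/2\<close>.\<close>

lemma lamK_strict_mono:
  assumes c: "0 < c" "c \<le> 1" and xy: "0 < x" "x < y" "y\<^sup>2 \<le> 1 / 40"
  shows "lamK c x < lamK c y"
proof (rule DERIV_pos_imp_increasing[OF xy(2)])
  fix z assume z: "x \<le> z" "z \<le> y"
  have "z\<^sup>2 \<le> y\<^sup>2" using z xy by (intro power_mono) auto
  then have z2: "z\<^sup>2 \<le> 1 / 40" using xy by simp
  have nz: "1 + z\<^sup>2 > 0" by (simp add: add_pos_nonneg)
  have "(lamK c has_real_derivative
     ((4 - 12 * z\<^sup>2) * (1 + z\<^sup>2)\<^sup>2 - 4 * (z * (1 - z\<^sup>2)) * (4 * z * (1 + z\<^sup>2))) / ((1 + z\<^sup>2)\<^sup>2)\<^sup>2 - c / 2) (at z)"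
    unfolding lamK_def using nz
    by (auto intro!: derivative_eq_intros) (simp add: power2_eq_square algebra_simps)
  moreover have "((4 - 12 * z\<^sup>2) * (1 + z\<^sup>2)\<^sup>2 - 4 * (z * (1 - z\<^sup>2)) * (4 * z * (1 + z\<^sup>2))) / ((1 + z\<^sup>2)\<^sup>2)\<^sup>2 - c / 2 > 0"
  proof -
    define r where "r = z\<^sup>2"
    have r: "0 \<le> r" "r \<le> 1 / 40" using z2 by (auto simp: r_def)
    have "(1 + r) ^ 4 \<le> (41 / 40) ^ 4" using r by (intro power_mono) auto
    also have "\<dots> \<le> 2" by (simp add: power4_eq_xxxx)
    finally have p4: "((1 + r)\<^sup>2)\<^sup>2 \<le> 2" by (simp flip: power_mult)
    have "1 \<le> (1 + r)\<^sup>2" using r by simp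
    then have 1: "(4 - 12 * r) * 1 \<le> (4 - 12 * r) * (1 + r)\<^sup>2" using r by (intro mult_left_mono) auto
    have "r * ((1 - r) * (1 + r)) \<le> 1 / 40 * (1 * (41/40))" using r by (intro mult_mono) auto
    then have 2: "16 * (r * ((1 - r) * (1 + r))) \<le> 1" by simp
    have "(4 - 12 * r) * (1 + r)\<^sup>2 - 16 * (r * ((1 - r) * (1 + r))) > 2"
    proof -
      have "a - b > 2" if "(4 - 12 * r) * 1 \<le> a" "b \<le> 1" for a b :: real using that r by auto
      from this[OF 1 2] show ?thesis .
    qed
    moreover have "((1 + r)\<^sup>2)\<^sup>2 > 0" using r by simp
    ultimately have X: "((4 - 12 * r) * (1 + r)\<^sup>2 - 16 * (r * ((1 - r) * (1 + r)))) / ((1 + r)\<^sup>2)\<^sup>2 > 1"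
      using p4 by (simp add: less_divide_eq)
    have e: "4 * (z * (1 - z\<^sup>2)) * (4 * z * (1 + z\<^sup>2)) = 16 * (r * ((1 - r) * (1 + r)))"
      unfolding r_def power2_eq_square by algebra
    show ?thesis unfolding e unfolding r_def[symmetric] using X c by linarith
  qed
  ultimately show "\<exists>k. (lamK c has_real_derivative k) (at z) \<and> 0 < k" by blast
qed

lemma lamN_bounds:
  assumes c: "0 < c" "c \<le> 1" and \<rho>: "\<rho>\<^sup>2 \<le> 1 / 40"
  shows "3 \<le> lamN c \<rho>" "lamN c \<rho> \<le> 4"
proof -
  have rc: "0 \<le> \<rho>\<^sup>2 * c" "\<rho>\<^sup>2 * c \<le> 1 / 40"
    using c \<rho> mult_mono[of "\<rho>\<^sup>2" "1/40" c 1] by auto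
  have s: "sqrt (1 - \<rho>\<^sup>2 * c) \<le> 1" using rc by simp
  have "(9/10)\<^sup>2 \<le> 1 - \<rho>\<^sup>2 * c" using rc by (simp add: power2_eq_square)
  then have s': "9/10 \<le> sqrt (1 - \<rho>\<^sup>2 * c)" by (rule real_le_rsqrt)
  have "(1 + \<rho>\<^sup>2) * (1 - sqrt (1 - \<rho>\<^sup>2 * c)) \<le> (41/40) * (1/10)"
    using s s' \<rho> by (intro mult_mono) auto
  then show "3 \<le> lamN c \<rho>" unfolding lamN_def using \<rho> by linarith
  have "(1 + \<rho>\<^sup>2) * (1 - sqrt (1 - \<rho>\<^sup>2 * c)) \<ge> 0" using s by simp
  then show "lamN c \<rho> \<le> 4" unfolding lamN_def using zero_le_power2[of \<rho>] by linarith
qed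

text \<open>The numerator \<open>lamN\<close> is positive and nonincreasing, the denominator
  \<open>lamK\<close> is positive and strictly increasing. This gives the uniqueness in the
  definition of \<open>rho_star\<close>.\<close>

lemma lambda_lower_strict_antimono:
  assumes c: "0 < c" "c \<le> 1" and xy: "0 < x" "x < y" "y\<^sup>2 \<le> 1 / 40"
  shows "lambda_lower y c < lambda_lower x c"
proof -
  have le: "x\<^sup>2 \<le> y\<^sup>2" using xy by (intro power_mono) auto
  have x2: "x\<^sup>2 \<le> 1 / 40" using le xy(3) by linarith
  have "sqrt (1 - y\<^sup>2 * c) \<le> sqrt (1 - x\<^sup>2 * c)" using le c by (simp add: mult_right_mono)
  moreover have "sqrt (1 - x\<^sup>2 * c) \<le> 1" using c by simp
  ultimately have "(1 + x\<^sup>2) * (1 - sqrt (1 - x\<^sup>2 * c)) \<le> (1 + y\<^sup>2) * (1 - sqrt (1 - y\<^sup>2 * c))"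
    using le by (intro mult_mono) auto
  then have N: "lamN c y \<le> lamN c x" using le unfolding lamN_def by linarith
  have K: "lamK c x < lamK c y" by (rule lamK_strict_mono) fact+
  have Kx: "0 < lamK c x" using lambda_lower_eq(2)[OF c xy(1) x2] .
  have "lamN c y / lamK c y < lamN c x / lamK c x"
    using N K Kx lamN_bounds(1)[OF c xy(3)] by (intro frac_less2) auto
  then have "c * pi / 2 * (lamN c y / lamK c y) < c * pi / 2 * (lamN c x / lamK c x)"
    using c by (intro mult_strict_left_mono) auto
  then show ?thesis
    using lambda_lower_eq(1)[OF c _ xy(3)] lambda_lower_eq(1)[OF c xy(1) x2] xy by simp
qed

text \<open>Nothing is known about a definite description before existence and uniqueness are
  established; the bounds then come from the interval on which the intermediate value theorem finds
  the root.\<close>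

lemma rho_star_bounds:
  assumes c: "0 < c" "c \<le> 1"
  shows "0 < rho_star c" "rho_star c < 1 / (2 * sqrt 10)"
proof -
  define e :: real where "e = 1 / (2 * sqrt 10)"
  have e: "15 / 100 < e" "e < 16 / 100" "e\<^sup>2 = 1 / 40"
    using rho_max_bounds by (auto simp: e_def power_divide power_mult_distrib)
  let ?L = "\<lambda>\<rho>. c * pi / 2 * lamN c \<rho> / lamK c \<rho>"
  \<comment> \<open>At this left endpoint \<open>lamK <= 4 * ?d = c / 8\<close> and
    \<open>lamN >= 3\<close>, so the value is at least 12 pi. At the right endpoint
    \<open>lamN <= 4\<close> and \<open>lamK >= 0.48 * c\<close> keep it below 5 pi. The level 8 pi
    lies between.\<close>
  let ?d = "c / 32"
  have sq: "x\<^sup>2 \<le> 1 / 40" if "0 < x" "x \<le> e" for x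
    using rho_max_square that by (simp add: e_def)
  have d: "0 < ?d" "?d \<le> e" using c e by auto
  have He: "?L e < 8 * pi"
  proof -
    have K: "48 / 100 * c \<le> lamK c e"
    proof -
      have Ke: "lamK c e = e * (4 * (39 / 40) / (41 / 40)\<^sup>2 - c / 2)"
        by (simp add: lamK_def e(3) algebra_simps)
      have "(15/100) * (32 / 10) \<le> e * (4 * (39 / 40) / (41 / 40)\<^sup>2 - c / 2)"
        by (rule mult_mono) (use e c in \<open>auto simp: power2_eq_square\<close>)
      then show ?thesis using c Ke by linarith
    qed
    have "c * pi / 2 * lamN c e / lamK c e \<le> c * pi / 2 * 4 / (48 / 100 * c)"
      using K c lamN_bounds(2)[OF c sq[of e]] lamN_bounds(1)[OF c sq[of e]] e by (intro frac_le mult_left_mono) auto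
    also have "\<dots> < 8 * pi" using c by (simp add: field_simps)
    finally show ?thesis .
  qed
  have Hd: "8 * pi < ?L ?d"
  proof -
    have K0: "0 < lamK c ?d" using lambda_lower_eq(2)[OF c d(1) sq[OF d]] .
    have "lamK c ?d \<le> 4 * ?d"
    proof -
      have "?d * (1 - ?d\<^sup>2) / (1 + ?d\<^sup>2)\<^sup>2 \<le> ?d * 1 / 1"
        using d sq[OF d] by (intro frac_le mult_left_mono) auto
      moreover have "0 \<le> c * ?d / 2" using c by simp
      ultimately show ?thesis unfolding lamK_def times_divide_eq_right[symmetric] by linarith
    qed
    then have "c * pi / 2 * 3 / (4 * ?d) \<le> ?L ?d"
      using K0 lamN_bounds(1)[OF c sq[OF d]] c by (intro frac_le mult_left_mono) auto
    moreover have "8 * pi < c * pi / 2 * 3 / (4 * ?d)" using c by (simp add: field_simps)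
    ultimately show ?thesis by linarith
  qed
  have cont: "continuous_on {?d..e} ?L"
  proof -
    have "lamK c x \<noteq> 0" if "x \<in> {?d..e}" for x
      using lambda_lower_eq(2)[OF c, of x] sq[of x] that d by force
    moreover have "continuous_on {?d..e} (lamN c)" "continuous_on {?d..e} (lamK c)"
      unfolding lamN_def lamK_def
      by (auto intro!: continuous_intros simp: add_nonneg_eq_0_iff)
    ultimately show ?thesis by (intro continuous_intros) auto
  qed
  obtain x where x: "?d \<le> x" "x \<le> e" "?L x = 8 * pi"
    using IVT2'[of ?L e "8 * pi" ?d] He Hd cont d by auto
  have x0: "0 < x" using x d by simp
  have xe: "x < e" using x(2,3) He by (cases "x = e") auto
  have Lx: "lambda_lower x c = 8 * pi" using x lambda_lower_eq(1)[OF c x0 sq] x0 by simp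
  have "rho_star c = x"
    unfolding rho_star_def
  proof (rule the_equality)
    show "0 < x \<and> x < 1 / (2 * sqrt 10) \<and> lambda_lower x c = 8 * pi" using x0 xe Lx by (simp add: e_def)
    fix y assume y: "0 < y \<and> y < 1 / (2 * sqrt 10) \<and> lambda_lower y c = 8 * pi"
    then have "y\<^sup>2 \<le> 1 / 40" by (intro sq) (auto simp: e_def)
    then show "y = x"
      using lambda_lower_strict_antimono[OF c, of x y] lambda_lower_strict_antimono[OF c, of y x] y Lx x0 sq[of x] x
      by (cases x y rule: linorder_cases) auto
  qed
  then show "0 < rho_star c" "rho_star c < 1 / (2 * sqrt 10)" using x0 xe by (auto simp: e_def)
qed

section \<open>The function \<open>phi_N\<close> and the lower bound on \<open>N_bar\<close>\<close>

lemma phi_N_strict_antimono: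
  assumes "512 / pi \<le> M" "M < N"
  shows "phi_N N < phi_N M" "0 < phi_N N"
proof -
  have s2: "0 < sqrt (2::real)" "sqrt 2 \<le> (3/2::real)" using real_le_lsqrt[of "3/2" 2] by (auto simp: power2_eq_square)
  have M: "512 \<le> pi * M" "pi * M < pi * N"
    using assms by (auto simp: field_simps)
  then have pos: "0 < pi * N * (pi * M)" by (intro mult_pos_pos[of "pi * N" "pi * M"]) linarith+
  have q: "8192 * sqrt 2 / (pi * N) < 8192 * sqrt 2 / (pi * M)"
    by (rule divide_strict_left_mono[OF M(2) _ pos]) (use s2 in simp)
  have piN: "0 < pi * N" using M by linarith
  \<comment> \<open>For \<open>pi * M >= 512\<close> this term is at most 24, so the denominators of
    \<open>phi_N\<close> stay above 400.\<close>
  have qM: "8192 * sqrt 2 / (pi * M) \<le> 8192 * (3/2) / 512"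
    using M s2 by (intro frac_le) auto
  have q0: "8192 * sqrt 2 / (pi * N) > 0" using piN s2 by (intro divide_pos_pos) auto
  show "phi_N N < phi_N M" unfolding phi_N_def
    by (rule frac_less) (use q qM q0 M in linarith)+
  show "0 < phi_N N" unfolding phi_N_def by (rule divide_pos_pos) (use q qM q0 M in linarith)+
qed

text \<open>At \<open>pi * N = 512\<close> the value of \<open>phi_N\<close> exceeds 0.2, hence
  \<open>rho_star (1/4) < 0.16\<close>; since \<open>phi_N\<close> decreases, the root lies strictly
  to the right. This bound is what the convex case extracts from \<open>N_bar\<close>.\<close>

lemma N_bar_gt: "512 / pi < N_bar"
proof -
  define t where "t = rho_star (1/4)"
  have t: "0 < t" "t < 16/100" using rho_star_bounds[of "1/4"] rho_max_bounds by (auto simp: t_def)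
  have s2: "0 < sqrt (2::real)" "sqrt 2 \<le> (3/2::real)" using real_le_lsqrt[of "3/2" 2] by (auto simp: power2_eq_square)
  have s14: "(14/10::real) \<le> sqrt 2" by (rule real_le_rsqrt) (simp add: power2_eq_square)
  define a where "a = 512 / pi"
  \<comment> \<open>The right endpoint depends on \<open>t\<close>, so that \<open>phi_N b\<close>
    is at most \<open>100 / (1000 / t) = t / 10\<close>.\<close>
  define b where "b = (1000 + 1000 / t) / pi"
  have ab: "a < b" using t by (simp add: a_def b_def divide_strict_right_mono add_pos_pos)
  have pa: "pi * a = 512" "pi * b = 1000 + 1000 / t" by (auto simp: a_def b_def)
  have Ha: "t < phi_N a"
  proof -
    have "16/100 < (64 + 8192 * (14/10) / 512) / (512 - 64 - 8192 * (14/10) / (512::real))" by simp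
    also have "\<dots> \<le> phi_N a" unfolding phi_N_def pa
      using s14 s2 by (intro frac_le) auto
    finally show ?thesis using t by simp
  qed
  have Hb: "phi_N b < t"
  proof -
    define q where "q = 8192 * sqrt 2 / (1000 + 1000 / t)"
    have "1000 + 1000 / t \<ge> 1000" using t by simp
    then have "q \<le> 8192 * (3/2) / 1000" unfolding q_def using s2 t by (intro frac_le) auto
    moreover have "0 \<le> q" unfolding q_def using s2 t by (intro divide_nonneg_nonneg) auto
    ultimately    have q: "0 \<le> q" "q \<le> 13" by auto
    have "phi_N b = (64 + q) / (1000 + 1000 / t - 64 - q)" unfolding phi_N_def pa q_def ..
    also have "\<dots> \<le> 100 / (1000 / t)" using q t by (intro frac_le) auto
    also have "\<dots> < t" using t by simp
    finally show ?thesis .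
  qed
  have cont: "continuous_on {a..b} phi_N"
  proof -
    have "pi * N - 64 - 8192 * sqrt 2 / (pi * N) \<noteq> 0 \<and> N \<noteq> 0" if "N \<in> {a..b}" for N
    proof -
      have "pi * N \<ge> 512" using that pa pi_gt_zero by (metis atLeastAtMost_iff mult_le_cancel_left_pos)
      moreover then have "8192 * sqrt 2 / (pi * N) \<le> 8192 * (3/2) / 512" using s2 by (intro frac_le) auto
      ultimately show ?thesis by auto
    qed
    then show ?thesis unfolding phi_N_def by (intro continuous_intros) auto
  qed
  obtain N where N: "a \<le> N" "N \<le> b" "phi_N N = t"
    using IVT2'[of phi_N b t a] Ha Hb cont ab by auto
  have aN: "a < N" using N Ha by (cases "a = N") auto
  have "N_bar = N" unfolding N_bar_def
  proof (rule the_equality)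
    show "512 / pi < N \<and> phi_N N = rho_star (1/4)" using aN N by (simp add: a_def t_def)
    fix y assume y: "512 / pi < y \<and> phi_N y = rho_star (1/4)"
    then show "y = N"
      using phi_N_strict_antimono(1)[of y N] phi_N_strict_antimono(1)[of N y] aN N
      by (cases y N rule: linorder_cases) (auto simp: a_def t_def)
  qed
  then show ?thesis using aN by (simp add: a_def)
qed

text \<open>Everything is expressed through the root \<open>s\<close> occurring in
  \<open>gamma_plus\<close>, since \<open>m = (A^2 - s^2) / 2\<close> is polynomial in it. For
  \<open>rho <= 2/5\<close> this gives \<open>A <= 1.16\<close>, \<open>gamma_plus^2 <= 1/2\<close>
  and \<open>m <= 0.673\<close>.\<close>

lemma gamma_plus_bounds:
  assumes "0 < \<rho>" "\<rho> \<le> 1" "0 < m" "m \<le> mu_bar \<rho>"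
  shows "0 < (gamma_plus \<rho> m)\<^sup>2"
    and "\<rho> \<le> 2 / 5 \<Longrightarrow> m * (1 + (gamma_plus \<rho> m)\<^sup>2)\<^sup>2 \<le> 2"
proof -
  define A where "A = 1 + \<rho>\<^sup>2"
  define s where "s = sqrt (A\<^sup>2 - 2 * m)"
  have r: "0 < \<rho>\<^sup>2" "\<rho>\<^sup>2 \<le> 1" using assms power_mono[of \<rho> 1 2] by auto
  then have A: "1 < A" "A \<le> 2" by (auto simp: A_def)
  have "2 * m \<le> A\<^sup>2" using assms by (simp add: mu_bar_def A_def)
  then have s: "0 \<le> s" "s\<^sup>2 = A\<^sup>2 - 2 * m" by (auto simp: s_def)
  have sA: "s < A" using s assms A by (intro power2_less_imp_less[of s A]) auto
  have m2: "m = (A\<^sup>2 - s\<^sup>2) / 2" using s(2) by simp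
  have m: "m = (A - s) * (A + s) / 2" unfolding m2 by (simp add: algebra_simps power2_eq_square)
  define n where "n = 2 * A - m - 2 * s"
  \<comment> \<open>The factorization shows the sign: \<open>s < A <= 2\<close> makes both factors
    positive, and with them the radicand of \<open>gamma_plus\<close>.\<close>
  have n: "n = (A - s) * (4 - A - s) / 2" unfolding n_def m by (simp add: algebra_simps add_divide_distrib diff_divide_distrib)
  have "0 < (A - s) * (4 - A - s)" using sA A by (intro mult_pos_pos) auto
  then have n0: "0 < n" unfolding n by simp
  have dd: "4 * (2 - A) < m + 4 * (2 - A)" "0 \<le> 4 * (2 - A)" using assms A by auto
  have g: "(gamma_plus \<rho> m)\<^sup>2 = n / (m + 4 * (2 - A))"
    using n0 dd by (simp add: gamma_plus_def n_def s_def A_def add.commute)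
  show "0 < (gamma_plus \<rho> m)\<^sup>2" unfolding g using n0 dd by auto
  assume "\<rho> \<le> 2 / 5"
  then have "\<rho>\<^sup>2 \<le> (2/5)\<^sup>2" using assms by (intro power_mono) auto
  then have A': "A \<le> 116 / 100" by (simp add: A_def power2_eq_square)
  \<comment> \<open>Dropping the nonnegative term \<open>s * (4 - s) / 2\<close> amounts to taking
    \<open>s = 0\<close>, the value at \<open>m = mu_bar\<close>.\<close>
  have "n \<le> 2 * A - A\<^sup>2 / 2"
  proof -
    have "n = 2 * A - A\<^sup>2 / 2 - s * (4 - s) / 2" unfolding n_def m2 by (simp add: algebra_simps power2_eq_square add_divide_distrib diff_divide_distrib)
    then show ?thesis using s sA A by simp
  qed
  also have "\<dots> = 2 - (2 - A)\<^sup>2 / 2" by (simp add: power2_eq_square algebra_simps add_divide_distrib diff_divide_distrib)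
  also have "\<dots> \<le> 2 - (84/100)\<^sup>2 / 2" using A' power_mono[of "84/100" "2 - A" 2] by simp
  finally have "n / (m + 4 * (2 - A)) \<le> (2 - (84/100)\<^sup>2 / 2) / (4 * (84/100))"
    using dd A' n0 by (intro frac_le) auto
  also have "\<dots> \<le> 1/2" by (simp add: power2_eq_square)
  finally have g2: "(gamma_plus \<rho> m)\<^sup>2 \<le> 1/2" unfolding g .
  have "m \<le> (116/100)\<^sup>2 / 2"
  proof -
    have "A\<^sup>2 \<le> (116/100)\<^sup>2" using A A' by (intro power_mono) auto
    then show ?thesis using assms(4) unfolding mu_bar_def A_def by linarith
  qed
  then have "m * (1 + (gamma_plus \<rho> m)\<^sup>2)\<^sup>2 \<le> ((116/100)\<^sup>2 / 2) * (1 + 1/2)\<^sup>2"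
    using g2 assms by (intro mult_mono power_mono) auto
  also have "\<dots> \<le> 2" by (simp add: power2_eq_square)
  finally show "m * (1 + (gamma_plus \<rho> m)\<^sup>2)\<^sup>2 \<le> 2" .
qed

section \<open>Length of a convex boundary curve\<close>

lemma sorted_gap_disjoint:
  fixes ts :: "real list"
  assumes "sorted ts" "i < j" "Suc j < length ts" "x \<in> {ts ! i<..<ts ! Suc i}" "y \<in> {ts ! j<..<ts ! Suc j}"
  shows "x < y"
  using sorted_nth_mono[of ts "Suc i" j] assms by auto

text \<open>Integrate over the level $s$ the number of sampling intervals whose image crosses $s$: each
  crossing contributes its own preimage of $s$.\<close>

lemma variation_le_of_two_point_levels:
  fixes f :: "real \<Rightarrow> real"
  assumes cont: "continuous_on {0..1} f" and rng: "f ` {0..1} \<subseteq> {A..B}" and AB: "A \<le> B"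
    and lev: "\<And>s. A < s \<Longrightarrow> s < B \<Longrightarrow> finite {t\<in>{0<..<1}. f t = s} \<and> card {t\<in>{0<..<1}. f t = s} \<le> 2"
    and ts: "sorted ts" "set ts \<subseteq> {0..1}"
  shows "(\<Sum>i<length ts - 1. \<bar>f (ts ! i) - f (ts ! Suc i)\<bar>) \<le> 2 * (B - A)"
proof -
  define n where "n = length ts - 1"
  define I where "I i = {min (f (ts ! i)) (f (ts ! Suc i))<..<max (f (ts ! i)) (f (ts ! Suc i))}" for i
  have t01: "ts ! i \<in> {0..1}" if "i \<le> n" "n \<noteq> 0" for i using that ts by (auto simp: n_def subset_iff)
  have mono: "ts ! i \<le> ts ! Suc i" if "i < n" for i
    using that ts by (intro sorted_nth_mono) (auto simp: n_def)
  have IAB: "I i \<subseteq> {A<..<B}" if "i < n" for i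
  proof -
    have "f (ts ! i) \<in> {A..B}" "f (ts ! Suc i) \<in> {A..B}"
      using rng t01[of i] t01[of "Suc i"] that by (auto simp: image_subset_iff)
    then show ?thesis by (auto simp: I_def)
  qed
  \<comment> \<open>\<open>I i\<close> is an open interval, so the level is not attained at the
    sample points themselves. The crossing is strictly between them: crossings of different gaps are
    distinct, and none of them is at 0 or 1, where a closed curve is at the same point
    twice.\<close>
  have cross: "\<exists>t. ts ! i < t \<and> t < ts ! Suc i \<and> f t = s" if i: "i < n" and s: "s \<in> I i" for i s
  proof -
    have c: "continuous_on {ts ! i..ts ! Suc i} f"
      by (rule continuous_on_subset[OF cont]) (use t01[of i] t01[of "Suc i"] i in auto)
    have "\<exists>t. ts ! i \<le> t \<and> t \<le> ts ! Suc i \<and> f t = s"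
    proof (cases "f (ts ! i) \<le> f (ts ! Suc i)")
      case True
      then show ?thesis using IVT'[of f "ts ! i" s "ts ! Suc i"] s mono[OF i] c by (auto simp: I_def)
    next
      case False
      then show ?thesis using IVT2'[of f "ts ! Suc i" s "ts ! i"] s mono[OF i] c by (auto simp: I_def)
    qed
    then obtain t where t: "ts ! i \<le> t" "t \<le> ts ! Suc i" "f t = s" by blast
    have "t \<noteq> ts ! i" "t \<noteq> ts ! Suc i" using t(3) s by (auto simp: I_def)
    then show ?thesis using t by (intro exI[of _ t]) auto
  qed
  have count: "(\<Sum>i<n. indicator (I i) s) \<le> (2 * indicator {A<..<B} s :: real)" for s
  proof (cases "s \<in> {A<..<B}")
    case True
    define C where "C = {i. i < n \<and> s \<in> I i}"
    have "\<forall>i\<in>C. \<exists>t. ts ! i < t \<and> t < ts ! Suc i \<and> f t = s" using cross by (auto simp: C_def)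
    then obtain \<tau> where \<tau>: "\<And>i. i \<in> C \<Longrightarrow> ts ! i < \<tau> i \<and> \<tau> i < ts ! Suc i \<and> f (\<tau> i) = s" by metis
    have sub: "\<tau> ` C \<subseteq> {t\<in>{0<..<1}. f t = s}"
    proof clarify
      fix i assume i: "i \<in> C"
      then have "i < n" by (simp add: C_def)
      then show "\<tau> i \<in> {0<..<1} \<and> f (\<tau> i) = s" using \<tau>[OF i] t01[of i] t01[of "Suc i"] by auto
    qed
    have lt: "\<tau> i < \<tau> j" if "i \<in> C" "j \<in> C" "i < j" for i j
      by (rule sorted_gap_disjoint[OF ts(1) \<open>i < j\<close>]) (use that \<tau> in \<open>auto simp: C_def n_def\<close>)
    have "inj_on \<tau> C"
      by (rule inj_onI) (metis lt less_irrefl linorder_neqE_nat)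
    moreover have "finite {t\<in>{0<..<1}. f t = s}" "card {t\<in>{0<..<1}. f t = s} \<le> 2"
      using lev[of s] True by auto
    ultimately have "card C \<le> 2" using card_mono[OF _ sub] by (simp add: card_image)
    moreover have "(\<Sum>i<n. indicator (I i) s :: real) = (\<Sum>i\<in>C. 1)"
      by (rule sum.mono_neutral_cong_right) (auto simp: C_def)
    ultimately show ?thesis using True by simp
  next
    case False
    then have "s \<notin> I i" if "i < n" for i using IAB[OF that] by auto
    then show ?thesis using False by simp
  qed
  have "(\<Sum>i<n. \<bar>f (ts ! i) - f (ts ! Suc i)\<bar>) = (\<Sum>i<n. measure lborel (I i))"
    by (intro sum.cong) (auto simp: I_def)
  also have "\<dots> = (\<Sum>i<n. (LINT s|lborel. indicator (I i) s))" by simp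
  also have "\<dots> = (LINT s|lborel. (\<Sum>i<n. indicator (I i) s))"
    by (subst Bochner_Integration.integral_sum) (auto simp: I_def)
  also have "\<dots> \<le> (LINT s|lborel. 2 * indicator {A<..<B} s)"
  proof (rule integral_mono)
    show "integrable lborel (\<lambda>s. 2 * indicator {A<..<B} s :: real)"
      using AB by (intro integrable_mult_right integrable_real_indicator) auto
    show "integrable lborel (\<lambda>s. \<Sum>i<n. indicator (I i) s :: real)"
      unfolding I_def by (intro Bochner_Integration.integrable_sum integrable_real_indicator) auto
  qed (rule count)
  also have "\<dots> = 2 * (B - A)" using AB by simp
  finally show ?thesis by (simp add: n_def)
qed

lemma card_le_2I:
  assumes "\<And>x y z. x \<in> S \<Longrightarrow> y \<in> S \<Longrightarrow> z \<in> S \<Longrightarrow> x < y \<Longrightarrow> y < z \<Longrightarrow> False"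
  shows "finite (S::real set) \<and> card S \<le> 2"
proof (rule ccontr)
  assume "\<not> ?thesis"
  then obtain T where T: "T \<subseteq> S" "finite T" "card T = 3"
    by (metis infinite_arbitrarily_large obtain_subset_with_card_n not_le Suc_leI numeral_3_eq_3 numeral_2_eq_2 less_eq_Suc_le)
  define xs where "xs = sorted_list_of_set T"
  have xs: "length xs = 3" "sorted xs" "distinct xs" "set xs = T" using T by (auto simp: xs_def)
  then obtain a b c where "xs = [a, b, c]" by (auto simp: length_Suc_conv numeral_3_eq_3)
  then show False using xs T assms[of a b c] by auto
qed

text \<open>An open segment from an interior point of a convex set to a point of its closure lies in
  the interior. Hence a ray from \<open>c\<close> carries at most one frontier point, and two of
  them on a line through \<open>c\<close> lie on opposite sides.\<close>

lemma convex_frontier_line: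
  fixes S :: "complex set"
  assumes S: "open S" "convex S" and c: "c \<in> S" and v: "v \<noteq> 0"
    and fr: "c + x *\<^sub>R v \<in> frontier S" "c + y *\<^sub>R v \<in> frontier S" "x < y"
  shows "x < 0 \<and> 0 < y"
proof -
  have int: "interior S = S" using S by (simp add: interior_open)
  have F: "p \<notin> S" "p \<in> closure S" if "p \<in> frontier S" for p using that int by (auto simp: frontier_def)
  \<comment> \<open>A quotient \<open>s / r\<close> in (0,1) says that the point with parameter
    \<open>s\<close> lies strictly between \<open>c\<close> and the point with parameter
    \<open>r\<close>.\<close>
  have no: "False" if "c + s *\<^sub>R v \<in> frontier S" "c + r *\<^sub>R v \<in> frontier S" "0 < s / r" "s / r < 1" for s r
  proof -
    have "r \<noteq> 0" using that by auto
    have "open_segment c (c + r *\<^sub>R v) \<subseteq> S"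
      using in_interior_closure_convex_segment[OF S(2), of c "c + r *\<^sub>R v"] c int F that by auto
    moreover have "c + s *\<^sub>R v \<in> open_segment c (c + r *\<^sub>R v)"
      unfolding in_segment using that v \<open>r \<noteq> 0\<close>
      by (intro conjI exI[of _ "s / r"]) (auto simp: algebra_simps)
    ultimately show False using F that by blast
  qed
  have "x \<noteq> 0" "y \<noteq> 0" using fr F c by auto
  then consider "x < 0 \<and> 0 < y" | "0 < x" | "y < 0" using fr(3) by linarith
  then show ?thesis
  proof cases
    case 2 then show ?thesis using no[of x y] fr by (simp add: divide_simps)
  next
    case 3 then show ?thesis using no[of y x] fr by (simp add: divide_simps)
  qed auto
qed

text \<open>A level strictly between infimum and supremum is attained at some \<open>c\<close> in
  \<open>S\<close>, on a segment joining a lower to a higher point. Of three frontier points on the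
  level line, two would lie on the same side of \<open>c\<close>.\<close>

lemma convex_frontier_level_two_points:
  fixes S :: "complex set" and l :: "complex \<Rightarrow> real"
  assumes S: "open S" "convex S" "S \<noteq> {}" and l: "l = Re \<or> l = Im"
    and g: "simple_path g" "path_image g = frontier S"
    and bd: "S \<subseteq> l -` {A..B}" and tight: "A = Inf (l ` S)" "B = Sup (l ` S)" and s: "A < s" "s < B"
  shows "finite {t\<in>{0<..<1}. l (g t) = s} \<and> card {t\<in>{0<..<1}. l (g t) = s} \<le> 2"
proof (rule card_le_2I)
  fix t1 t2 t3 assume t: "t1 \<in> {t\<in>{0<..<1}. l (g t) = s}" "t2 \<in> {t\<in>{0<..<1}. l (g t) = s}"
    "t3 \<in> {t\<in>{0<..<1}. l (g t) = s}" "t1 < t2" "t2 < t3"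
  have ne: "l ` S \<noteq> {}" "bdd_below (l ` S)" "bdd_above (l ` S)"
    using S(3) bd by (auto intro!: bdd_belowI[of _ A] bdd_aboveI[of _ B])
  obtain p where p: "p \<in> S" "l p < s" using cInf_lessD[OF ne(1), of s] s tight by auto
  obtain q where q: "q \<in> S" "s < l q" using less_cSupD[OF ne(1), of s] s tight by auto
  define k where "k = (s - l p) / (l q - l p)"
  define c where "c = (1 - k) *\<^sub>R p + k *\<^sub>R q"
  have k: "0 \<le> k" "k \<le> 1" using p q by (auto simp: k_def divide_simps)
  have c: "c \<in> S" unfolding c_def using S(2) p q k by (simp add: convexD)
  have "l c = l p + k * (l q - l p)" using l by (auto simp: c_def algebra_simps)
  then have lc: "l c = s" using p q by (simp add: k_def)
  define v where "v = (if l = Re then \<i> else 1)"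
  define m where "m = (if l = Re then Im else Re)"
  have RI: "Re \<noteq> Im" by (metis complex.sel(1) complex.sel(2) zero_neq_one)
  have v: "v \<noteq> 0" by (simp add: v_def)
  have rep: "w = c + (m w - m c) *\<^sub>R v" if "l w = s" for w
    using that lc l RI by (auto simp: v_def m_def complex_eq_iff)
  have fr: "g t \<in> frontier S" if "t \<in> {0<..<1}" for t
    using g that by (auto simp: path_image_def)
  have frx: "c + (m (g t) - m c) *\<^sub>R v \<in> frontier S" if "t \<in> {t\<in>{0<..<1}. l (g t) = s}" for t
    using rep[of "g t"] fr[of t] that by simp
  have lf: "\<forall>x\<in>{0..1}. \<forall>y\<in>{0..1}. g x = g y \<longrightarrow> x = y \<or> x = 0 \<and> y = 1 \<or> x = 1 \<and> y = 0"
    using g(1) by (simp add: simple_path_def loop_free_def)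
  \<comment> \<open>The endpoints are left out because the curve may be closed; on the open
    parameter interval a simple path is injective.\<close>
  have inj: "x = y" if "x \<in> {0<..<1}" "y \<in> {0<..<1}" "g x = g y" for x y
    using lf[rule_format, of x y] that by auto
  have "g t1 \<noteq> g t2" using inj[of t1 t2] t by auto
  moreover have "g t2 \<noteq> g t3" using inj[of t2 t3] t by auto
  moreover have "g t1 \<noteq> g t3" using inj[of t1 t3] t by auto
  moreover have "g x = g y" if "m (g x) = m (g y)" "l (g x) = s" "l (g y) = s" for x y
  proof -
    have "g x = c + (m (g x) - m c) *\<^sub>R v" using rep[OF that(2)] .
    also have "\<dots> = c + (m (g y) - m c) *\<^sub>R v" by (simp only: that(1))
    also have "\<dots> = g y" using rep[OF that(3)] by (rule sym)
    finally show ?thesis .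
  qed
  moreover have "l (g t1) = s" "l (g t2) = s" "l (g t3) = s" using t by auto
  ultimately have ne: "m (g t1) \<noteq> m (g t2)" "m (g t2) \<noteq> m (g t3)" "m (g t1) \<noteq> m (g t3)"
    by blast+
  note L = convex_frontier_line[OF S(1,2) c v frx frx]
  show False
    using L[OF t(1) t(2)] L[OF t(2) t(1)] L[OF t(1) t(3)] L[OF t(3) t(1)] L[OF t(2) t(3)] L[OF t(3) t(2)] ne
    by linarith
qed

text \<open>Bounding each chord by the sum of its coordinate increments turns length into two
  one-dimensional variations. Each coordinate takes every inner level at most twice, so its
  variation is at most twice its range, that is \<open>4 * a\<close> and
  \<open>4 * b\<close>.\<close>

lemma curve_length_convex_le:
  fixes S :: "complex set"
  assumes S: "open S" "convex S" "S \<noteq> {}" "bounded S" and g: "simple_path g" "path_image g = frontier S"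
    and box: "S \<subseteq> {z. \<bar>Re z\<bar> \<le> a \<and> \<bar>Im z\<bar> \<le> b}"
  shows "curve_length g \<le> ennreal (4 * a + 4 * b)"
proof -
  have var: "(\<Sum>i<length ts - 1. \<bar>l (g (ts ! i)) - l (g (ts ! Suc i))\<bar>) \<le> 4 * d"
    if l: "l = Re \<or> l = Im" and d: "\<And>z. z \<in> S \<Longrightarrow> \<bar>l z\<bar> \<le> d" and ts: "sorted ts" "set ts \<subseteq> {0..1}"
    for l :: "complex \<Rightarrow> real" and d ts
  proof -
    define A where "A = Inf (l ` S)"
    define B where "B = Sup (l ` S)"
    have bdd: "bdd_below (l ` S)" "bdd_above (l ` S)"
      using d by (auto intro!: bdd_belowI[of _ "-d"] bdd_aboveI[of _ d] simp: abs_le_iff minus_le_iff)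
    have AB: "A \<le> l z \<and> l z \<le> B" if "z \<in> S" for z
      unfolding A_def B_def using that bdd by (auto intro: cInf_lower cSup_upper)
    have dd: "-d \<le> A" "B \<le> d" unfolding A_def B_def
      using S(3) d by (auto intro!: cInf_greatest cSup_least simp: abs_le_iff minus_le_iff)
    obtain z0 where z0: "z0 \<in> S" using S(3) by auto
    have lc: "continuous_on X l" for X using l by (auto intro!: continuous_intros)
    have cl: "closure S \<subseteq> {z. A \<le> l z \<and> l z \<le> B}"
      by (rule closure_minimal) (use AB l in \<open>auto intro!: closed_Collect_conj closed_Collect_le continuous_intros\<close>)
    have rng: "(l \<circ> g) ` {0..1} \<subseteq> {A..B}"
    proof -
      have "g t \<in> closure S" if "t \<in> {0..1}" for t
        using g(2) that by (auto simp: path_image_def frontier_def)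
      then show ?thesis using cl by fastforce
    qed
    have "(\<Sum>i<length ts - 1. \<bar>(l \<circ> g) (ts ! i) - (l \<circ> g) (ts ! Suc i)\<bar>) \<le> 2 * (B - A)"
    proof (rule variation_le_of_two_point_levels[OF _ rng _ _ ts])
      show "continuous_on {0..1} (l \<circ> g)"
        using g(1) unfolding simple_path_def path_def by (intro continuous_on_compose lc) auto
      show "A \<le> B" using AB[OF z0] by linarith
      fix s assume "A < s" "s < B"
      then show "finite {t\<in>{0<..<1}. (l \<circ> g) t = s} \<and> card {t\<in>{0<..<1}. (l \<circ> g) t = s} \<le> 2"
        using convex_frontier_level_two_points[OF S(1-3) l g, of A B s] AB
        by (auto simp: A_def B_def subset_iff)
    qed
    also have "\<dots> \<le> 4 * d" using dd by simp
    finally show ?thesis by simp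
  qed
  show ?thesis unfolding curve_length_def
  proof (rule SUP_least, clarify)
    fix ts :: "real list" assume ts: "sorted ts" "set ts \<subseteq> {0..1}"
    have "(\<Sum>i<length ts - 1. dist (g (ts ! i)) (g (ts ! Suc i)))
       \<le> (\<Sum>i<length ts - 1. \<bar>Re (g (ts ! i)) - Re (g (ts ! Suc i))\<bar> + \<bar>Im (g (ts ! i)) - Im (g (ts ! Suc i))\<bar>)"
      proof (rule sum_mono)
      show "dist (g (ts ! i)) (g (ts ! Suc i)) \<le> \<bar>Re (g (ts ! i)) - Re (g (ts ! Suc i))\<bar> + \<bar>Im (g (ts ! i)) - Im (g (ts ! Suc i))\<bar>" for i
        using cmod_le[of "g (ts ! i) - g (ts ! Suc i)"] by (simp add: dist_norm)
    qed
    also have "\<dots> \<le> 4 * a + 4 * b"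
      unfolding sum.distrib using var[of Re a ts] var[of Im b ts] ts box by (intro add_mono) auto
    finally show "(\<Sum>i<length ts - 1. ennreal (dist (g (ts ! i)) (g (ts ! Suc i)))) \<le> ennreal (4 * a + 4 * b)"
      by (subst sum_ennreal) (auto intro: ennreal_leI)
  qed
qed

section \<open>Lebesgue measure under similarities of the plane\<close>

text \<open>Invariance of Lebesgue measure under rotations is taken from orthogonal maps of
  \<open>real^2\<close>; these two mutually inverse isometries carry it over to
  \<open>complex\<close>.\<close>

definition vec_of_complex :: "complex \<Rightarrow> real^2" where
  "vec_of_complex z = (\<chi> i. if i = 1 then Re z else Im z)"

definition complex_of_vec :: "real^2 \<Rightarrow> complex" where
  "complex_of_vec v = Complex (v $ 1) (v $ 2)"

lemma vec_of_complex_inverse [simp]: "complex_of_vec (vec_of_complex z) = z"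
  and complex_of_vec_inverse [simp]: "vec_of_complex (complex_of_vec v) = v"
  by (auto simp: vec_of_complex_def complex_of_vec_def vec_eq_iff complex_eq_iff forall_2)

lemma linear_vec_of_complex: "linear vec_of_complex" and linear_complex_of_vec: "linear complex_of_vec"
  by (auto intro!: linearI simp: vec_of_complex_def complex_of_vec_def vec_eq_iff complex_eq_iff)

lemma norm_vec_of_complex: "norm (vec_of_complex z) = norm z"
  by (simp add: norm_vec_def L2_set_def sum_2 vec_of_complex_def cmod_def)

lemma borel_measurable_vec_of_complex [measurable]: "vec_of_complex \<in> borel_measurable borel"
  and borel_measurable_complex_of_vec [measurable]: "complex_of_vec \<in> borel_measurable borel"
  by (auto intro!: borel_measurable_continuous_onI linear_continuous_on
      simp: linear_linear linear_vec_of_complex linear_complex_of_vec)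

lemma prod_Basis_vec_2: "(\<Prod>b\<in>(Basis :: (real^2) set). f b) = f (axis 1 1) * f (axis 2 1)"
proof -
  have B: "(Basis :: (real^2) set) = {axis 1 1, axis 2 1}"
    by (auto simp: Basis_vec_def UNIV_2)
  have ne: "(axis 1 1 :: real^2) \<noteq> axis 2 1" by (simp add: axis_eq_axis)
  show ?thesis unfolding B by (subst prod.insert) (use ne in auto)
qed

lemma distr_lborel_vec_of_complex: "distr lborel borel vec_of_complex = lborel"
proof (rule lborel_eqI[symmetric])
  fix l u :: "real^2" assume le: "\<And>b. b \<in> Basis \<Longrightarrow> l \<bullet> b \<le> u \<bullet> b"
  have le': "l $ 1 \<le> u $ 1" "l $ 2 \<le> u $ 2"
    using le[of "axis 1 1"] le[of "axis 2 1"] by (auto simp: inner_axis)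
  have "vec_of_complex -` box l u = box (complex_of_vec l) (complex_of_vec u)"
    by (auto simp: mem_box_cart forall_2 vec_of_complex_def complex_of_vec_def mem_box Basis_complex_def)
  then have "emeasure (distr lborel borel vec_of_complex) (box l u) = emeasure lborel (box (complex_of_vec l) (complex_of_vec u))"
    by (simp add: emeasure_distr)
  also have "\<dots> = ennreal (\<Prod>b\<in>Basis. (u - l) \<bullet> b)"
    using le' by (subst emeasure_lborel_box_eq)
      (auto simp: Basis_complex_def complex_of_vec_def prod_Basis_vec_2 inner_axis)
  finally show "emeasure (distr lborel borel vec_of_complex) (box l u) = ennreal (\<Prod>b\<in>Basis. (u - l) \<bullet> b)" .
qed simp

text \<open>A measure that agrees with \<open>lborel\<close> on boxes is \<open>lborel\<close>. The
  preimage of a box is moved to \<open>real^2\<close>, where it is the image of the box under an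
  orthogonal map and so has the same measure.\<close>

lemma distr_lborel_complex_rotation:
  fixes a :: complex assumes a: "norm a = 1"
  shows "distr lborel borel (\<lambda>z. a * z) = lborel"
proof (rule lborel_eqI[symmetric])
  fix l u :: complex assume le: "\<And>b. b \<in> Basis \<Longrightarrow> l \<bullet> b \<le> u \<bullet> b"
  define B where "B = box l u"
  \<comment> \<open>The conjugate appears because a preimage under multiplication by
    \<open>a\<close> is an image under multiplication by its inverse, which is \<open>cnj a\<close>
    when \<open>norm a = 1\<close>.\<close>
  define f where "f v = vec_of_complex (cnj a * complex_of_vec v)" for v
  have ac: "a * cnj a = 1" using a by (simp add: complex_mult_cnj cmod_def flip: of_real_power)
  have inv: "a * (cnj a * z) = z" "cnj a * (a * z) = z" for z
    using ac by (simp_all add: mult.assoc[symmetric] mult.commute)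
  have lf: "linear f" unfolding f_def
    by (intro linearI) (simp_all add: linear_add[OF linear_complex_of_vec] linear_add[OF linear_vec_of_complex]
        linear_scale[OF linear_complex_of_vec] linear_scale[OF linear_vec_of_complex] distrib_left)
  have of: "orthogonal_transformation f"
    unfolding orthogonal_transformation using lf
    by (auto simp: f_def norm_vec_of_complex norm_mult a) (metis complex_of_vec_inverse norm_vec_of_complex)
  have B: "B \<in> sets borel" "bounded B" by (auto simp: B_def bounded_box)
  have em: "emeasure lborel S = emeasure lborel (complex_of_vec -` S)" if [measurable]: "S \<in> sets borel" for S
  proof -
    have "complex_of_vec -` S \<in> sets borel"
      using measurable_sets[OF borel_measurable_complex_of_vec that] by simp
    moreover have "vec_of_complex -` complex_of_vec -` S = S" by auto
    ultimately show ?thesis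
      by (subst distr_lborel_vec_of_complex[symmetric]) (simp add: emeasure_distr)
  qed
  have m: "(\<lambda>z. a * z) \<in> borel_measurable borel" by measurable
  have S1: "(\<lambda>z. a * z) -` B \<in> sets borel" using measurable_sets[OF m B(1)] by simp
  have im: "complex_of_vec -` (\<lambda>z. a * z) -` B = f ` (complex_of_vec -` B)"
  proof -
    have "v \<in> f ` (complex_of_vec -` B)" if "a * complex_of_vec v \<in> B" for v
      by (rule image_eqI[of _ _ "vec_of_complex (a * complex_of_vec v)"]) (unfold f_def vec_of_complex_inverse inv(2), use that in simp_all)
    moreover have "a * complex_of_vec (f w) = complex_of_vec w" for w
      unfolding f_def vec_of_complex_inverse inv(1) by (rule refl)
    ultimately show ?thesis by auto
  qed
  have V: "complex_of_vec -` B \<in> sets borel"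
    using measurable_sets[OF borel_measurable_complex_of_vec B(1)] by simp
  have fin: "emeasure lborel (complex_of_vec -` B) < \<infinity>"
    using em[OF B(1)] B(2) emeasure_bounded_finite[of B] by simp
  have lm: "complex_of_vec -` B \<in> lmeasurable"
    using V fin by (intro fmeasurableI) auto
  have "emeasure (distr lborel borel (\<lambda>z. a * z)) B = emeasure lborel ((\<lambda>z. a * z) -` B)"
    using B m by (simp add: emeasure_distr)
  also have "\<dots> = emeasure lborel (f ` (complex_of_vec -` B))" using em[OF S1] im by simp
  also have "\<dots> = emeasure lebesgue (f ` (complex_of_vec -` B))"
    using measurable_sets[OF borel_measurable_complex_of_vec S1] im by simp
  also have "\<dots> = emeasure lebesgue (complex_of_vec -` B)"
    unfolding emeasure_eq_measure2[OF lm] emeasure_eq_measure2[OF measurable_orthogonal_image[OF of lm]]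
    by (simp only: measure_orthogonal_image[OF of lm])
  also have "\<dots> = emeasure lborel B" using em[OF B(1)] V by simp
  also have "\<dots> = (\<Prod>b\<in>Basis. (u - l) \<bullet> b)" unfolding B_def
    using le by (simp add: emeasure_lborel_box_eq)
  finally show "emeasure (distr lborel borel (\<lambda>z. a * z)) (box l u) = (\<Prod>b\<in>Basis. (u - l) \<bullet> b)"
    by (simp add: B_def)
qed simp

text \<open>Polar decomposition of \<open>a\<close>: the unit factor preserves \<open>lborel\<close>
  by the rotation lemma, and the factor \<open>norm a\<close> is a real dilation of a space of
  dimension 2.\<close>

lemma lborel_complex_affine:
  fixes a t :: complex assumes a: "a \<noteq> 0"
  shows "lborel = density (distr lborel borel (\<lambda>z. t + a * z)) (\<lambda>_. ennreal ((norm a)\<^sup>2))"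
proof -
  have n: "norm (a / of_real (norm a)) = 1" using a by (simp add: norm_divide)
  have e: "t + norm a *\<^sub>R ((a / of_real (norm a)) * z) = t + a * z" for z
    using a by (simp add: scaleR_conv_of_real)
  have "lborel = density (distr lborel borel (\<lambda>x. t + norm a *\<^sub>R x)) (\<lambda>_. ennreal (\<bar>norm a\<bar>^DIM(complex)))"
    using a by (intro lborel_affine) auto
  also have "distr lborel borel (\<lambda>x. t + norm a *\<^sub>R x) =
      distr (distr lborel borel (\<lambda>z. (a / of_real (norm a)) * z)) borel (\<lambda>x. t + norm a *\<^sub>R x)"
    by (simp only: distr_lborel_complex_rotation[OF n])
  also have "\<dots> = distr lborel borel (\<lambda>z. t + a * z)"
  proof -
    have "(\<lambda>x. t + norm a *\<^sub>R x) \<circ> (\<lambda>z. (a / of_real (norm a)) * z) = (\<lambda>z. t + a * z)"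
      by (rule ext) (simp only: comp_def e)
    then show ?thesis by (subst distr_distr) (simp_all del: times_divide_eq_left)
  qed
  finally show ?thesis by simp
qed

text \<open>The identity for \<open>lborel\<close> survives completion because \<open>lborel\<close>
  and its image under the map have the same null sets.\<close>

lemma lebesgue_complex_affine:
  fixes a t :: complex assumes a: "a \<noteq> 0"
  defines "T \<equiv> \<lambda>z. t + a * z"
  shows "lebesgue = density (distr lebesgue lebesgue T) (\<lambda>_. ennreal ((norm a)\<^sup>2))" (is "_ = ?D")
    and "T \<in> lebesgue \<rightarrow>\<^sub>M lebesgue"
proof -
  have T_borel[measurable]: "T \<in> borel \<rightarrow>\<^sub>M borel"
    by (auto simp: T_def[abs_def])
  { fix A :: "complex set" assume A: "A \<in> sets borel"
    then have "emeasure lborel A = 0 \<longleftrightarrow> emeasure (density (distr lborel borel T) (\<lambda>_. ennreal ((norm a)\<^sup>2))) A = 0"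
      unfolding T_def using a by (subst lborel_complex_affine[symmetric]) auto
    also have "\<dots> \<longleftrightarrow> emeasure (distr lebesgue lborel T) A = 0"
      using A a by (simp add: distr_completion emeasure_density nn_integral_cmult cong: distr_cong)
    finally have "emeasure lborel A = 0 \<longleftrightarrow> emeasure (distr lebesgue lborel T) A = 0" . }
  then have eq: "null_sets lborel = null_sets (distr lebesgue lborel T)"
    by (auto simp: null_sets_def)
  show "T \<in> lebesgue \<rightarrow>\<^sub>M lebesgue"
    by (simp add: completion.measurable_completion2 eq measurable_completion)
  have "lebesgue = completion (density (distr lborel borel T) (\<lambda>_. ennreal ((norm a)\<^sup>2)))"
    using a by (subst lborel_complex_affine[of a t]) (simp_all add: T_def[abs_def])
  also have "\<dots> = density (completion (distr lebesgue lborel T)) (\<lambda>_. ennreal ((norm a)\<^sup>2))"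
    using a by (auto intro!: always_eventually completion_density_eq simp: distr_completion cong: distr_cong)
  also have "\<dots> = density (distr lebesgue lebesgue T) (\<lambda>_. ennreal ((norm a)\<^sup>2))"
    by (subst completion.completion_distr_eq) (auto simp: eq measurable_completion)
  finally show "lebesgue = density (distr lebesgue lebesgue T) (\<lambda>_. ennreal ((norm a)\<^sup>2))" .
qed

lemma integral_complex_affine:
  fixes a t :: complex and f :: "complex \<Rightarrow> real" assumes a: "a \<noteq> 0" and S: "S \<in> sets lebesgue"
    and f: "f \<in> borel_measurable (lebesgue_on ((\<lambda>z. t + a * z) ` S))" and S': "(\<lambda>z. t + a * z) ` S \<in> sets lebesgue"
  shows "(LINT z|lebesgue_on ((\<lambda>z. t + a * z) ` S). f z) = (norm a)\<^sup>2 * (LINT z|lebesgue_on S. f (t + a * z))"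
proof -
  let ?T = "\<lambda>z. t + a * z"
  have ind: "indicator (?T ` S) (?T z) = (indicator S z :: real)" for z using a by (auto simp: indicator_def)
  have m: "(\<lambda>z. indicator (?T ` S) z *\<^sub>R f z) \<in> borel_measurable lebesgue"
    using f S' by (subst (asm) borel_measurable_restrict_space_iff) auto
  have "(LINT z|lebesgue_on (?T ` S). f z) = (LINT z|lebesgue. indicator (?T ` S) z *\<^sub>R f z)"
    using S' by (intro integral_restrict_space) auto
  also have "\<dots> = (LINT z|density (distr lebesgue lebesgue ?T) (\<lambda>_. ennreal ((norm a)\<^sup>2)). indicator (?T ` S) z *\<^sub>R f z)"
    using lebesgue_complex_affine(1)[OF a, of t] by simp
  also have "\<dots> = (norm a)\<^sup>2 * (LINT z|lebesgue. indicator S z *\<^sub>R f (?T z))"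
    using m lebesgue_complex_affine(2)[OF a, of t]
    by (subst integral_density) (auto simp: integral_distr ind)
  also have "(LINT z|lebesgue. indicator S z *\<^sub>R f (?T z)) = (LINT z|lebesgue_on S. f (t + a * z))"
    using S by (subst integral_restrict_space) auto
  finally show ?thesis .
qed

text \<open>The exceptional set is mapped onto the new exceptional set, and differentiable images of
  negligible sets are negligible.\<close>

lemma AE_complex_affine:
  fixes a t :: complex assumes a: "a \<noteq> 0" and S: "S \<in> sets lebesgue"
    and S': "(\<lambda>z. t + a * z) ` S \<in> sets lebesgue" and P: "AE z in lebesgue_on S. P (t + a * z)"
  shows "AE z in lebesgue_on ((\<lambda>z. t + a * z) ` S). P z"
proof -
  let ?T = "\<lambda>z. t + a * z"
  have "AE z in lebesgue. z \<in> S \<longrightarrow> P (?T z)"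
    using P S by (subst (asm) AE_restrict_space_iff) auto
  then obtain N where N: "N \<in> null_sets lebesgue" "{z. \<not> (z \<in> S \<longrightarrow> P (?T z))} \<subseteq> N"
    by (auto simp: eventually_ae_filter)
  have dT: "?T differentiable_on N"
    unfolding differentiable_on_def by (auto intro!: derivative_intros)
  have "negligible (?T ` N)"
    by (rule negligible_differentiable_image_negligible[OF _ _ dT])
      (use N in \<open>simp_all add: negligible_iff_null_sets\<close>)
  then have "?T ` N \<in> null_sets lebesgue" by (simp add: negligible_iff_null_sets)
  moreover have "{z. \<not> (z \<in> ?T ` S \<longrightarrow> P z)} \<subseteq> ?T ` N" using N(2) by blast
  ultimately have "AE z in lebesgue. z \<in> ?T ` S \<longrightarrow> P z"
    unfolding eventually_ae_filter by auto
  then show ?thesis using S' by (subst AE_restrict_space_iff) auto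
qed

lemma measure_complex_rigid:
  assumes a: "norm a = 1" and S: "S \<in> sets lebesgue" and S': "(\<lambda>z. t + a * z) ` S \<in> sets lebesgue"
  shows "measure lebesgue ((\<lambda>z. t + a * z) ` S) = measure lebesgue (S::complex set)"
proof -
  have "(LINT z|lebesgue_on ((\<lambda>z. t + a * z) ` S). 1) = (norm a)\<^sup>2 * (LINT z|lebesgue_on S. 1)"
    using a S S' by (intro integral_complex_affine) auto
  then show ?thesis using a S S' by (simp add: measure_restrict_space)
qed

section \<open>Square integrable functions\<close>

text \<open>The notion \<open>L2_on\<close> for an arbitrary measure: estimates for test functions
  live on \<open>lborel\<close>, those for \<open>H10\<close> on \<open>lebesgue_on\<close>.\<close>

definition square_integrable :: "'a measure \<Rightarrow> ('a \<Rightarrow> 'b::euclidean_space) \<Rightarrow> bool" where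
  "square_integrable M f \<longleftrightarrow> f \<in> borel_measurable M \<and> integrable M (\<lambda>x. (norm (f x))\<^sup>2)"

definition L2norm :: "'a measure \<Rightarrow> ('a \<Rightarrow> 'b::euclidean_space) \<Rightarrow> real" where
  "L2norm M f = sqrt (LINT x|M. (norm (f x))\<^sup>2)"

lemma square_integrableD:
  assumes "square_integrable M f"
  shows "f \<in> borel_measurable M" "integrable M (\<lambda>x. (norm (f x))\<^sup>2)"
  using assms by (auto simp: square_integrable_def)

lemma L2norm_nonneg [simp]: "0 \<le> L2norm M f"
  by (simp add: L2norm_def)

lemma L2norm_power2: "(L2norm M f)\<^sup>2 = (LINT x|M. (norm (f x))\<^sup>2)"
  by (simp add: L2norm_def)

lemma integrable_inner_square_integrable:
  assumes f: "square_integrable M f" and g: "square_integrable M g"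
  shows "integrable M (\<lambda>x. f x \<bullet> g x)"
proof (rule Bochner_Integration.integrable_bound)
  show "integrable M (\<lambda>x. (norm (f x))\<^sup>2 + (norm (g x))\<^sup>2)"
    using f g by (auto simp: square_integrable_def)
  show "(\<lambda>x. f x \<bullet> g x) \<in> borel_measurable M"
    using f g by (auto simp: square_integrable_def)
  have "norm (f x \<bullet> g x) \<le> norm ((norm (f x))\<^sup>2 + (norm (g x))\<^sup>2)" for x
  proof -
    have "\<bar>f x \<bullet> g x\<bar> \<le> norm (f x) * norm (g x)" by (rule Cauchy_Schwarz_ineq2)
    moreover have "2 * (norm (f x) * norm (g x)) \<le> (norm (f x))\<^sup>2 + (norm (g x))\<^sup>2"
      using sum_squares_bound[of "norm (f x)" "norm (g x)"] by simp
    moreover have "0 \<le> norm (f x) * norm (g x)" by simp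
    ultimately show ?thesis by simp
  qed
  then show "AE x in M. norm (f x \<bullet> g x) \<le> norm ((norm (f x))\<^sup>2 + (norm (g x))\<^sup>2)" by simp
qed

lemma square_integrable_scaleR:
  "square_integrable M f \<Longrightarrow> square_integrable M (\<lambda>x. c *\<^sub>R f x)"
  by (auto simp: square_integrable_def power_mult_distrib)

lemma norm_add_power2: "(norm (a + b))\<^sup>2 = (norm a)\<^sup>2 + 2 * (a \<bullet> b) + (norm b)\<^sup>2" for a b :: "'b::real_inner"
  by (simp add: power2_norm_eq_inner inner_add inner_commute)

lemma square_integrable_add:
  assumes f: "square_integrable M f" and g: "square_integrable M g"
  shows "square_integrable M (\<lambda>x. f x + g x)"
  using f g integrable_inner_square_integrable[OF f g]
  by (auto simp: square_integrable_def norm_add_power2)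

lemma square_integrable_diff:
  assumes f: "square_integrable M f" and g: "square_integrable M g"
  shows "square_integrable M (\<lambda>x. f x - g x)"
  using square_integrable_add[OF f square_integrable_scaleR[OF g, of "-1"]] by simp

lemma integral_norm_add_power2:
  assumes f: "square_integrable M f" and g: "square_integrable M g"
  shows "(LINT x|M. (norm (f x + g x))\<^sup>2) =
    (LINT x|M. (norm (f x))\<^sup>2) + 2 * (LINT x|M. f x \<bullet> g x) + (LINT x|M. (norm (g x))\<^sup>2)"
  using integrable_inner_square_integrable[OF f g] square_integrableD(2)[OF f] square_integrableD(2)[OF g]
  by (simp add: norm_add_power2)

text \<open>The integral of \<open>norm (f x + t *\<^sub>R g x)\<close> squared is a nonnegative
  quadratic polynomial in \<open>t\<close>, so its discriminant is not positive.\<close>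

lemma L2_Cauchy_Schwarz:
  assumes f: "square_integrable M f" and g: "square_integrable M g"
  shows "\<bar>LINT x|M. f x \<bullet> g x\<bar> \<le> L2norm M f * L2norm M g"
proof -
  define a where "a = (LINT x|M. (norm (f x))\<^sup>2)"
  define b where "b = (LINT x|M. f x \<bullet> g x)"
  define c where "c = (LINT x|M. (norm (g x))\<^sup>2)"
  have ac: "0 \<le> a" "0 \<le> c" by (auto simp: a_def c_def)
  have q: "0 \<le> a + 2 * (t * b) + t\<^sup>2 * c" for t
  proof -
    have "0 \<le> (LINT x|M. (norm (f x + t *\<^sub>R g x))\<^sup>2)" by simp
    also have "\<dots> = a + 2 * (t * b) + t\<^sup>2 * c"
      using integral_norm_add_power2[OF f square_integrable_scaleR[OF g]]
      by (simp add: a_def b_def c_def power_mult_distrib)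
    finally show ?thesis .
  qed
  have "b\<^sup>2 \<le> a * c"
  proof (cases "c = 0")
    case True
    have "b = 0"
    proof (rule ccontr)
      assume "b \<noteq> 0"
      \<comment> \<open>With \<open>c = 0\<close> the polynomial is affine in \<open>t\<close>, and
        this \<open>t\<close> makes it equal to -1.\<close>
      then show False using q[of "- (a + 1) / (2 * b)"] True ac by (simp add: field_simps)
    qed
    then show ?thesis using ac by simp
  next
    case False
    then show ?thesis using q[of "- b / c"] ac by (simp add: field_simps power2_eq_square)
  qed
  then have "sqrt (b\<^sup>2) \<le> sqrt (a * c)" by (rule real_sqrt_le_mono)
  then show ?thesis by (simp add: real_sqrt_mult L2norm_def a_def b_def c_def)
qed

lemma L2norm_triangle:
  assumes f: "square_integrable M f" and g: "square_integrable M g"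
  shows "L2norm M (\<lambda>x. f x + g x) \<le> L2norm M f + L2norm M g"
proof (rule power2_le_imp_le)
  show "(L2norm M (\<lambda>x. f x + g x))\<^sup>2 \<le> (L2norm M f + L2norm M g)\<^sup>2"
    using L2_Cauchy_Schwarz[OF f g]
    by (simp add: L2norm_power2 integral_norm_add_power2[OF f g] power2_sum)
qed simp

lemma L2norm_scaleR: "L2norm M (\<lambda>x. c *\<^sub>R f x) = \<bar>c\<bar> * L2norm M f"
  by (simp add: L2norm_def power_mult_distrib real_sqrt_mult)

definition L2_tendsto :: "'a measure \<Rightarrow> (nat \<Rightarrow> 'a \<Rightarrow> 'b::euclidean_space) \<Rightarrow> ('a \<Rightarrow> 'b) \<Rightarrow> bool" where
  "L2_tendsto M f g \<longleftrightarrow> (\<forall>n. square_integrable M (f n)) \<and> square_integrable M g \<and>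
     (\<lambda>n. L2norm M (\<lambda>x. f n x - g x)) \<longlonglongrightarrow> 0"

lemma L2_tendsto_iff:
  assumes "\<And>n. square_integrable M (f n)" "square_integrable M g"
  shows "L2_tendsto M f g \<longleftrightarrow> (\<lambda>n. LINT x|M. (norm (f n x - g x))\<^sup>2) \<longlonglongrightarrow> 0"
proof -
  have "(\<lambda>n. (L2norm M (\<lambda>x. f n x - g x))\<^sup>2) \<longlonglongrightarrow> 0 \<longleftrightarrow> (\<lambda>n. L2norm M (\<lambda>x. f n x - g x)) \<longlonglongrightarrow> 0"
  proof
    assume "(\<lambda>n. (L2norm M (\<lambda>x. f n x - g x))\<^sup>2) \<longlonglongrightarrow> 0"
    from tendsto_real_sqrt[OF this] show "(\<lambda>n. L2norm M (\<lambda>x. f n x - g x)) \<longlonglongrightarrow> 0" by simp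
  next
    assume "(\<lambda>n. L2norm M (\<lambda>x. f n x - g x)) \<longlonglongrightarrow> 0"
    from tendsto_power[OF this, of 2] show "(\<lambda>n. (L2norm M (\<lambda>x. f n x - g x))\<^sup>2) \<longlonglongrightarrow> 0" by simp
  qed
  then show ?thesis using assms by (simp add: L2_tendsto_def L2norm_power2)
qed

lemma L2_tendsto_const: "square_integrable M f \<Longrightarrow> L2_tendsto M (\<lambda>n. f) f"
  by (simp add: L2_tendsto_def L2norm_def)

lemma L2_tendsto_add:
  assumes "L2_tendsto M f g" "L2_tendsto M f' g'"
  shows "L2_tendsto M (\<lambda>n x. f n x + f' n x) (\<lambda>x. g x + g' x)"
proof -
  have s: "square_integrable M (f n)" "square_integrable M (f' n)" "square_integrable M g" "square_integrable M g'" for n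
    using assms by (auto simp: L2_tendsto_def)
  have "(\<lambda>n. L2norm M (\<lambda>x. (f n x + f' n x) - (g x + g' x))) \<longlonglongrightarrow> 0"
  proof (rule tendsto_sandwich[of "\<lambda>_. 0"])
    show "(\<lambda>n. L2norm M (\<lambda>x. f n x - g x) + L2norm M (\<lambda>x. f' n x - g' x)) \<longlonglongrightarrow> 0"
      using assms by (auto simp: L2_tendsto_def intro!: tendsto_add_zero)
    have "L2norm M (\<lambda>x. (f n x + f' n x) - (g x + g' x)) \<le> L2norm M (\<lambda>x. f n x - g x) + L2norm M (\<lambda>x. f' n x - g' x)" for n
      using L2norm_triangle[OF square_integrable_diff[OF s(1,3)] square_integrable_diff[OF s(2,4)], of n n]
      by (simp add: add_diff_add)
    then show "\<forall>\<^sub>F n in sequentially. L2norm M (\<lambda>x. (f n x + f' n x) - (g x + g' x))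
      \<le> L2norm M (\<lambda>x. f n x - g x) + L2norm M (\<lambda>x. f' n x - g' x)" by simp
  qed auto
  then show ?thesis using s by (auto simp: L2_tendsto_def intro!: square_integrable_add)
qed

lemma L2_tendsto_scaleR:
  assumes "L2_tendsto M f g"
  shows "L2_tendsto M (\<lambda>n x. c *\<^sub>R f n x) (\<lambda>x. c *\<^sub>R g x)"
  using assms by (auto simp: L2_tendsto_def square_integrable_scaleR L2norm_scaleR
      intro!: tendsto_mult_right_zero simp flip: scaleR_diff_right)

text \<open>The factor is \<open>\<bar>C\<bar>\<close> because on a null measure the bound almost
  everywhere does not force \<open>C\<close> to be nonnegative.\<close>

lemma square_integrable_bounded_mult:
  fixes w :: "'a \<Rightarrow> real"
  assumes w: "w \<in> borel_measurable M" "AE x in M. \<bar>w x\<bar> \<le> C" and f: "square_integrable M f"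
  shows "square_integrable M (\<lambda>x. w x *\<^sub>R f x)" "L2norm M (\<lambda>x. w x *\<^sub>R f x) \<le> \<bar>C\<bar> * L2norm M f"
proof -
  have le: "AE x in M. (norm (w x *\<^sub>R f x))\<^sup>2 \<le> C\<^sup>2 * (norm (f x))\<^sup>2"
    using w(2)
  proof eventually_elim
    case (elim x)
    then have "(w x)\<^sup>2 \<le> C\<^sup>2" using power_mono[of "\<bar>w x\<bar>" C 2] by simp
    then show ?case by (simp add: power_mult_distrib mult_right_mono)
  qed
  have I: "integrable M (\<lambda>x. C\<^sup>2 * (norm (f x))\<^sup>2)" using f by (simp add: square_integrable_def)
  have m: "(\<lambda>x. w x *\<^sub>R f x) \<in> borel_measurable M" using w f by (auto simp: square_integrable_def)
  have J: "integrable M (\<lambda>x. (norm (w x *\<^sub>R f x))\<^sup>2)"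
  proof (rule Bochner_Integration.integrable_bound[OF I])
    show "(\<lambda>x. (norm (w x *\<^sub>R f x))\<^sup>2) \<in> borel_measurable M" using m by measurable
    show "AE x in M. norm ((norm (w x *\<^sub>R f x))\<^sup>2) \<le> norm (C\<^sup>2 * (norm (f x))\<^sup>2)"
      using le by eventually_elim (simp only: real_norm_def abs_power2 abs_mult abs_norm_cancel)
  qed
  then show "square_integrable M (\<lambda>x. w x *\<^sub>R f x)" using m by (simp add: square_integrable_def)
  have "(LINT x|M. (norm (w x *\<^sub>R f x))\<^sup>2) \<le> (LINT x|M. C\<^sup>2 * (norm (f x))\<^sup>2)"
    by (rule integral_mono_AE[OF J I le])
  then have "(L2norm M (\<lambda>x. w x *\<^sub>R f x))\<^sup>2 \<le> (\<bar>C\<bar> * L2norm M f)\<^sup>2"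
    by (simp add: L2norm_power2 power_mult_distrib)
  then show "L2norm M (\<lambda>x. w x *\<^sub>R f x) \<le> \<bar>C\<bar> * L2norm M f"
    by (rule power2_le_imp_le) simp
qed

lemma L2_tendsto_bounded_mult:
  fixes w :: "'a \<Rightarrow> real"
  assumes w: "w \<in> borel_measurable M" "AE x in M. \<bar>w x\<bar> \<le> C" and f: "L2_tendsto M f g"
  shows "L2_tendsto M (\<lambda>n x. w x *\<^sub>R f n x) (\<lambda>x. w x *\<^sub>R g x)"
proof -
  have s: "square_integrable M (f n)" "square_integrable M g" for n using f by (auto simp: L2_tendsto_def)
  have "(\<lambda>n. L2norm M (\<lambda>x. w x *\<^sub>R f n x - w x *\<^sub>R g x)) \<longlonglongrightarrow> 0"
  proof (rule tendsto_sandwich[of "\<lambda>_. 0"])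
    show "(\<lambda>n. \<bar>C\<bar> * L2norm M (\<lambda>x. f n x - g x)) \<longlonglongrightarrow> 0"
      using f by (auto simp: L2_tendsto_def intro!: tendsto_mult_right_zero)
    show "\<forall>\<^sub>F n in sequentially. L2norm M (\<lambda>x. w x *\<^sub>R f n x - w x *\<^sub>R g x) \<le> \<bar>C\<bar> * L2norm M (\<lambda>x. f n x - g x)"
      using square_integrable_bounded_mult(2)[OF w square_integrable_diff[OF s]]
      by (simp add: scaleR_diff_right)
  qed auto
  then show ?thesis using s by (auto simp: L2_tendsto_def intro!: square_integrable_bounded_mult(1)[OF w])
qed

lemma L2_tendsto_inner:
  assumes f: "L2_tendsto M f f'" and g: "L2_tendsto M g g'"
  shows "(\<lambda>n. LINT x|M. f n x \<bullet> g n x) \<longlonglongrightarrow> (LINT x|M. f' x \<bullet> g' x)"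
proof -
  have s: "square_integrable M (f n)" "square_integrable M f'" "square_integrable M (g n)" "square_integrable M g'" for n
    using f g by (auto simp: L2_tendsto_def)
  let ?a = "\<lambda>n. L2norm M (\<lambda>x. f n x - f' x)" and ?b = "\<lambda>n. L2norm M (\<lambda>x. g n x - g' x)"
  have ab: "?a \<longlonglongrightarrow> 0" "?b \<longlonglongrightarrow> 0" using f g by (auto simp: L2_tendsto_def)
  have "(\<lambda>n. (LINT x|M. f n x \<bullet> g n x) - (LINT x|M. f' x \<bullet> g' x)) \<longlonglongrightarrow> 0"
  proof (rule tendsto_rabs_zero_cancel, rule tendsto_sandwich[of "\<lambda>_. 0"])
    have "(\<lambda>n. ?a n * (L2norm M g' + ?b n) + L2norm M f' * ?b n) \<longlonglongrightarrow> 0 * (L2norm M g' + 0) + L2norm M f' * 0"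
      by (intro tendsto_intros ab)
    then show "(\<lambda>n. ?a n * (L2norm M g' + ?b n) + L2norm M f' * ?b n) \<longlonglongrightarrow> 0" by simp
    have "\<bar>(LINT x|M. f n x \<bullet> g n x) - (LINT x|M. f' x \<bullet> g' x)\<bar> \<le> ?a n * (L2norm M g' + ?b n) + L2norm M f' * ?b n" for n
    proof -
      have "(LINT x|M. f n x \<bullet> g n x) - (LINT x|M. f' x \<bullet> g' x)
        = (LINT x|M. (f n x - f' x) \<bullet> g n x) + (LINT x|M. f' x \<bullet> (g n x - g' x))"
        using integrable_inner_square_integrable[OF s(1,3)] integrable_inner_square_integrable[OF s(2,3)]
          integrable_inner_square_integrable[OF s(2,4)]
        by (simp add: inner_diff_left inner_diff_right)
      also have "\<bar>\<dots>\<bar> \<le> ?a n * L2norm M (g n) + L2norm M f' * ?b n"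
        by (intro order_trans[OF abs_triangle_ineq] add_mono L2_Cauchy_Schwarz square_integrable_diff s)
      also have "L2norm M (g n) \<le> L2norm M g' + ?b n"
        using L2norm_triangle[OF s(4) square_integrable_diff[OF s(3,4)], of n] by simp
      finally show ?thesis by (simp add: mult_left_mono)
    qed
    then show "\<forall>\<^sub>F n in sequentially. \<bar>(LINT x|M. f n x \<bullet> g n x) - (LINT x|M. f' x \<bullet> g' x)\<bar>
      \<le> ?a n * (L2norm M g' + ?b n) + L2norm M f' * ?b n" by simp
  qed auto
  then show ?thesis by (simp add: LIM_zero_iff)
qed

text \<open>Completeness: along a subsequence with summable increments the sequence converges almost
  everywhere, and Fatou's lemma turns this into convergence in mean square.\<close>

lemma L2_complete:
  fixes f :: "nat \<Rightarrow> 'a \<Rightarrow> 'b::euclidean_space"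
  assumes s: "\<And>n. square_integrable M (f n)"
    and Cau: "\<And>e. e > 0 \<Longrightarrow> \<exists>N. \<forall>m\<ge>N. \<forall>n\<ge>N. (LINT x|M. (norm (f m x - f n x))\<^sup>2) < e"
  shows "\<exists>g. L2_tendsto M f g"
proof -
  have meas [measurable]: "f n \<in> borel_measurable M" for n using s by (auto simp: square_integrable_def)
  have sd: "integrable M (\<lambda>x. (norm (f m x - f n x))\<^sup>2)" for m n
    using square_integrable_diff[OF s s] by (auto simp: square_integrable_def)
  have "\<forall>k. \<exists>N. \<forall>m\<ge>N. \<forall>n\<ge>N. (LINT x|M. (norm (f m x - f n x))\<^sup>2) < (1/4)^k"
    by (intro allI Cau) simp
  then obtain N where N: "\<And>k m n. N k \<le> m \<Longrightarrow> N k \<le> n \<Longrightarrow> (LINT x|M. (norm (f m x - f n x))\<^sup>2) < (1/4)^k"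
    by metis
  \<comment> \<open>The sum makes the indices monotone and at least \<open>N k\<close>; the summand
    \<open>k\<close> makes them tend to infinity.\<close>
  define r where "r k = (\<Sum>j\<le>k. N j) + k" for k
  have r: "N k \<le> r k" "r k \<le> r (Suc k)" "k \<le> r k" for k
    by (auto simp: r_def intro!: trans_le_add1 member_le_sum)
  \<comment> \<open>The increments have squared norm below \<open>(1/4)^k\<close>, so the weight
    \<open>2^k\<close> still leaves summable integrals. Where the series of the \<open>d k x\<close>
    converges its terms are bounded, and the weight then forces geometric decay of the
    increments.\<close>
  define d where "d k x = 2^k * (norm (f (r (Suc k)) x - f (r k) x))\<^sup>2" for k x
  have dI: "integrable M (d k)" "(LINT x|M. d k x) \<le> (1/2)^k" for k
  proof -
    show "integrable M (d k)" unfolding d_def using sd by simp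
    have "(LINT x|M. d k x) = 2^k * (LINT x|M. (norm (f (r (Suc k)) x - f (r k) x))\<^sup>2)" by (simp add: d_def)
    also have "\<dots> \<le> 2^k * (1/4)^k"
      using N[of k "r (Suc k)" "r k"] r[of k] by (intro mult_left_mono) auto
    also have "\<dots> = (1/2)^k" by (simp flip: power_mult_distrib)
    finally show "(LINT x|M. d k x) \<le> (1/2)^k" .
  qed
  have "AE x in M. summable (\<lambda>k. d k x)"
  proof -
    have [measurable]: "d k \<in> borel_measurable M" for k unfolding d_def by measurable
    have "(\<integral>\<^sup>+x. (\<Sum>k. ennreal (d k x)) \<partial>M) = (\<Sum>k. \<integral>\<^sup>+x. ennreal (d k x) \<partial>M)"
      by (intro nn_integral_suminf) auto
    also have "\<dots> = (\<Sum>k. ennreal (LINT x|M. d k x))"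
      using dI by (subst nn_integral_eq_integral) (auto simp: d_def)
    also have "\<dots> \<le> (\<Sum>k. ennreal ((1/2)^k))"
      using dI by (intro suminf_le ennreal_leI) auto
    also have "\<dots> < \<infinity>"
      by (subst suminf_ennreal2) (auto simp: summable_geometric)
    finally have "AE x in M. (\<Sum>k. ennreal (d k x)) \<noteq> \<infinity>"
      by (intro nn_integral_PInf_AE) auto
    then show ?thesis
      by eventually_elim (rule summable_suminf_not_top, auto simp: d_def)
  qed
  then have "AE x in M. convergent (\<lambda>k. f (r k) x)"
  proof eventually_elim
    case (elim x)
    have "Bseq (\<lambda>k. d k x)" using elim by (metis summable_LIMSEQ_zero convergentI convergent_imp_Bseq)
    then obtain B where B: "B > 0" "\<And>k. norm (d k x) \<le> B" by (auto simp: Bseq_def)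
    have "norm (f (r (Suc k)) x - f (r k) x) \<le> sqrt B * (sqrt (1/2))^k" for k
    proof -
      have "(norm (f (r (Suc k)) x - f (r k) x))\<^sup>2 \<le> B / 2^k"
        using B(2)[of k] by (simp add: d_def field_simps abs_mult)
      then have "norm (f (r (Suc k)) x - f (r k) x) \<le> sqrt (B / 2^k)" by (rule real_le_rsqrt)
      also have "\<dots> = sqrt B * (sqrt (1/2))^k" by (simp add: real_sqrt_divide real_sqrt_power power_divide)
      finally show ?thesis .
    qed
    moreover have "summable (\<lambda>k. sqrt B * (sqrt (1/2))^k)"
      by (intro summable_mult summable_geometric) (simp add: real_sqrt_divide)
    ultimately have "summable (\<lambda>k. f (r (Suc k)) x - f (r k) x)"
      by (metis (no_types, lifting) summable_comparison_test)
    then have "convergent (\<lambda>n. \<Sum>k<n. f (r (Suc k)) x - f (r k) x)" by (simp add: summable_iff_convergent)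
    then have "convergent (\<lambda>n. f (r n) x - f (r 0) x)" 
      using sum_lessThan_telescope[of "\<lambda>k. f (r k) x"] by simp
    then have "convergent (\<lambda>n. (f (r n) x - f (r 0) x) + f (r 0) x)" by (intro convergent_add convergent_const)
    then show ?case by simp
  qed
  then have lim: "AE x in M. (\<lambda>k. f (r k) x) \<longlonglongrightarrow> lim (\<lambda>k. f (r k) x)"
    by eventually_elim (simp add: convergent_LIMSEQ_iff)
  define g where "g x = lim (\<lambda>k. f (r k) x)" for x
  have g [measurable]: "g \<in> borel_measurable M" unfolding g_def by measurable
  \<comment> \<open>The index \<open>n\<close> belongs to the full sequence and only the second
    index runs along the subsequence, so the conclusion concerns the whole sequence. It is used with
    bound 1, to see that \<open>g\<close> is square integrable, and with \<open>e / 2\<close>, for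
    the convergence.\<close>
  have fatou: "integrable M (\<lambda>x. (norm (f n x - g x))\<^sup>2) \<and> (LINT x|M. (norm (f n x - g x))\<^sup>2) \<le> e"
    if "\<And>k. N' \<le> k \<Longrightarrow> (LINT x|M. (norm (f n x - f k x))\<^sup>2) \<le> e" for n N' e
  proof -
    have "0 \<le> (LINT x|M. (norm (f n x - f N' x))\<^sup>2)" by simp
    then have e0: "0 \<le> e" using that[of N'] by linarith
    have "(\<integral>\<^sup>+x. ennreal ((norm (f n x - g x))\<^sup>2) \<partial>M) = (\<integral>\<^sup>+x. liminf (\<lambda>k. ennreal ((norm (f n x - f (r k) x))\<^sup>2)) \<partial>M)"
    proof (rule nn_integral_cong_AE)
      show "AE x in M. ennreal ((norm (f n x - g x))\<^sup>2) = liminf (\<lambda>k. ennreal ((norm (f n x - f (r k) x))\<^sup>2))"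
        using lim
      proof eventually_elim
        case (elim x)
        then have "(\<lambda>k. ennreal ((norm (f n x - f (r k) x))\<^sup>2)) \<longlonglongrightarrow> ennreal ((norm (f n x - g x))\<^sup>2)"
          unfolding g_def by (intro tendsto_intros tendsto_ennrealI) auto
        then show ?case by (metis lim_imp_Liminf trivial_limit_sequentially)
      qed
    qed
    also have "\<dots> \<le> liminf (\<lambda>k. \<integral>\<^sup>+x. ennreal ((norm (f n x - f (r k) x))\<^sup>2) \<partial>M)"
      by (rule nn_integral_liminf) measurable
    also have "\<dots> \<le> liminf (\<lambda>k. ennreal e)"
    proof (rule Liminf_mono)
      have "(\<integral>\<^sup>+x. ennreal ((norm (f n x - f (r k) x))\<^sup>2) \<partial>M) \<le> ennreal e" if "N' \<le> k" for k
        using sd[of n "r k"] \<open>N' \<le> k\<close> r(3)[of k] that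
          \<open>\<And>k. N' \<le> k \<Longrightarrow> (LINT x|M. (norm (f n x - f k x))\<^sup>2) \<le> e\<close>[of "r k"]
        by (subst nn_integral_eq_integral) (auto intro!: ennreal_leI)
      then show "\<forall>\<^sub>F k in sequentially. (\<integral>\<^sup>+x. ennreal ((norm (f n x - f (r k) x))\<^sup>2) \<partial>M) \<le> ennreal e"
        using eventually_sequentially by blast
    qed
    also have "\<dots> = ennreal e" by (simp add: Liminf_const)
    finally have le: "(\<integral>\<^sup>+x. ennreal ((norm (f n x - g x))\<^sup>2) \<partial>M) \<le> ennreal e" .
    have I: "integrable M (\<lambda>x. (norm (f n x - g x))\<^sup>2)"
      by (rule integrableI_bounded) (use le in \<open>auto simp: less_top[symmetric] top_unique intro: le_less_trans\<close>)
    then have "ennreal (LINT x|M. (norm (f n x - g x))\<^sup>2) \<le> ennreal e"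
      using le by (subst (asm) nn_integral_eq_integral) auto
    then show ?thesis using I e0 by (simp add: ennreal_le_iff)
  qed
  obtain N1 where N1: "\<And>m n. N1 \<le> m \<Longrightarrow> N1 \<le> n \<Longrightarrow> (LINT x|M. (norm (f m x - f n x))\<^sup>2) < 1"
    using Cau[of 1] by auto
  have "square_integrable M (\<lambda>x. f N1 x - g x)"
    using fatou[of N1 N1 1] N1[of N1] by (force simp: square_integrable_def less_imp_le)
  from square_integrable_diff[OF s[of N1] this] have sg: "square_integrable M g" by simp
  have "(\<lambda>n. LINT x|M. (norm (f n x - g x))\<^sup>2) \<longlonglongrightarrow> 0"
  proof (rule LIMSEQ_I)
    fix e :: real assume e: "0 < e"
    obtain N2 where N2: "\<And>m n. N2 \<le> m \<Longrightarrow> N2 \<le> n \<Longrightarrow> (LINT x|M. (norm (f m x - f n x))\<^sup>2) < e / 2"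
      using Cau[of "e/2"] e by auto
    have "(LINT x|M. (norm (f n x - g x))\<^sup>2) \<le> e / 2" if "N2 \<le> n" for n
      using fatou[of N2 n "e/2"] N2[OF that] by (simp add: less_imp_le)
    then show "\<exists>N2. \<forall>n\<ge>N2. norm ((LINT x|M. (norm (f n x - g x))\<^sup>2) - 0) < e"
      using e by (intro exI[of _ N2]) fastforce
  qed
  then show ?thesis using L2_tendsto_iff[of M f g, OF s sg] by blast
qed

section \<open>Compactness and the Poincare inequality for test functions\<close>

lemma GDERIV_line:
  assumes "\<And>x. GDERIV f x :> D x"
  shows "((\<lambda>t. f (x + t *\<^sub>R v)) has_real_derivative D (x + t *\<^sub>R v) \<bullet> v) (at t)"
proof -
  have "((\<lambda>t. f (x + t *\<^sub>R v)) has_derivative (\<lambda>h. (0 + h *\<^sub>R v) \<bullet> D (x + t *\<^sub>R v))) (at t)"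
    by (rule has_derivative_compose[of "\<lambda>t. x + t *\<^sub>R v" _ _ _ f])
      (use assms in \<open>auto intro!: derivative_eq_intros simp: gderiv_def\<close>)
  then show ?thesis
    by (simp add: has_field_derivative_def inner_commute mult_commute_abs)
qed

lemma GDERIV_isCont: "GDERIV f x :> D \<Longrightarrow> isCont f x"
  by (auto simp: gderiv_def intro: has_derivative_continuous)

lemma test_functionD:
  assumes "test_function \<Omega> \<phi> D"
  shows "GDERIV \<phi> x :> D x" "continuous_on UNIV D" "continuous_on UNIV \<phi>"
    and "x \<notin> \<Omega> \<Longrightarrow> \<phi> x = 0" "x \<notin> \<Omega> \<Longrightarrow> D x = 0"
proof -
  show G: "GDERIV \<phi> x :> D x" and "continuous_on UNIV D" for x using assms by (auto simp: test_function_def)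
  show "continuous_on UNIV \<phi>" using GDERIV_isCont[OF G] by (auto simp: continuous_on_eq_continuous_at)
  have cl: "closure {x. \<phi> x \<noteq> 0} \<subseteq> \<Omega>" using assms by (auto simp: test_function_def)
  have z: "\<phi> y = 0" if "y \<notin> closure {x. \<phi> x \<noteq> 0}" for y
    using subsetD[OF closure_subset, of y "{x. \<phi> x \<noteq> 0}"] that by auto
  assume x: "x \<notin> \<Omega>"
  show "\<phi> x = 0" by (rule z) (use cl x in blast)
  have xc: "x \<in> - closure {x. \<phi> x \<noteq> 0}" using x cl by auto
  have "(\<phi> has_derivative (\<lambda>_. 0)) (at x)"
  proof (rule has_derivative_transform_within_open)
    show "((\<lambda>_. 0) has_derivative (\<lambda>_. 0)) (at x)" by (rule has_derivative_const)
    show "open (- closure {x. \<phi> x \<noteq> 0})" by (rule open_Compl[OF closed_closure])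
    show "0 = \<phi> y" if "y \<in> - closure {x. \<phi> x \<noteq> 0}" for y
      by (rule z[symmetric]) (use that in blast)
  qed fact
  then have "(\<lambda>h. h \<bullet> D x) = (\<lambda>_. 0)"
    using has_derivative_unique[OF G[of x, unfolded gderiv_def]] by blast
  from fun_cong[OF this, of "D x"] show "D x = 0" by simp
qed

lemma test_function_borel_measurable [measurable_dest]:
  assumes "test_function \<Omega> \<phi> D"
  shows "\<phi> \<in> borel_measurable borel" "D \<in> borel_measurable borel"
  using test_functionD[OF assms] by (auto intro: borel_measurable_continuous_onI)

lemma test_function_lincomb:
  assumes "test_function \<Omega> \<phi> D" "test_function \<Omega> \<psi> E"
  shows "test_function \<Omega> (\<lambda>x. a * \<phi> x + b * \<psi> x) (\<lambda>x. a *\<^sub>R D x + b *\<^sub>R E x)"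
  unfolding test_function_def
proof (intro conjI allI)
  show "GDERIV (\<lambda>x. a * \<phi> x + b * \<psi> x) x :> a *\<^sub>R D x + b *\<^sub>R E x" for x
    using test_functionD(1)[OF assms(1), of x] test_functionD(1)[OF assms(2), of x]
    unfolding gderiv_def by (auto intro!: derivative_eq_intros simp: inner_add_right)
  show "continuous_on UNIV (\<lambda>x. a *\<^sub>R D x + b *\<^sub>R E x)"
    using test_functionD(2)[OF assms(1)] test_functionD(2)[OF assms(2)] by (intro continuous_intros)
  have sub: "closure {x. a * \<phi> x + b * \<psi> x \<noteq> 0} \<subseteq> closure {x. \<phi> x \<noteq> 0} \<union> closure {x. \<psi> x \<noteq> 0}"
    unfolding closure_Un[symmetric] by (rule closure_mono) auto
  then show "closure {x. a * \<phi> x + b * \<psi> x \<noteq> 0} \<subseteq> \<Omega>"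
    using assms by (auto simp: test_function_def)
  show "compact (closure {x. a * \<phi> x + b * \<psi> x \<noteq> 0})"
    using compact_Int_closed[OF compact_Un[of "closure {x. \<phi> x \<noteq> 0}" "closure {x. \<psi> x \<noteq> 0}"] closed_closure[of "{x. a * \<phi> x + b * \<psi> x \<noteq> 0}"]] assms
      Int_absorb1[OF sub]
    by (auto simp: test_function_def Int_commute)
qed

lemma integrable_continuous_bounded_support:
  fixes f :: "'a::euclidean_space \<Rightarrow> 'b::euclidean_space"
  assumes "continuous_on UNIV f" "bounded \<Omega>" "\<And>x. x \<notin> \<Omega> \<Longrightarrow> f x = 0"
  shows "integrable lborel f"
proof -
  have "integrable lborel (\<lambda>x. indicator (closure \<Omega>) x *\<^sub>R f x)"
    using assms by (intro borel_integrable_compact) (auto simp: compact_closure intro: continuous_on_subset)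
  moreover have "(\<lambda>x. indicator (closure \<Omega>) x *\<^sub>R f x) = f"
    using assms(3) closure_subset[of \<Omega>] by (auto simp: indicator_def fun_eq_iff)
  ultimately show ?thesis by simp
qed

lemma nn_integral_lborel_shift:
  fixes f :: "'a::euclidean_space \<Rightarrow> ennreal"
  assumes [measurable]: "f \<in> borel_measurable borel"
  shows "(\<integral>\<^sup>+x. f (x + c) \<partial>lborel) = (\<integral>\<^sup>+x. f x \<partial>lborel)"
proof -
  have "(\<integral>\<^sup>+x. f x \<partial>lborel) = (\<integral>\<^sup>+x. f x \<partial>distr lborel borel ((+) c))" by (simp add: lborel_distr_plus)
  also have "\<dots> = (\<integral>\<^sup>+x. f (x + c) \<partial>lborel)" by (subst nn_integral_distr) (auto simp: add.commute)
  finally show ?thesis by simp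
qed

text \<open>Jensen's inequality on [0,1]: by the fundamental theorem the increment \<open>c\<close>
  is the mean of \<open>g\<close>, and the variance of \<open>g\<close> is nonnegative.\<close>

lemma increment_power2_le:
  fixes f :: "'a::real_inner \<Rightarrow> real"
  assumes G: "\<And>x. GDERIV f x :> D x" and D: "continuous_on UNIV D"
  shows "ennreal ((f (x + v) - f x)\<^sup>2) \<le> (\<integral>\<^sup>+t. ennreal ((D (x + t *\<^sub>R v) \<bullet> v)\<^sup>2) * indicator {0..1} t \<partial>lborel)"
proof -
  define g where "g t = D (x + t *\<^sub>R v) \<bullet> v" for t
  define c where "c = f (x + v) - f x"
  have g: "isCont g t" for t
  proof -
    have "continuous_on UNIV g" unfolding g_def
      by (intro continuous_intros continuous_on_compose2[OF D]) auto
    then show ?thesis by (simp add: continuous_on_eq_continuous_at)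
  qed
  have "((\<lambda>t. f (x + t *\<^sub>R v)) has_real_derivative g t) (at t)" for t
    unfolding g_def by (rule GDERIV_line[OF G])
  then have c: "(LINT t|lborel. g t * indicator {0..1} t) = c"
    using integral_FTC_Icc_real[of 0 1 "\<lambda>t. f (x + t *\<^sub>R v)" g] g by (simp add: c_def)
  have I: "integrable lborel (\<lambda>t. g t * indicator {0..1} t)" "integrable lborel (\<lambda>t. (g t)\<^sup>2 * indicator {0..1} t)"
    "integrable lborel (\<lambda>t. c\<^sup>2 * indicator {0..1::real} t)"
    using g by (auto intro!: borel_integrable_atLeastAtMost continuous_intros)
  have "0 \<le> (LINT t|lborel. (g t - c)\<^sup>2 * indicator {0..1} t)"
    by (rule Bochner_Integration.integral_nonneg) simp
  also have "\<dots> = (LINT t|lborel. (g t)\<^sup>2 * indicator {0..1} t - 2 * c * (g t * indicator {0..1} t) + c\<^sup>2 * indicator {0..1} t)"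
    by (rule Bochner_Integration.integral_cong) (auto simp: power2_diff algebra_simps indicator_def)
  also have "\<dots> = (LINT t|lborel. (g t)\<^sup>2 * indicator {0..1} t) - c\<^sup>2"
    using I c by (simp add: power2_eq_square)
  finally have "c\<^sup>2 \<le> (LINT t|lborel. (g t)\<^sup>2 * indicator {0..1} t)" by simp
  then have "ennreal (c\<^sup>2) \<le> ennreal (LINT t|lborel. (g t)\<^sup>2 * indicator {0..1} t)" by (rule ennreal_leI)
  also have "\<dots> = (\<integral>\<^sup>+t. ennreal ((g t)\<^sup>2 * indicator {0..1} t) \<partial>lborel)"
    using I(2) by (subst nn_integral_eq_integral) auto
  also have "\<dots> = (\<integral>\<^sup>+t. ennreal ((g t)\<^sup>2) * indicator {0..1} t \<partial>lborel)"
    by (rule nn_integral_cong) (auto simp: indicator_def)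
  finally show ?thesis by (simp add: g_def c_def)
qed

text \<open>Integrate the pointwise bound over \<open>x\<close>, exchange the integrals, and use
  that shifting by \<open>t *\<^sub>R v\<close> does not change the inner one. Integrals valued in
  \<open>ennreal\<close> avoid any integrability assumption.\<close>

lemma L2_translate_le:
  fixes f :: "'a::euclidean_space \<Rightarrow> real"
  assumes G: "\<And>x. GDERIV f x :> D x" and D: "continuous_on UNIV D"
  shows "(\<integral>\<^sup>+x. ennreal ((f (x + v) - f x)\<^sup>2) \<partial>lborel) \<le> ennreal ((norm v)\<^sup>2) * (\<integral>\<^sup>+x. ennreal ((norm (D x))\<^sup>2) \<partial>lborel)"
proof -
  have [measurable]: "D \<in> borel_measurable borel" using D by (rule borel_measurable_continuous_onI)
  have "(\<integral>\<^sup>+x. ennreal ((f (x + v) - f x)\<^sup>2) \<partial>lborel)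
      \<le> (\<integral>\<^sup>+x. (\<integral>\<^sup>+t. ennreal ((D (x + t *\<^sub>R v) \<bullet> v)\<^sup>2) * indicator {0..1} t \<partial>lborel) \<partial>lborel)"
    by (intro nn_integral_mono increment_power2_le[OF G D])
  also have "\<dots> = (\<integral>\<^sup>+t. (\<integral>\<^sup>+x. ennreal ((D (x + t *\<^sub>R v) \<bullet> v)\<^sup>2) * indicator {0..1} t \<partial>lborel) \<partial>lborel)"
    by (rule lborel_pair.Fubini') measurable
  also have "\<dots> \<le> (\<integral>\<^sup>+t. (ennreal ((norm v)\<^sup>2) * (\<integral>\<^sup>+x. ennreal ((norm (D x))\<^sup>2) \<partial>lborel)) * indicator {0..1::real} t \<partial>lborel)"
  proof (rule nn_integral_mono)
    fix t :: real
    have "(\<integral>\<^sup>+x. ennreal ((D (x + t *\<^sub>R v) \<bullet> v)\<^sup>2) \<partial>lborel) = (\<integral>\<^sup>+x. ennreal ((D x \<bullet> v)\<^sup>2) \<partial>lborel)"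
      by (rule nn_integral_lborel_shift) measurable
    also have "\<dots> \<le> (\<integral>\<^sup>+x. ennreal ((norm v)\<^sup>2) * ennreal ((norm (D x))\<^sup>2) \<partial>lborel)"
    proof (rule nn_integral_mono)
      fix x
      have "\<bar>D x \<bullet> v\<bar>\<^sup>2 \<le> (norm (D x) * norm v)\<^sup>2" by (intro power_mono Cauchy_Schwarz_ineq2) auto
      then show "ennreal ((D x \<bullet> v)\<^sup>2) \<le> ennreal ((norm v)\<^sup>2) * ennreal ((norm (D x))\<^sup>2)"
        by (simp add: ennreal_mult[symmetric] power_mult_distrib mult.commute ennreal_leI)
    qed
    also have "\<dots> = ennreal ((norm v)\<^sup>2) * (\<integral>\<^sup>+x. ennreal ((norm (D x))\<^sup>2) \<partial>lborel)"
      by (rule nn_integral_cmult) measurable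
    finally show "(\<integral>\<^sup>+x. ennreal ((D (x + t *\<^sub>R v) \<bullet> v)\<^sup>2) * indicator {0..1} t \<partial>lborel)
      \<le> (ennreal ((norm v)\<^sup>2) * (\<integral>\<^sup>+x. ennreal ((norm (D x))\<^sup>2) \<partial>lborel)) * indicator {0..1} t"
      by (auto simp: indicator_def)
  qed
  also have "\<dots> = ennreal ((norm v)\<^sup>2) * (\<integral>\<^sup>+x. ennreal ((norm (D x))\<^sup>2) \<partial>lborel)"
    by (subst nn_integral_cmult) auto
  finally show ?thesis .
qed

section \<open>Rellich compactness by averages over grid cells\<close>

definition grid_cell :: "real \<Rightarrow> int \<times> int \<Rightarrow> complex set" where
  "grid_cell h k = {z. \<lfloor>Re z / h\<rfloor> = fst k \<and> \<lfloor>Im z / h\<rfloor> = snd k}"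

lemma grid_cell_measurable [measurable]: "grid_cell h k \<in> sets borel"
  unfolding grid_cell_def by measurable

lemma grid_cell_emeasure:
  assumes h: "0 < h" shows "emeasure lborel (grid_cell h k) = ennreal (h\<^sup>2)"
proof -
  define l where "l = Complex (h * fst k) (h * snd k)"
  define u where "u = Complex (h * (fst k + 1)) (h * (snd k + 1))"
  have lu: "\<forall>b\<in>Basis. l \<bullet> b \<le> u \<bullet> b" using h by (auto simp: Basis_complex_def l_def u_def)
  have eq: "grid_cell h k = {z. h * fst k \<le> Re z \<and> Re z < h * (fst k + 1) \<and> h * snd k \<le> Im z \<and> Im z < h * (snd k + 1)}"
    using h by (auto simp: grid_cell_def floor_eq_iff field_simps)
  have m: "(\<Prod>b\<in>Basis. (u - l) \<bullet> b) = h\<^sup>2"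
    by (simp add: Basis_complex_def l_def u_def power2_eq_square algebra_simps)
  have "box l u \<subseteq> grid_cell h k" "grid_cell h k \<subseteq> cbox l u"
    by (auto simp: eq box_def cbox_def Basis_complex_def l_def u_def)
  then have "emeasure lborel (box l u) \<le> emeasure lborel (grid_cell h k)"
    "emeasure lborel (grid_cell h k) \<le> emeasure lborel (cbox l u)"
    by (auto intro!: emeasure_mono)
  then show ?thesis using lu m by (simp add: emeasure_lborel_box_eq emeasure_lborel_cbox_eq)
qed

lemma grid_cell_close:
  assumes h: "0 < h" and "x \<in> grid_cell h k" "y \<in> grid_cell h k"
  shows "norm (y - x) \<le> 2 * h"
proof -
  have "\<bar>Re y / h - Re x / h\<bar> \<le> 1" "\<bar>Im y / h - Im x / h\<bar> \<le> 1"
    using assms unfolding grid_cell_def by (auto; linarith)+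
  then have "\<bar>Re (y - x)\<bar> \<le> h" "\<bar>Im (y - x)\<bar> \<le> h"
    using h by (auto simp: diff_divide_distrib[symmetric] divide_le_eq)
  then show ?thesis using cmod_le[of "y - x"] by linarith
qed

text \<open>Used twice: with \<open>c = f x\<close>, to evaluate a double integral over the cell,
  and with \<open>c\<close> the mean of \<open>f\<close> over the cell, to see that the variance is
  nonnegative.\<close>

lemma grid_deviation:
  fixes f :: "complex \<Rightarrow> real" and k :: "int \<times> int"
  assumes h: "0 < h" and f: "integrable lborel f" "integrable lborel (\<lambda>x. (f x)\<^sup>2)"
  defines "q \<equiv> indicator (grid_cell h k) :: complex \<Rightarrow> real"
  shows "integrable lborel q" "integrable lborel (\<lambda>x. q x * f x)" "integrable lborel (\<lambda>x. q x * (f x)\<^sup>2)"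
    and "(LINT x|lborel. q x) = h\<^sup>2" "integrable lborel (\<lambda>y. q y * (f y - c)\<^sup>2)"
    and "(LINT y|lborel. q y * (f y - c)\<^sup>2) =
      (LINT y|lborel. q y * (f y)\<^sup>2) - 2 * c * (LINT y|lborel. q y * f y) + h\<^sup>2 * c\<^sup>2"
proof -
  have m: "measure lborel (grid_cell h k) = h\<^sup>2"
    using grid_cell_emeasure[OF h, of k] by (simp add: measure_def)
  show q: "integrable lborel q" "(LINT x|lborel. q x) = h\<^sup>2"
    unfolding q_def using grid_cell_emeasure[OF h, of k] m by (auto intro!: integrable_real_indicator)
  show qf: "integrable lborel (\<lambda>x. q x * f x)" "integrable lborel (\<lambda>x. q x * (f x)\<^sup>2)"
    unfolding q_def using integrable_real_mult_indicator[of "grid_cell h k" lborel f]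
      integrable_real_mult_indicator[of "grid_cell h k" lborel "\<lambda>x. (f x)\<^sup>2"] f
    by (auto simp: mult.commute)
  have e: "q y * (f y - c)\<^sup>2 = q y * (f y)\<^sup>2 - 2 * c * (q y * f y) + c\<^sup>2 * q y" for y
    by (simp add: power2_diff algebra_simps)
  show "integrable lborel (\<lambda>y. q y * (f y - c)\<^sup>2)"
    and "(LINT y|lborel. q y * (f y - c)\<^sup>2) =
      (LINT y|lborel. q y * (f y)\<^sup>2) - 2 * c * (LINT y|lborel. q y * f y) + h\<^sup>2 * c\<^sup>2"
    unfolding e using q qf by simp_all
qed

text \<open>The variance on a cell written with pairs of points instead of the mean: differences
  \<open>f y - f x\<close> can be estimated by translations.\<close>

lemma grid_double_integral:
  fixes f :: "complex \<Rightarrow> real" and k :: "int \<times> int"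
  assumes h: "0 < h" and f: "integrable lborel f" "integrable lborel (\<lambda>x. (f x)\<^sup>2)"
  defines "q \<equiv> indicator (grid_cell h k) :: complex \<Rightarrow> real"
  shows "(\<integral>\<^sup>+x. (\<integral>\<^sup>+y. ennreal (q x * q y * (f y - f x)\<^sup>2) \<partial>lborel) \<partial>lborel)
    = ennreal (2 * h\<^sup>2 * (LINT x|lborel. q x * (f x)\<^sup>2) - 2 * (LINT x|lborel. q x * f x)\<^sup>2)"
proof -
  note I = grid_deviation[OF h f, of k, folded q_def]
  define m where "m = (LINT x|lborel. q x * f x)"
  define s where "s = (LINT x|lborel. q x * (f x)\<^sup>2)"
  have q0: "0 \<le> q x" for x by (simp add: q_def)
  define d where "d x = q x * (s - 2 * f x * m + h\<^sup>2 * (f x)\<^sup>2)" for x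
  have dx: "(LINT y|lborel. q x * (q y * (f y - f x)\<^sup>2)) = d x" for x
    using I(6)[of "f x"] by (simp add: d_def s_def m_def)
  have d0: "0 \<le> d x" for x
    unfolding dx[symmetric] by (rule Bochner_Integration.integral_nonneg) (simp add: q0)
  have inner: "(\<integral>\<^sup>+y. ennreal (q x * q y * (f y - f x)\<^sup>2) \<partial>lborel) = ennreal (d x)" for x
    unfolding dx[symmetric] mult.assoc
    by (rule nn_integral_eq_integral) (use I(5)[of "f x"] q0 in auto)
  have e: "d x = s * q x - 2 * m * (q x * f x) + h\<^sup>2 * (q x * (f x)\<^sup>2)" for x
    by (simp add: d_def algebra_simps)
  have "(\<integral>\<^sup>+x. ennreal (d x) \<partial>lborel) = ennreal (LINT x|lborel. d x)"
    by (rule nn_integral_eq_integral) (use I d0 in \<open>auto simp: e\<close>)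
  also have "(LINT x|lborel. d x) = s * h\<^sup>2 - 2 * m * m + h\<^sup>2 * s"
    unfolding e using I by (simp add: s_def[symmetric] m_def[symmetric])
  finally show ?thesis unfolding inner by (simp add: s_def m_def power2_eq_square algebra_simps)
qed

text \<open>A Poincare inequality with mean values, summed over the cells. Two points of one cell
  differ by a vector \<open>v\<close> of length at most \<open>2 * h\<close>, so all double
  integrals together are at most the integral over such \<open>v\<close> of the squared
  \<open>L^2\<close> distance between \<open>f\<close> and its translate, which is at most
  \<open>(2 * h)^2\<close> times the gradient integral. With area at most \<open>(4 * h)^2\<close>
  for the \<open>v\<close> this is \<open>64 * h^4\<close>, and division by \<open>2 * h^2\<close>
  leaves 32.\<close>

lemma grid_estimate:
  assumes t: "test_function \<Omega> f D" and b: "bounded \<Omega>" and h: "0 < h"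
    and K: "finite K" "\<Omega> \<subseteq> (\<Union>k\<in>K. grid_cell h k)"
  shows "(LINT x|lborel. (f x)\<^sup>2) \<le>
    (\<Sum>k\<in>K. (LINT x|lborel. indicator (grid_cell h k) x * f x)\<^sup>2) / h\<^sup>2 + 32 * h\<^sup>2 * (LINT x|lborel. (norm (D x))\<^sup>2)"
proof -
  note T = test_functionD[OF t]
  have [measurable]: "f \<in> borel_measurable borel" "D \<in> borel_measurable borel"
    using test_function_borel_measurable[OF t] by auto
  have If: "integrable lborel f" "integrable lborel (\<lambda>x. (f x)\<^sup>2)"
    using T(3,4) b by (auto intro!: integrable_continuous_bounded_support[of _ \<Omega>] continuous_intros)
  have ID: "integrable lborel (\<lambda>x. (norm (D x))\<^sup>2)"
    using T(2,5) b by (auto intro!: integrable_continuous_bounded_support[of _ \<Omega>] continuous_intros)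
  define S where "S = (LINT x|lborel. (norm (D x))\<^sup>2)"
  define m where "m k = (LINT x|lborel. indicator (grid_cell h k) x * f x)" for k
  define s where "s k = (LINT x|lborel. indicator (grid_cell h k) x * (f x)\<^sup>2)" for k
  have S0: "0 \<le> S" by (simp add: S_def)
  have nnS: "(\<integral>\<^sup>+x. ennreal ((norm (D x))\<^sup>2) \<partial>lborel) = ennreal S"
    using ID unfolding S_def by (intro nn_integral_eq_integral) auto
  have disj: "k = k'" if "x \<in> grid_cell h k" "x \<in> grid_cell h k'" for x k k'
    using that by (auto simp: grid_cell_def prod_eq_iff)
  define B :: "complex \<Rightarrow> real" where "B v = indicator (cball 0 (2 * h)) v" for v
  have [measurable]: "B \<in> borel_measurable borel"
    unfolding B_def[abs_def] by (auto intro!: borel_measurable_indicator)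
  let ?q = "\<lambda>k x. indicator (grid_cell h k) x :: real"
  \<comment> \<open>Cells are disjoint, so at most one term of the sum is nonzero; this merges the
    cells into a single function of \<open>y - x\<close>.\<close>
  have sum1: "(\<Sum>k\<in>K. ?q k x * ?q k y) \<le> B (y - x)" for x y
  proof (cases "\<exists>k\<in>K. x \<in> grid_cell h k \<and> y \<in> grid_cell h k")
    case True
    then obtain k where k: "k \<in> K" "x \<in> grid_cell h k" "y \<in> grid_cell h k" by auto
    have "(\<Sum>k\<in>K. ?q k x * ?q k y) = (\<Sum>k'\<in>K. if k' = k then 1 else 0)"
    proof (rule sum.cong)
      fix k' assume "k' \<in> K"
      show "?q k' x * ?q k' y = (if k' = k then 1 else 0)"
      proof (cases "k' = k")
        case False
        then have "x \<notin> grid_cell h k'" using disj[OF k(2), of k'] by blast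
        then show ?thesis using False by simp
      qed (use k in simp)
    qed simp
    then show ?thesis using k K grid_cell_close[OF h k(2,3)] by (simp add: indicator_def B_def)
  next
    case False
    then have "(\<Sum>k\<in>K. ?q k x * ?q k y) = 0" by (intro sum.neutral) (auto simp: indicator_def)
    then show ?thesis by (simp add: B_def)
  qed
  have nn: "0 \<le> 2 * h\<^sup>2 * s k - 2 * (m k)\<^sup>2" for k
  proof -
    have "0 \<le> (LINT x|lborel. ?q k x * (f x - m k / h\<^sup>2)\<^sup>2)" by (rule Bochner_Integration.integral_nonneg) simp
    also have "\<dots> = s k - 2 * (m k / h\<^sup>2) * m k + h\<^sup>2 * (m k / h\<^sup>2)\<^sup>2"
      using grid_deviation(6)[OF h If] by (simp add: s_def m_def)
    also have "\<dots> = s k - (m k)\<^sup>2 / h\<^sup>2" using h by (simp add: field_simps power2_eq_square)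
    finally show ?thesis using h by (simp add: field_simps)
  qed
  have "ennreal (\<Sum>k\<in>K. 2 * h\<^sup>2 * s k - 2 * (m k)\<^sup>2) = (\<Sum>k\<in>K. ennreal (2 * h\<^sup>2 * s k - 2 * (m k)\<^sup>2))"
    using nn by (simp add: sum_ennreal)
  also have "\<dots> = (\<Sum>k\<in>K. \<integral>\<^sup>+x. (\<integral>\<^sup>+y. ennreal (?q k x * ?q k y * (f y - f x)\<^sup>2) \<partial>lborel) \<partial>lborel)"
    unfolding s_def m_def using grid_double_integral[OF h If] by simp
  also have "\<dots> = (\<integral>\<^sup>+x. (\<integral>\<^sup>+y. ennreal ((\<Sum>k\<in>K. ?q k x * ?q k y) * (f y - f x)\<^sup>2) \<partial>lborel) \<partial>lborel)"
    by (simp add: nn_integral_sum[symmetric] sum_ennreal sum_distrib_right del: sum_ennreal)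
      (simp add: nn_integral_sum sum_ennreal[symmetric] del: sum_ennreal)
  also have "\<dots> \<le> (\<integral>\<^sup>+x. (\<integral>\<^sup>+y. ennreal (B (y - x) * (f y - f x)\<^sup>2) \<partial>lborel) \<partial>lborel)"
    using sum1 by (intro nn_integral_mono ennreal_leI mult_right_mono) auto
  also have "\<dots> = (\<integral>\<^sup>+x. (\<integral>\<^sup>+v. ennreal (B v * (f (x + v) - f x)\<^sup>2) \<partial>lborel) \<partial>lborel)"
  proof (rule nn_integral_cong)
    fix x
    have "(\<lambda>y. ennreal (B (y - x) * (f y - f x)\<^sup>2)) \<in> borel_measurable borel"
      by measurable
    from nn_integral_lborel_shift[OF this, of x]
    show "(\<integral>\<^sup>+y. ennreal (B (y - x) * (f y - f x)\<^sup>2) \<partial>lborel)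
      = (\<integral>\<^sup>+v. ennreal (B v * (f (x + v) - f x)\<^sup>2) \<partial>lborel)"
      by (simp add: add.commute)
  qed
  also have "\<dots> = (\<integral>\<^sup>+v. (\<integral>\<^sup>+x. ennreal (B v * (f (x + v) - f x)\<^sup>2) \<partial>lborel) \<partial>lborel)"
    by (rule lborel_pair.Fubini') measurable
  also have "\<dots> \<le> (\<integral>\<^sup>+v. ennreal ((2 * h)\<^sup>2 * S) * indicator (cball (0::complex) (2 * h)) v \<partial>lborel)"
  proof (rule nn_integral_mono)
    fix v :: complex
    have "(\<integral>\<^sup>+x. ennreal ((f (x + v) - f x)\<^sup>2) \<partial>lborel) \<le> ennreal ((norm v)\<^sup>2) * ennreal S"
      using L2_translate_le[OF T(1,2), of v] nnS by simp
    also have "\<dots> = ennreal ((norm v)\<^sup>2 * S)" using S0 by (simp add: ennreal_mult)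
    finally have le: "(\<integral>\<^sup>+x. ennreal ((f (x + v) - f x)\<^sup>2) \<partial>lborel) \<le> ennreal ((norm v)\<^sup>2 * S)" .
    show "(\<integral>\<^sup>+x. ennreal (B v * (f (x + v) - f x)\<^sup>2) \<partial>lborel)
      \<le> ennreal ((2 * h)\<^sup>2 * S) * indicator (cball 0 (2 * h)) v"
    proof (cases "v \<in> cball 0 (2 * h)")
      case True
      then have "(norm v)\<^sup>2 * S \<le> (2 * h)\<^sup>2 * S" using S0 by (intro mult_right_mono power_mono) auto
      then show ?thesis using True le by (simp add: B_def order_trans[OF _ ennreal_leI])
    next
      case False
      then have "B v = 0" by (simp add: B_def)
      then show ?thesis by simp
    qed
  qed
  also have "\<dots> = ennreal ((2 * h)\<^sup>2 * S) * emeasure lborel (cball 0 (2 * h) :: complex set)"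
    by (subst nn_integral_cmult) (auto intro!: borel_measurable_indicator)
  also have "\<dots> \<le> ennreal ((2 * h)\<^sup>2 * S) * ennreal ((4 * h) * (4 * h))"
  proof (rule mult_left_mono)
    have "cball 0 (2 * h) \<subseteq> cbox (Complex (-2 * h) (-2 * h)) (Complex (2 * h) (2 * h))"
    proof
      fix z :: complex assume "z \<in> cball 0 (2 * h)"
      then have "\<bar>Re z\<bar> \<le> 2 * h" "\<bar>Im z\<bar> \<le> 2 * h"
        using abs_Re_le_cmod[of z] abs_Im_le_cmod[of z] by auto
      then show "z \<in> cbox (Complex (-2 * h) (-2 * h)) (Complex (2 * h) (2 * h))"
        by (auto simp: cbox_def Basis_complex_def abs_le_iff)
    qed
    then have "emeasure lborel (cball 0 (2 * h) :: complex set) \<le> emeasure lborel (cbox (Complex (-2 * h) (-2 * h)) (Complex (2 * h) (2 * h)))"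
      by (intro emeasure_mono) auto
    also have "\<dots> = ennreal ((4 * h) * (4 * h))"
      using h by (subst emeasure_lborel_cbox_eq) (auto simp: Basis_complex_def)
    finally show "emeasure lborel (cball 0 (2 * h) :: complex set) \<le> ennreal ((4 * h) * (4 * h))" .
  qed simp
  also have "\<dots> = ennreal (64 * h^4 * S)"
    using S0 h by (subst ennreal_mult[symmetric]) (auto simp: power2_eq_square power4_eq_xxxx algebra_simps)
  finally have "(\<Sum>k\<in>K. 2 * h\<^sup>2 * s k - 2 * (m k)\<^sup>2) \<le> 64 * h^4 * S"
    using S0 by (subst (asm) ennreal_le_iff) auto
  then have 1: "2 * h\<^sup>2 * (\<Sum>k\<in>K. s k) - 2 * (\<Sum>k\<in>K. (m k)\<^sup>2) \<le> 64 * h^4 * S"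
    by (simp add: sum_subtractf sum_distrib_left)
  have "(\<Sum>k\<in>K. s k) = (LINT x|lborel. (\<Sum>k\<in>K. ?q k x * (f x)\<^sup>2))"
    unfolding s_def using integrable_real_mult_indicator[of "grid_cell h _" lborel "\<lambda>x. (f x)\<^sup>2"] If
    by (subst Bochner_Integration.integral_sum) (auto simp: mult.commute)
  also have "\<dots> = (LINT x|lborel. (f x)\<^sup>2)"
  proof (rule Bochner_Integration.integral_cong)
    fix x
    show "(\<Sum>k\<in>K. ?q k x * (f x)\<^sup>2) = (f x)\<^sup>2"
    proof (cases "x \<in> \<Omega>")
      case True
      then obtain k where k: "k \<in> K" "x \<in> grid_cell h k" using K by auto
      have "(\<Sum>k\<in>K. ?q k x * (f x)\<^sup>2) = (\<Sum>k'\<in>K. if k' = k then (f x)\<^sup>2 else 0)"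
    proof (rule sum.cong)
      fix k' assume "k' \<in> K"
      show "?q k' x * (f x)\<^sup>2 = (if k' = k then (f x)\<^sup>2 else 0)"
      proof (cases "k' = k")
        case False
        then have "x \<notin> grid_cell h k'" using disj[OF k(2), of k'] by blast
        then show ?thesis using False by simp
      qed (use k in simp)
    qed simp
      then show ?thesis using k K by simp
    qed (simp add: T(4))
  qed simp
  finally have 2: "(\<Sum>k\<in>K. s k) = (LINT x|lborel. (f x)\<^sup>2)" .
  have "h\<^sup>2 * (LINT x|lborel. (f x)\<^sup>2) \<le> (\<Sum>k\<in>K. (m k)\<^sup>2) + 32 * h^4 * S" using 1 2 by simp
  also have "\<dots> = h\<^sup>2 * ((\<Sum>k\<in>K. (m k)\<^sup>2) / h\<^sup>2 + 32 * h\<^sup>2 * S)"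
    using h by (simp add: field_simps power2_eq_square power4_eq_xxxx)
  finally show ?thesis using h by (simp add: m_def S_def)
qed

lemma integrable_test_function:
  assumes t: "test_function \<Omega> f D" and b: "bounded \<Omega>"
  shows "integrable lborel f" "integrable lborel (\<lambda>x. (f x)\<^sup>2)" "integrable lborel (\<lambda>x. (norm (D x))\<^sup>2)"
  using test_functionD[OF t] b by (auto intro!: integrable_continuous_bounded_support[of _ \<Omega>] continuous_intros)

lemma bounded_finite_grid:
  assumes b: "bounded (\<Omega> :: complex set)" and h: "0 < h"
  shows "\<exists>K. finite K \<and> \<Omega> \<subseteq> (\<Union>k\<in>K. grid_cell h k)"
proof -
  obtain R where R: "\<And>x. x \<in> \<Omega> \<Longrightarrow> norm x \<le> R" using b by (auto simp: bounded_iff)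
  define m where "m = \<lceil>R / h\<rceil> + 1"
  have fl: "\<lfloor>t / h\<rfloor> \<in> {-m..m}" if "\<bar>t\<bar> \<le> R" for t
  proof -
    have "\<bar>t / h\<bar> \<le> R / h" using that h by (simp add: divide_right_mono)
    then have "t / h \<le> R / h" "- (R / h) \<le> t / h" by linarith+
    then show ?thesis unfolding m_def atLeastAtMost_iff by linarith
  qed
  have "\<Omega> \<subseteq> (\<Union>k\<in>{-m..m} \<times> {-m..m}. grid_cell h k)"
  proof
    fix x assume "x \<in> \<Omega>"
    then have "\<bar>Re x\<bar> \<le> R" "\<bar>Im x\<bar> \<le> R"
      using R[of x] abs_Re_le_cmod[of x] abs_Im_le_cmod[of x] by auto
    then have "(\<lfloor>Re x / h\<rfloor>, \<lfloor>Im x / h\<rfloor>) \<in> {-m..m} \<times> {-m..m}" using fl by simp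
    moreover have "x \<in> grid_cell h (\<lfloor>Re x / h\<rfloor>, \<lfloor>Im x / h\<rfloor>)" by (simp add: grid_cell_def)
    ultimately show "x \<in> (\<Union>k\<in>{-m..m} \<times> {-m..m}. grid_cell h k)" by (rule UN_I)
  qed
  moreover have "finite ({-m..m} \<times> {-m..m})" by simp
  ultimately show ?thesis by (intro exI conjI)
qed

text \<open>The averages over all cells at all scales \<open>1 / (N + 1)\<close> are countably many
  bounded sequences, so one diagonal subsequence makes all of them converge. For differences of its
  members, \<open>grid_estimate\<close> leaves a gradient term that is small on a fine grid,
  uniformly in the indices, and finitely many averages, which are Cauchy.\<close>

lemma rellich_test_functions:
  fixes \<phi> :: "nat \<Rightarrow> complex \<Rightarrow> real"
  assumes t: "\<And>n. test_function \<Omega> (\<phi> n) (D n)" and b: "bounded \<Omega>"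
    and B: "\<And>n. (LINT x|lborel. (\<phi> n x)\<^sup>2) \<le> B" "\<And>n. (LINT x|lborel. (norm (D n x))\<^sup>2) \<le> B"
  shows "\<exists>r. strict_mono (r :: nat \<Rightarrow> nat) \<and>
    (\<forall>e>0. \<exists>N. \<forall>m\<ge>N. \<forall>n\<ge>N. (LINT x|lborel. (\<phi> (r m) x - \<phi> (r n) x)\<^sup>2) < e)"
proof -
  define h where "h N = 1 / real (Suc N)" for N
  have h: "0 < h N" "h N \<le> 1" for N by (auto simp: h_def)
  define l where "l n Nk = (LINT x|lborel. indicator (grid_cell (h (fst Nk)) (snd Nk)) x * \<phi> n x)" for n and Nk :: "nat \<times> (int \<times> int)"
  note I = integrable_test_function[OF t b]
  have int: "integrable lborel (\<lambda>x. indicator (grid_cell (h N) k) x * \<phi> n x)" for N k n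
    using integrable_real_mult_indicator[of "grid_cell (h N) k" lborel "\<phi> n"] I(1)[of n] by (simp add: mult.commute)
  \<comment> \<open>Since \<open>h N <= 1\<close> a cell has area at most 1, and on it the absolute
    value of the function is at most 1 plus its square.\<close>
  have lb: "norm (l n Nk) \<le> 1 + B" for n Nk
  proof -
    obtain N k where Nk: "Nk = (N, k)" by (cases Nk)
    let ?Q = "grid_cell (h N) k"
    have iQ: "integrable lborel (indicator ?Q :: complex \<Rightarrow> real)" "measure lborel ?Q \<le> 1"
      using grid_cell_emeasure[OF h(1), of N k] h[of N]
      by (auto intro!: integrable_real_indicator simp: measure_def power_le_one)
    have "norm (l n Nk) \<le> (LINT x|lborel. norm (indicator ?Q x * \<phi> n x))"
      unfolding l_def Nk fst_conv snd_conv by (rule integral_norm_bound)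
    also have "\<dots> \<le> (LINT x|lborel. indicator ?Q x + (\<phi> n x)\<^sup>2)"
    proof (rule integral_mono)
      show "norm (indicator ?Q x * \<phi> n x) \<le> indicator ?Q x + (\<phi> n x)\<^sup>2" for x
        using sum_squares_bound[of 1 "\<bar>\<phi> n x\<bar>"] by (auto simp: indicator_def)
    qed (use int[of N k n] iQ I(2)[of n] in auto)
    also have "\<dots> \<le> 1 + B" using iQ I(2)[of n] B(1)[of n] by simp
    finally show ?thesis .
  qed
  obtain r where r: "strict_mono r" "\<And>Nk. \<exists>L. (\<lambda>n. l (r n) Nk) \<longlonglongrightarrow> L"
    using function_convergent_subsequence[of "UNIV :: (nat \<times> (int \<times> int)) set" l "1 + B"] lb by auto
  have S: "(LINT x|lborel. (norm (1 *\<^sub>R D m x + (-1) *\<^sub>R D n x))\<^sup>2) \<le> 4 * B" for m n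
  proof -
    have sD: "square_integrable lborel (D k)" for k
      using I(3)[of k] test_function_borel_measurable(2)[OF t] by (simp add: square_integrable_def)
    have LB: "L2norm lborel (D k) \<le> sqrt B" for k
      unfolding L2norm_def using B(2) by (rule real_sqrt_le_mono)
    have "L2norm lborel (\<lambda>x. D m x + (-1) *\<^sub>R D n x) \<le> L2norm lborel (D m) + L2norm lborel (\<lambda>x. (-1) *\<^sub>R D n x)"
      by (intro L2norm_triangle square_integrable_scaleR sD)
    also have "\<dots> \<le> 2 * sqrt B" using LB[of m] LB[of n] unfolding L2norm_scaleR by simp
    finally have "(L2norm lborel (\<lambda>x. D m x + (-1) *\<^sub>R D n x))\<^sup>2 \<le> (2 * sqrt B)\<^sup>2"
      by (intro power_mono) auto
    moreover have "0 \<le> B" using B(2)[of 0] by (rule order_trans[rotated]) simp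
    ultimately show ?thesis by (simp add: L2norm_power2 power_mult_distrib)
  qed
  have "0 \<le> (LINT x|lborel. (\<phi> 0 x)\<^sup>2)" by simp
  then have B0: "0 \<le> B" using B(1)[of 0] by linarith
  have "\<exists>N. \<forall>m\<ge>N. \<forall>n\<ge>N. (LINT x|lborel. (\<phi> (r m) x - \<phi> (r n) x)\<^sup>2) < e" if e: "0 < e" for e
  proof -
    \<comment> \<open>The scale is chosen so that \<open>32 * H^2 * (4 * B)\<close> falls below
      \<open>e / 2\<close>: replace \<open>H^2\<close> by \<open>H\<close>, and note that 128 is
      half of 256. Adding 1 to \<open>B\<close> avoids dividing by zero.\<close>
    obtain M where M: "inverse (real (Suc M)) < e / (256 * (B + 1))"
      using reals_Archimedean[of "e / (256 * (B + 1))"] e B0 by auto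
    define H where "H = h M"
    have H: "0 < H" "H \<le> 1" "H * (256 * (B + 1)) < e" using h[of M] M B0
      by (auto simp: H_def h_def inverse_eq_divide pos_less_divide_eq)
    have HB: "32 * H\<^sup>2 * (4 * B) < e / 2"
    proof -
      have "H\<^sup>2 \<le> H" using H by (simp add: power2_eq_square mult_left_le)
      then have "H\<^sup>2 * (128 * B) \<le> H * (128 * (B + 1))" using B0 H by (intro mult_mono) auto
      then show ?thesis using H(3) by (simp add: algebra_simps)
    qed
    obtain K where K: "finite K" "\<Omega> \<subseteq> (\<Union>k\<in>K. grid_cell H k)" using bounded_finite_grid[OF b H(1)] by auto
    \<comment> \<open>Chosen so that \<open>card K\<close> terms below it, divided by
      \<open>H^2\<close>, sum to at most \<open>e / 2\<close>; the 1 added to the cardinality covers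
      an empty \<open>K\<close>.\<close>
    define \<delta> where "\<delta> = e * H\<^sup>2 / (2 * (real (card K) + 1))"
    have \<delta>: "0 < \<delta>" using e H by (simp add: \<delta>_def)
    have "\<forall>k. \<exists>N. \<forall>m\<ge>N. \<forall>n\<ge>N. (l (r m) (M, k) - l (r n) (M, k))\<^sup>2 < \<delta>"
    proof
      fix k
      obtain L where "(\<lambda>n. l (r n) (M, k)) \<longlonglongrightarrow> L" using r(2) by blast
      then have "Cauchy (\<lambda>n. l (r n) (M, k))" by (rule LIMSEQ_imp_Cauchy)
      then obtain N where N: "\<And>m n. m \<ge> N \<Longrightarrow> n \<ge> N \<Longrightarrow> norm (l (r m) (M, k) - l (r n) (M, k)) < sqrt \<delta>"
        using \<delta> CauchyD[of "\<lambda>n. l (r n) (M, k)" "sqrt \<delta>"] by auto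
      have "(l (r m) (M, k) - l (r n) (M, k))\<^sup>2 < \<delta>" if "m \<ge> N" "n \<ge> N" for m n
        using power_strict_mono[OF N[OF that], of 2] \<delta> by simp
      then show "\<exists>N. \<forall>m\<ge>N. \<forall>n\<ge>N. (l (r m) (M, k) - l (r n) (M, k))\<^sup>2 < \<delta>" by blast
    qed
    then obtain Nf where Nf: "\<And>k m n. m \<ge> Nf k \<Longrightarrow> n \<ge> Nf k \<Longrightarrow> (l (r m) (M, k) - l (r n) (M, k))\<^sup>2 < \<delta>"
      by metis
    have "(LINT x|lborel. (\<phi> (r m) x - \<phi> (r n) x)\<^sup>2) < e" if mn: "m \<ge> (\<Sum>k\<in>K. Nf k)" "n \<ge> (\<Sum>k\<in>K. Nf k)" for m n
    proof -
      have ge: "m \<ge> Nf k" "n \<ge> Nf k" if "k \<in> K" for k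
        using member_le_sum[of k K Nf] that mn K(1) by auto
      let ?s = "\<Sum>k\<in>K. (LINT x|lborel. indicator (grid_cell H k) x * (1 * \<phi> (r m) x + (-1) * \<phi> (r n) x))\<^sup>2"
      have E1: "(LINT x|lborel. (1 * \<phi> (r m) x + (-1) * \<phi> (r n) x)\<^sup>2) \<le>
        ?s / H\<^sup>2 + 32 * H\<^sup>2 * (LINT x|lborel. (norm (1 *\<^sub>R D (r m) x + (-1) *\<^sub>R D (r n) x))\<^sup>2)"
        by (rule grid_estimate[OF test_function_lincomb[OF t t] b H(1) K])
      have "(LINT x|lborel. indicator (grid_cell H k) x * (1 * \<phi> (r m) x + (-1) * \<phi> (r n) x))
        = l (r m) (M, k) - l (r n) (M, k)" for k
        using int[of M k "r m"] int[of M k "r n"]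
        by (simp add: l_def H_def right_diff_distrib)
      then have "?s = (\<Sum>k\<in>K. (l (r m) (M, k) - l (r n) (M, k))\<^sup>2)" by simp
      also have "\<dots> \<le> (\<Sum>k\<in>K. \<delta>)" using Nf ge by (intro sum_mono less_imp_le) auto
      finally have E2: "?s / H\<^sup>2 \<le> (\<Sum>k\<in>K. \<delta>) / H\<^sup>2" by (rule divide_right_mono) simp
      have "(\<Sum>k\<in>K. \<delta>) / H\<^sup>2 = e / 2 * (real (card K) / (real (card K) + 1))"
        using H by (simp add: \<delta>_def divide_simps)
      also have "\<dots> \<le> e / 2 * 1" using e by (intro mult_left_mono) auto
      finally have E3: "(\<Sum>k\<in>K. \<delta>) / H\<^sup>2 \<le> e / 2" by simp
      have E4: "32 * H\<^sup>2 * (LINT x|lborel. (norm (1 *\<^sub>R D (r m) x + (-1) *\<^sub>R D (r n) x))\<^sup>2) \<le> 32 * H\<^sup>2 * (4 * B)"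
        by (intro mult_left_mono S) auto
      have "X < e" if "X \<le> a + b'" "a \<le> a'" "a' \<le> e / 2" "b' \<le> b''" "b'' < e / 2" for X a b' a' b'' :: real
        using that by linarith
      from this[OF E1 E2 E3 E4 HB] show ?thesis by simp
    qed
    then show ?thesis by (intro exI[of _ "\<Sum>k\<in>K. Nf k"]) simp
  qed
  then show ?thesis using r(1) by (intro exI[of _ r]) simp
qed

section \<open>The Poincare inequality on a strip\<close>

lemma lborel_integral_shift:
  fixes f :: "'a::euclidean_space \<Rightarrow> real"
  assumes [measurable]: "f \<in> borel_measurable borel"
  shows "(LINT x|lborel. f (x + c)) = (LINT x|lborel. f x)"
proof -
  have "(LINT x|lborel. f x) = (LINT x|distr lborel borel ((+) c). f x)" by (simp add: lborel_distr_plus)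
  also have "\<dots> = (LINT x|lborel. f (x + c))" by (subst integral_distr) (auto simp: add.commute)
  finally show ?thesis by simp
qed

text \<open>The difference quotients all have integral zero by translation invariance.\<close>

lemma integral_directional_derivative_zero:
  fixes F F' :: "'a::euclidean_space \<Rightarrow> real"
  assumes der: "\<And>x. ((\<lambda>t. F (x + t *\<^sub>R v)) has_real_derivative F' x) (at 0)"
    and cont: "continuous_on UNIV F" "continuous_on UNIV F'" and b: "bounded \<Omega>"
    and supp: "\<And>x. x \<notin> \<Omega> \<Longrightarrow> F x = 0" "\<And>x. x \<notin> \<Omega> \<Longrightarrow> F' x = 0"
  shows "(LINT x|lborel. F' x) = 0"
proof -
  have [measurable]: "F \<in> borel_measurable borel" "F' \<in> borel_measurable borel"
    using cont by (auto intro: borel_measurable_continuous_onI)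
  have IF: "integrable lborel F" by (rule integrable_continuous_bounded_support[OF cont(1) b supp(1)])
  have der': "((\<lambda>t. F (x + t *\<^sub>R v)) has_real_derivative F' (x + s *\<^sub>R v)) (at s)" for x s
    using DERIV_shift[of "\<lambda>t. F (x + t *\<^sub>R v)" "F' (x + s *\<^sub>R v)" 0 s] der[of "x + s *\<^sub>R v"]
    by (simp add: scaleR_add_left add.assoc add.commute add.left_commute)
  obtain R where R: "\<And>x. x \<in> \<Omega> \<Longrightarrow> norm x \<le> R" using b by (auto simp: bounded_iff)
  have "compact (F' ` closure \<Omega>)"
    using b cont(2) by (intro compact_continuous_image) (auto simp: compact_closure intro: continuous_on_subset)
  then obtain C0 where C0: "\<And>x. x \<in> closure \<Omega> \<Longrightarrow> \<bar>F' x\<bar> \<le> C0"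
    using compact_imp_bounded by (fastforce simp: bounded_iff)
  define C where "C = max C0 0"
  have C: "\<bar>F' x\<bar> \<le> C" for x
    using C0[of x] supp(2)[of x] closure_subset[of \<Omega>] by (cases "x \<in> \<Omega>") (auto simp: C_def subset_iff)
  define s where "s n x = (F (x + inverse (real (Suc n)) *\<^sub>R v) - F x) / inverse (real (Suc n))" for n x
  \<comment> \<open>A common majorant: steps are at most 1, so every difference quotient vanishes
    outside the ball of radius \<open>R + norm v\<close>, and inside it the mean value theorem
    bounds it by the maximum of \<open>F'\<close>.\<close>
  let ?w = "\<lambda>x. C * indicator (cball (0::'a) (R + norm v)) x"
  have "(\<lambda>n. LINT x|lborel. s n x) \<longlonglongrightarrow> (LINT x|lborel. F' x)"
  proof (rule integral_dominated_convergence[of _ _ _ ?w])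
    have "integrable lborel (indicator (cball (0::'a) (R + norm v)) :: 'a \<Rightarrow> real)"
      by (intro integrable_real_indicator emeasure_bounded_finite) auto
    then show "integrable lborel ?w" by simp
    show "AE x in lborel. (\<lambda>n. s n x) \<longlonglongrightarrow> F' x"
    proof (rule always_eventually, rule allI)
      fix x
      have lim: "((\<lambda>h. (F (x + h *\<^sub>R v) - F x) / h) \<longlongrightarrow> F' x) (at 0)"
        using der[of x] by (simp add: DERIV_def)
      have "filterlim (\<lambda>n. inverse (real (Suc n))) (at 0) sequentially"
        unfolding filterlim_at using LIMSEQ_inverse_real_of_nat by (auto simp del: of_nat_Suc)
      from filterlim_compose[OF lim this] show "(\<lambda>n. s n x) \<longlonglongrightarrow> F' x" by (simp add: s_def)
    qed
    show "AE x in lborel. norm (s n x) \<le> ?w x" for n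
    proof (rule always_eventually, rule allI)
      fix x
      define h where "h = inverse (real (Suc n))"
      have h: "0 < h" "h \<le> 1" by (auto simp: h_def inverse_le_1_iff)
      show "norm (s n x) \<le> ?w x"
      proof (cases "norm x \<le> R + norm v")
        case True
        obtain z where z: "0 < z" "z < h" "F (x + h *\<^sub>R v) - F (x + 0 *\<^sub>R v) = (h - 0) * F' (x + z *\<^sub>R v)"
          using MVT2[OF h(1), of "\<lambda>t. F (x + t *\<^sub>R v)" "\<lambda>t. F' (x + t *\<^sub>R v)"] der' by blast
        then have "s n x = F' (x + z *\<^sub>R v)" using h by (simp add: s_def h_def)
        then show ?thesis using True C by simp
      next
        case False
        have "x \<notin> \<Omega>" using R[of x] False norm_ge_zero[of v] by linarith
        moreover have "x + h *\<^sub>R v \<notin> \<Omega>"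
        proof
          assume "x + h *\<^sub>R v \<in> \<Omega>"
          then have "norm (x + h *\<^sub>R v) \<le> R" by (rule R)
          moreover have "norm x \<le> norm (x + h *\<^sub>R v) + norm (h *\<^sub>R v)"
            using norm_triangle_ineq4[of "x + h *\<^sub>R v" "h *\<^sub>R v"] by simp
          moreover have "norm (h *\<^sub>R v) \<le> norm v" using h by (simp add: mult_left_le_one_le)
          ultimately show False using False by linarith
        qed
        ultimately show ?thesis using False supp(1) by (simp add: s_def h_def)
      qed
    qed
    show "s n \<in> borel_measurable lborel" for n unfolding s_def[abs_def] by measurable
  qed measurable
  moreover have "(LINT x|lborel. s n x) = 0" for n
  proof -
    let ?c = "inverse (real (Suc n)) *\<^sub>R v"
    have "integrable lborel (\<lambda>x. F (x + ?c))"
    proof -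
      have "integrable (distr lborel borel ((+) ?c)) F" using IF by (simp add: lborel_distr_plus)
      then show ?thesis by (subst (asm) integrable_distr_eq) (auto simp: add.commute)
    qed
    then show ?thesis unfolding s_def using IF lborel_integral_shift[of F ?c] by simp
  qed
  ultimately have "(\<lambda>n. 0 :: real) \<longlonglongrightarrow> (LINT x|lborel. F' x)" by simp
  then show ?thesis using LIMSEQ_unique[of "\<lambda>n. 0 :: real"] by force
qed

text \<open>Picone's identity for the positive function $\cos(kp)$, $k = 3/2 < \pi/2$, which solves
  $-\Delta w = k^2 |q|^2 w$.\<close>

lemma poincare_strip:
  assumes t: "test_function \<Omega> \<phi> D" and b: "bounded \<Omega>" and strip: "\<And>z. z \<in> \<Omega> \<Longrightarrow> \<bar>q \<bullet> z + c\<bar> \<le> 1"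
  shows "9 / 4 * (norm q)\<^sup>2 * (LINT x|lborel. (\<phi> x)\<^sup>2) \<le> (LINT x|lborel. (norm (D x))\<^sup>2)"
proof -
  note T = test_functionD[OF t]
  define k :: real where "k = 3 / 2"
  define p where "p z = k * (q \<bullet> z + c)" for z
  define C where "C = closure {x. \<phi> x \<noteq> 0}"
  define U where "U = {z. \<bar>p z\<bar> < pi / 2}"
  have pc: "continuous_on UNIV p" unfolding p_def by (intro continuous_intros)
  have "open U" unfolding U_def using pc by (intro open_Collect_less continuous_intros) auto
  have CO: "C \<subseteq> \<Omega>" using t by (simp add: test_function_def C_def)
  have OU: "\<Omega> \<subseteq> U"
  proof
    fix z assume "z \<in> \<Omega>"
    then have "\<bar>p z\<bar> \<le> k" using strip[of z] by (simp add: p_def abs_mult k_def)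
    also have "k < pi / 2" using pi_gt3 by (simp add: k_def)
    finally show "z \<in> U" by (simp add: U_def)
  qed
  have zero: "\<phi> x = 0" if "x \<notin> C" for x
    using subsetD[OF closure_subset, of x "{x. \<phi> x \<noteq> 0}"] that by (auto simp: C_def)
  have zeroD: "D x = 0" if "x \<notin> \<Omega>" for x using T(5) that .
  have cosU: "cos (p z) \<noteq> 0" if "z \<in> U" for z
  proof -
    have "- (pi / 2) < p z" "p z < pi / 2" using that unfolding U_def mem_Collect_eq by linarith+
    then show ?thesis using cos_gt_zero_pi[of "p z"] by simp
  qed
  \<comment> \<open>\<open>k * tan (p z)\<close> is the negative logarithmic derivative of
    \<open>cos (p z)\<close> divided by \<open>norm q\<close> squared, taken along \<open>q\<close>.
    Hence \<open>F'\<close>, the derivative of \<open>F\<close> along \<open>q\<close>, is the exact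
    term in Picone's identity, and its integral vanishes.\<close>
  define F where "F z = tan (p z) * (\<phi> z)\<^sup>2" for z
  define F' where "F' z = k * (norm q)\<^sup>2 * (1 + (tan (p z))\<^sup>2) * (\<phi> z)\<^sup>2 + 2 * tan (p z) * \<phi> z * (D z \<bullet> q)" for z
  have "open (- C)" by (simp add: C_def open_Compl)
  \<comment> \<open>\<open>tan\<close> has poles outside \<open>U\<close>, but there
    \<open>\<phi>\<close> vanishes in a neighborhood. Two open sets cover the plane, with a smooth
    formula on one and zero on the other, so continuity and derivatives can be checked on
    each.\<close>
  have cover: "x \<in> U \<or> x \<in> - C" for x using CO OU by auto
  have Fz: "F x = 0" "F' x = 0" if "x \<in> - C" for x using zero that by (auto simp: F_def F'_def)
  have cU: "continuous_on U F" "continuous_on U F'"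
  proof -
    have "continuous_on U p" "continuous_on U \<phi>" "continuous_on U D"
      using pc T(2,3) by (auto intro: continuous_on_subset)
    moreover have "continuous_on U (\<lambda>z. tan (p z))"
    proof (rule continuous_on_compose2[of "p ` U" tan U p])
      show "continuous_on (p ` U) tan"
        using cosU by (auto intro!: continuous_at_imp_continuous_on isCont_tan)
    qed (use pc in \<open>auto intro: continuous_on_subset\<close>)
    ultimately show "continuous_on U F" "continuous_on U F'"
      unfolding F_def[abs_def] F'_def[abs_def] by (auto intro!: continuous_intros)
  qed
  have cont: "continuous_on UNIV F" "continuous_on UNIV F'"
  proof -
    have UC: "UNIV = U \<union> - C" using cover by auto
    have "continuous_on (- C) F" "continuous_on (- C) F'"
      using Fz by (auto intro: continuous_on_cong[THEN iffD2, OF refl _ continuous_on_const[of _ 0]])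
    then show "continuous_on UNIV F" "continuous_on UNIV F'"
      unfolding UC using cU \<open>open U\<close> \<open>open (- C)\<close> by (auto intro: continuous_on_open_Un)
  qed
  have der: "((\<lambda>t. F (x + t *\<^sub>R q)) has_real_derivative F' x) (at 0)" for x
  proof (cases "x \<in> U")
    case True
    have d1: "((\<lambda>t. \<phi> (x + t *\<^sub>R q)) has_real_derivative D x \<bullet> q) (at 0)"
      using GDERIV_line[OF T(1), of x q 0] by simp
    have d2: "((\<lambda>t. p (x + t *\<^sub>R q)) has_real_derivative k * (norm q)\<^sup>2) (at 0)"
      unfolding p_def inner_add_right inner_scaleR_right power2_norm_eq_inner
      by (auto intro!: derivative_eq_intros)
    have "((\<lambda>t. F (x + t *\<^sub>R q)) has_real_derivative
        (inverse ((cos (p (x + 0 *\<^sub>R q)))\<^sup>2) * (k * (norm q)\<^sup>2)) * (\<phi> (x + 0 *\<^sub>R q))\<^sup>2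
        + (2 * \<phi> (x + 0 *\<^sub>R q) * (D x \<bullet> q)) * tan (p (x + 0 *\<^sub>R q))) (at 0)"
      unfolding F_def using cosU[OF True] d1 d2
      by (auto intro!: derivative_eq_intros DERIV_chain2[where f=tan])
    moreover have "inverse ((cos (p x))\<^sup>2) = 1 + (tan (p x))\<^sup>2"
      using tan_sec[OF cosU[OF True]] by (simp add: power_inverse)
    ultimately show ?thesis by (simp add: F'_def algebra_simps)
  next
    case False
    then have x: "x \<in> - C" using cover by auto
    have "((\<lambda>_. 0) has_real_derivative 0) (at (0::real))" by simp
    moreover have "open ((\<lambda>t. x + t *\<^sub>R q) -` (- C))"
      by (intro open_vimage \<open>open (- C)\<close> continuous_intros)
    ultimately have "((\<lambda>t. F (x + t *\<^sub>R q)) has_real_derivative 0) (at 0)"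
      by (rule DERIV_cong[OF has_field_derivative_transform_within_open, OF _ _ _ _ refl]) (use x Fz in auto)
    then show ?thesis using Fz[OF x] by simp
  qed
  have int0: "(LINT x|lborel. F' x) = 0"
    by (rule integral_directional_derivative_zero[OF der cont b]) (use CO Fz in auto)
  have IF: "integrable lborel F'"
    by (rule integrable_continuous_bounded_support[OF cont(2) b]) (use CO Fz in auto)
  note I = integrable_test_function[OF t b]
  \<comment> \<open>The integrand is the square of the norm of
    \<open>D x + (k * tan (p x) * \<phi> x) *\<^sub>R q\<close>; integrating removes
    \<open>F'\<close> and leaves the claimed inequality.\<close>
  have "0 \<le> (LINT x|lborel. (norm (D x))\<^sup>2 + k * F' x - k\<^sup>2 * (norm q)\<^sup>2 * (\<phi> x)\<^sup>2)"
  proof (rule Bochner_Integration.integral_nonneg)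
    fix x
    have "(norm (D x))\<^sup>2 + k * F' x - k\<^sup>2 * (norm q)\<^sup>2 * (\<phi> x)\<^sup>2 = (norm (D x + (k * tan (p x) * \<phi> x) *\<^sub>R q))\<^sup>2"
      unfolding norm_add_power2 by (simp add: F'_def power_mult_distrib algebra_simps power2_eq_square)
    then show "0 \<le> (norm (D x))\<^sup>2 + k * F' x - k\<^sup>2 * (norm q)\<^sup>2 * (\<phi> x)\<^sup>2" by simp
  qed
  also have "\<dots> = (LINT x|lborel. (norm (D x))\<^sup>2) - k\<^sup>2 * (norm q)\<^sup>2 * (LINT x|lborel. (\<phi> x)\<^sup>2)"
    using I IF int0 by simp
  finally show ?thesis by (simp add: k_def power2_eq_square)
qed

section \<open>The Rayleigh quotient\<close>

definition L2_inner :: "'a measure \<Rightarrow> ('a \<Rightarrow> 'b::euclidean_space) \<Rightarrow> ('a \<Rightarrow> 'b) \<Rightarrow> real" where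
  "L2_inner M f g = (LINT x|M. f x \<bullet> g x)"

lemma L2_inner_add_left:
  assumes "square_integrable M f" "square_integrable M g" "square_integrable M h"
  shows "L2_inner M (\<lambda>x. f x + g x) h = L2_inner M f h + L2_inner M g h"
  using integrable_inner_square_integrable[OF assms(1,3)] integrable_inner_square_integrable[OF assms(2,3)]
  by (simp add: L2_inner_def inner_add_left)

lemma L2_inner_scaleR_left: "L2_inner M (\<lambda>x. c *\<^sub>R f x) h = c * L2_inner M f h"
  by (simp add: L2_inner_def)

lemma L2_inner_self: "L2_inner M f f = (LINT x|M. (norm (f x))\<^sup>2)"
  by (simp add: L2_inner_def power2_norm_eq_inner)

lemma L2_inner_self_nonneg: "0 \<le> L2_inner M f f"
  by (simp add: L2_inner_self)

lemma L2_inner_lincomb_self: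
  assumes f: "square_integrable M f" and g: "square_integrable M g"
  shows "L2_inner M (\<lambda>x. f x + t *\<^sub>R g x) (\<lambda>x. f x + t *\<^sub>R g x)
    = L2_inner M f f + 2 * t * L2_inner M f g + t\<^sup>2 * L2_inner M g g"
  using integral_norm_add_power2[OF f square_integrable_scaleR[OF g, of t]]
  by (simp add: L2_inner_self power_mult_distrib) (simp add: L2_inner_def)

lemma L2_tendsto_L2_inner:
  "L2_tendsto M f f' \<Longrightarrow> L2_tendsto M g g' \<Longrightarrow> (\<lambda>n. L2_inner M (f n) (g n)) \<longlonglongrightarrow> L2_inner M f' g'"
  unfolding L2_inner_def by (rule L2_tendsto_inner)

text \<open>The first-order condition at a minimum in algebraic form; it yields the Euler-Lagrange
  equation without differentiating the Rayleigh quotient.\<close>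

lemma linear_coefficient_zero:
  fixes a b :: real assumes "\<And>t. 0 \<le> 2 * t * a + t\<^sup>2 * b" shows "a = 0"
proof (rule ccontr)
  assume a: "a \<noteq> 0"
  define t where "t = - a / (\<bar>b\<bar> + 1)"
  define c where "c = \<bar>b\<bar> + 1"
  have c: "0 < c" "b \<le> c" by (auto simp: c_def)
  have "2 * t * a + t\<^sup>2 * b \<le> 2 * t * a + t\<^sup>2 * c" using c by (intro add_left_mono mult_left_mono) auto
  also have "\<dots> = - (a\<^sup>2 / c)" using c by (simp add: t_def c_def[symmetric] divide_simps power2_eq_square)
  also have "\<dots> < 0" using a c by simp
  finally show False using assms[of t] by simp
qed

text \<open>The bridge between estimates for test functions on the whole plane and the integrals
  over the domain that occur in \<open>H10\<close>.\<close>

lemma lebesgue_on_eq_lborel: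
  fixes f :: "'a::euclidean_space \<Rightarrow> 'b::{banach, second_countable_topology}"
  assumes S: "S \<in> sets lebesgue" and f: "f \<in> borel_measurable borel" and z: "\<And>x. x \<notin> S \<Longrightarrow> f x = 0"
  shows "(LINT x|lebesgue_on S. f x) = (LINT x|lborel. f x)"
    and "integrable (lebesgue_on S) f \<longleftrightarrow> integrable lborel f"
proof -
  have e: "(\<lambda>x. indicator S x *\<^sub>R f x) = f" using z by (auto simp: indicator_def fun_eq_iff)
  show "(LINT x|lebesgue_on S. f x) = (LINT x|lborel. f x)"
    using S f by (subst integral_restrict_space) (auto simp: e integral_completion)
  show "integrable (lebesgue_on S) f \<longleftrightarrow> integrable lborel f"
    using S f by (subst integrable_restrict_space) (auto simp: e integrable_completion)
qed

lemma positive_part_square_DERIV: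
  "((\<lambda>t. (max 0 t)\<^sup>2) has_real_derivative 2 * max 0 t) (at (t::real))"
proof -
  consider "t < 0" | "t > 0" | "t = 0" by linarith
  then show ?thesis
  proof cases
    case 1
    have "((\<lambda>_. 0) has_real_derivative 0) (at t)" by simp
    then have "((\<lambda>t. (max 0 t)\<^sup>2) has_real_derivative 0) (at t)"
      by (rule has_field_derivative_transform_within_open[of _ _ _ "{..<0}"]) (use 1 in auto)
    then show ?thesis using 1 by simp
  next
    case 2
    have "((\<lambda>t. t\<^sup>2) has_real_derivative 2 * t) (at t)" by (auto intro!: derivative_eq_intros)
    then have "((\<lambda>t. (max 0 t)\<^sup>2) has_real_derivative 2 * t) (at t)"
      by (rule has_field_derivative_transform_within_open[of _ _ _ "{0<..}"]) (use 2 in auto)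
    then show ?thesis using 2 by simp
  next
    case 3
    have "((\<lambda>h. (max 0 h)\<^sup>2 / h) \<longlongrightarrow> 0) (at (0::real))"
    proof (rule Lim_null_comparison[of _ "\<lambda>h. \<bar>h\<bar>"])
      show "\<forall>\<^sub>F h in at (0::real). norm ((max 0 h)\<^sup>2 / h) \<le> \<bar>h\<bar>"
        by (rule always_eventually) (auto simp: max_def power2_eq_square)
      show "((\<lambda>h. \<bar>h\<bar>) \<longlongrightarrow> 0) (at (0::real))" by (auto intro!: tendsto_eq_intros)
    qed
    then show ?thesis using 3 by (simp add: DERIV_def)
  qed
qed

text \<open>The paraboloid \<open>f\<close> has a kink where its positive part starts; squaring
  makes it continuously differentiable. The bump shows that the Rayleigh quotient has an admissible
  function.\<close>

lemma bump_test_function: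
  assumes "open \<Omega>" "z0 \<in> \<Omega>"
  shows "\<exists>\<phi> D r. test_function \<Omega> \<phi> D \<and> 0 < r \<and> ball z0 r \<subseteq> \<Omega> \<and> (\<forall>z\<in>ball z0 r. 0 < \<phi> z)"
proof -
  obtain r where r: "0 < r" "cball z0 r \<subseteq> \<Omega>" using assms open_contains_cball by blast
  define f where "f z = r\<^sup>2 - (z - z0) \<bullet> (z - z0)" for z
  define \<phi> where "\<phi> z = (max 0 (f z))\<^sup>2" for z
  define D where "D z = (2 * max 0 (f z)) *\<^sub>R ((-2) *\<^sub>R (z - z0))" for z
  have fpos: "0 < f z \<longleftrightarrow> z \<in> ball z0 r" for z
  proof -
    have "0 < f z \<longleftrightarrow> (dist z0 z)\<^sup>2 < r\<^sup>2" 
      unfolding f_def dist_norm norm_minus_commute[of z0 z] power2_norm_eq_inner by simp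
    also have "\<dots> \<longleftrightarrow> dist z0 z < r" using r(1) by (meson less_imp_le power2_less_imp_less power_strict_mono zero_le_dist zero_less_numeral)
    finally show ?thesis by simp
  qed
  have G: "GDERIV f z :> (-2) *\<^sub>R (z - z0)" for z
    unfolding gderiv_def f_def by (auto intro!: derivative_eq_intros simp: inner_commute fun_eq_iff)
  have "GDERIV \<phi> z :> D z" for z
    unfolding \<phi>_def[abs_def] D_def by (rule GDERIV_DERIV_compose[OF G positive_part_square_DERIV])
  moreover have "continuous_on UNIV D" unfolding D_def[abs_def] f_def by (intro continuous_intros)
  moreover have cl: "closure {x. \<phi> x \<noteq> 0} \<subseteq> cball z0 r"
  proof (rule closure_minimal)
    show "{x. \<phi> x \<noteq> 0} \<subseteq> cball z0 r"
    proof
      fix x assume "x \<in> {x. \<phi> x \<noteq> 0}"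
      then have "0 < f x" by (auto simp: \<phi>_def max_def split: if_splits)
      then show "x \<in> cball z0 r" using fpos[of x] by simp
    qed
  qed simp
  moreover have "compact (closure {x. \<phi> x \<noteq> 0})"
    unfolding compact_closure by (rule bounded_subset[OF bounded_cball order_trans[OF closure_subset cl]])
  ultimately have "test_function \<Omega> \<phi> D" using r(2) by (auto simp: test_function_def)
  moreover have "\<forall>z\<in>ball z0 r. 0 < \<phi> z"
  proof
    fix z assume "z \<in> ball z0 r"
    then have "0 < f z" by (rule fpos[THEN iffD2])
    then show "0 < \<phi> z" by (simp add: \<phi>_def)
  qed
  moreover have "ball z0 r \<subseteq> \<Omega>" using r(2) ball_subset_cball by blast
  ultimately show ?thesis using r(1) by blast
qed

text \<open>\<open>w\<close> stands for \<open>exp u\<close>. The bound \<open>C\<close> makes the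
  weighted product continuous in mean square, and positivity of \<open>w\<close> makes it
  definite.\<close>

locale weighted_domain =
  fixes \<Omega> :: "complex set" and w :: "complex \<Rightarrow> real" and C :: real
  assumes open_domain: "open \<Omega>" and bounded_domain: "bounded \<Omega>" and nonempty_domain: "\<Omega> \<noteq> {}"
    and weight_measurable: "w \<in> borel_measurable (lebesgue_on \<Omega>)"
    and weight_pos: "\<And>x. 0 < w x" and weight_le: "AE x in lebesgue_on \<Omega>. w x \<le> C"
begin

abbreviation M where "M \<equiv> lebesgue_on \<Omega>"

definition wprod :: "(complex \<Rightarrow> real) \<Rightarrow> (complex \<Rightarrow> real) \<Rightarrow> real" where
  "wprod \<phi> \<psi> = L2_inner M (\<lambda>x. w x *\<^sub>R \<phi> x) \<psi>"

definition wmean :: "(complex \<Rightarrow> real) \<Rightarrow> real" where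
  "wmean \<phi> = wprod \<phi> (\<lambda>_. 1)"

lemma domain_lebesgue: "\<Omega> \<in> sets lebesgue"
  using open_domain by auto

lemma domain_lmeasurable: "\<Omega> \<in> lmeasurable"
  by (rule bounded_set_imp_lmeasurable[OF bounded_domain domain_lebesgue])

lemma weight_abs_le: "AE x in M. \<bar>w x\<bar> \<le> C"
  using weight_le by eventually_elim (simp add: weight_pos less_imp_le)

lemma square_integrable_const: "square_integrable M (\<lambda>_. c :: real)"
proof -
  interpret finite_measure M by (rule finite_measure_lebesgue_on[OF domain_lmeasurable])
  show ?thesis by (simp add: square_integrable_def)
qed

lemma square_integrable_weight:
  "square_integrable M (\<phi> :: complex \<Rightarrow> real) \<Longrightarrow> square_integrable M (\<lambda>x. w x *\<^sub>R \<phi> x)"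
  by (rule square_integrable_bounded_mult(1)[OF weight_measurable weight_abs_le])

lemma wprod_commute: "wprod \<phi> \<psi> = wprod \<psi> \<phi>"
  by (simp add: wprod_def L2_inner_def mult.left_commute mult.commute)

lemma wprod_add_left:
  assumes "square_integrable M \<phi>" "square_integrable M \<psi>" "square_integrable M \<eta>"
  shows "wprod (\<lambda>x. \<phi> x + \<psi> x) \<eta> = wprod \<phi> \<eta> + wprod \<psi> \<eta>"
  using L2_inner_add_left[OF square_integrable_weight[OF assms(1)] square_integrable_weight[OF assms(2)] assms(3)]
  by (simp add: wprod_def distrib_left)

lemma wprod_scaleR_left: "wprod (\<lambda>x. c *\<^sub>R \<phi> x) \<psi> = c * wprod \<phi> \<psi>"
  using L2_inner_scaleR_left[of M c "\<lambda>x. w x *\<^sub>R \<phi> x" \<psi>] by (simp add: wprod_def mult.left_commute)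

lemma wprod_lincomb_self:
  assumes f: "square_integrable M \<phi>" and g: "square_integrable M \<psi>"
  shows "wprod (\<lambda>x. \<phi> x + t *\<^sub>R \<psi> x) (\<lambda>x. \<phi> x + t *\<^sub>R \<psi> x) = wprod \<phi> \<phi> + 2 * t * wprod \<phi> \<psi> + t\<^sup>2 * wprod \<psi> \<psi>"
proof -
  note sg = square_integrable_scaleR[OF g, of t]
  note sum = square_integrable_add[OF f sg]
  have "wprod (\<lambda>x. \<phi> x + t *\<^sub>R \<psi> x) \<eta> = wprod \<phi> \<eta> + t * wprod \<psi> \<eta>" if "square_integrable M \<eta>" for \<eta>
    using wprod_add_left[OF f sg that] wprod_scaleR_left[of t \<psi> \<eta>] by simp
  note L = this
  have "wprod (\<lambda>x. \<phi> x + t *\<^sub>R \<psi> x) (\<lambda>x. \<phi> x + t *\<^sub>R \<psi> x)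
    = wprod \<phi> (\<lambda>x. \<phi> x + t *\<^sub>R \<psi> x) + t * wprod \<psi> (\<lambda>x. \<phi> x + t *\<^sub>R \<psi> x)" by (rule L[OF sum])
  also have "wprod \<phi> (\<lambda>x. \<phi> x + t *\<^sub>R \<psi> x) = wprod \<phi> \<phi> + t * wprod \<psi> \<phi>"
    by (subst wprod_commute) (rule L[OF f])
  also have "wprod \<psi> (\<lambda>x. \<phi> x + t *\<^sub>R \<psi> x) = wprod \<phi> \<psi> + t * wprod \<psi> \<psi>"
    by (subst wprod_commute) (rule L[OF g])
  finally show ?thesis using wprod_commute[of \<psi> \<phi>] by (simp add: algebra_simps power2_eq_square)
qed

lemma wmean_lincomb:
  assumes f: "square_integrable M \<phi>" and g: "square_integrable M \<psi>"
  shows "wmean (\<lambda>x. \<phi> x + t *\<^sub>R \<psi> x) = wmean \<phi> + t * wmean \<psi>"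
  unfolding wmean_def
  using wprod_add_left[OF f square_integrable_scaleR[OF g, of t] square_integrable_const[of 1]]
    wprod_scaleR_left[of t \<psi> "\<lambda>_. 1"] by simp

lemma wprod_self_nonneg: "0 \<le> wprod \<phi> \<phi>"
  unfolding wprod_def L2_inner_def
  by (rule Bochner_Integration.integral_nonneg) (simp add: weight_pos less_imp_le mult.assoc)

lemma wprod_self_le:
  assumes "square_integrable M \<phi>"
  shows "wprod \<phi> \<phi> \<le> \<bar>C\<bar> * L2_inner M \<phi> \<phi>"
proof -
  have "wprod \<phi> \<phi> \<le> L2norm M (\<lambda>x. w x *\<^sub>R \<phi> x) * L2norm M \<phi>"
    using L2_Cauchy_Schwarz[OF square_integrable_weight[OF assms] assms] by (simp add: wprod_def L2_inner_def)
  also have "\<dots> \<le> (\<bar>C\<bar> * L2norm M \<phi>) * L2norm M \<phi>"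
    by (intro mult_right_mono square_integrable_bounded_mult(2)[OF weight_measurable weight_abs_le assms]) simp
  also have "\<dots> = \<bar>C\<bar> * (L2norm M \<phi>)\<^sup>2" by (simp add: power2_eq_square)
  finally show ?thesis by (simp add: L2norm_power2 L2_inner_self)
qed

lemma wprod_self_pos:
  assumes "square_integrable M \<phi>" "\<not> trivial_on \<Omega> \<phi>"
  shows "0 < wprod \<phi> \<phi>"
proof (rule ccontr)
  assume "\<not> 0 < wprod \<phi> \<phi>"
  then have z: "(LINT x|M. (w x *\<^sub>R \<phi> x) \<bullet> \<phi> x) = 0"
    using wprod_self_nonneg[of \<phi>] by (simp add: wprod_def L2_inner_def)
  have "AE x in M. (w x *\<^sub>R \<phi> x) \<bullet> \<phi> x = 0"
    using integral_nonneg_eq_0_iff_AE[OF integrable_inner_square_integrable[OF square_integrable_weight[OF assms(1)] assms(1)]] z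
    by (simp add: weight_pos less_imp_le mult.assoc)
  then have "AE x in M. \<phi> x = 0"
    by eventually_elim (use weight_pos in \<open>simp add: less_imp_neq[symmetric]\<close>)
  then show False using assms(2) by (simp add: trivial_on_def)
qed

lemma L2_tendsto_wprod:
  "L2_tendsto M f f' \<Longrightarrow> L2_tendsto M g g' \<Longrightarrow> (\<lambda>n. wprod (f n) (g n)) \<longlonglongrightarrow> wprod f' g'"
  unfolding wprod_def by (intro L2_tendsto_L2_inner L2_tendsto_bounded_mult[OF weight_measurable weight_abs_le])

lemma L2_tendsto_wmean: "L2_tendsto M f f' \<Longrightarrow> (\<lambda>n. wmean (f n)) \<longlonglongrightarrow> wmean f'"
  unfolding wmean_def by (intro L2_tendsto_wprod L2_tendsto_const square_integrable_const)

lemma test_function_lebesgue_on: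
  assumes t: "test_function \<Omega> \<phi> D"
  shows "square_integrable M \<phi>" "square_integrable M D"
    and "L2_inner M \<phi> \<phi> = (LINT x|lborel. (\<phi> x)\<^sup>2)" "L2_inner M D D = (LINT x|lborel. (norm (D x))\<^sup>2)"
proof -
  note m[measurable] = test_function_borel_measurable[OF t]
  note I = integrable_test_function[OF t bounded_domain]
  note T = test_functionD(4,5)[OF t]
  have "\<phi> \<in> borel_measurable M" "D \<in> borel_measurable M"
    using m by (auto intro!: measurable_restrict_space1 measurable_completion)
  then show "square_integrable M \<phi>" "square_integrable M D"
    using I(2,3) T lebesgue_on_eq_lborel(2)[OF domain_lebesgue, of "\<lambda>x. (\<phi> x)\<^sup>2"]
      lebesgue_on_eq_lborel(2)[OF domain_lebesgue, of "\<lambda>x. (norm (D x))\<^sup>2"]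
    by (auto simp: square_integrable_def)
  show "L2_inner M \<phi> \<phi> = (LINT x|lborel. (\<phi> x)\<^sup>2)"
    unfolding L2_inner_self using T lebesgue_on_eq_lborel(1)[OF domain_lebesgue, of "\<lambda>x. (norm (\<phi> x))\<^sup>2"] by simp
  show "L2_inner M D D = (LINT x|lborel. (norm (D x))\<^sup>2)"
    unfolding L2_inner_self using T lebesgue_on_eq_lborel(1)[OF domain_lebesgue, of "\<lambda>x. (norm (D x))\<^sup>2"] by simp
qed

lemma H10_iff:
  "H10 \<Omega> u G \<longleftrightarrow> (\<exists>\<phi> D. (\<forall>n. test_function \<Omega> (\<phi> n) (D n)) \<and> L2_tendsto M \<phi> u \<and> L2_tendsto M D G)"
proof
  assume H: "H10 \<Omega> u G"
  then have s: "square_integrable M u" "square_integrable M G"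
    by (auto simp: H10_def L2_on_def square_integrable_def)
  obtain \<phi> D where t: "\<And>n::nat. test_function \<Omega> (\<phi> n) (D n)"
    and c: "(\<lambda>n. LINT x|M. (\<phi> n x - u x)\<^sup>2) \<longlonglongrightarrow> 0" "(\<lambda>n. LINT x|M. (norm (D n x - G x))\<^sup>2) \<longlonglongrightarrow> 0"
    using H by (auto simp: H10_def)
  have "L2_tendsto M \<phi> u" "L2_tendsto M D G"
    using c L2_tendsto_iff[OF test_function_lebesgue_on(1)[OF t] s(1)] L2_tendsto_iff[OF test_function_lebesgue_on(2)[OF t] s(2)]
    by auto
  then show "\<exists>\<phi> D. (\<forall>n. test_function \<Omega> (\<phi> n) (D n)) \<and> L2_tendsto M \<phi> u \<and> L2_tendsto M D G" using t by blast
next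
  assume "\<exists>\<phi> D. (\<forall>n. test_function \<Omega> (\<phi> n) (D n)) \<and> L2_tendsto M \<phi> u \<and> L2_tendsto M D G"
  then obtain \<phi> D where t: "\<And>n. test_function \<Omega> (\<phi> n) (D n)" and c: "L2_tendsto M \<phi> u" "L2_tendsto M D G" by blast
  have s: "square_integrable M u" "square_integrable M G" using c by (auto simp: L2_tendsto_def)
  have "(\<lambda>n. LINT x|M. (\<phi> n x - u x)\<^sup>2) \<longlonglongrightarrow> 0" "(\<lambda>n. LINT x|M. (norm (D n x - G x))\<^sup>2) \<longlonglongrightarrow> 0"
    using c L2_tendsto_iff[OF test_function_lebesgue_on(1)[OF t] s(1)] L2_tendsto_iff[OF test_function_lebesgue_on(2)[OF t] s(2)]
    by auto
  then show "H10 \<Omega> u G" using s t by (auto simp: H10_def L2_on_def square_integrable_def)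
qed

lemma H10_square_integrable:
  assumes "H10 \<Omega> u G" shows "square_integrable M u" "square_integrable M G"
  using assms by (auto simp: H10_def L2_on_def square_integrable_def)

lemma H10_lincomb:
  assumes "H10 \<Omega> u G" "H10 \<Omega> v H"
  shows "H10 \<Omega> (\<lambda>x. u x + t *\<^sub>R v x) (\<lambda>x. G x + t *\<^sub>R H x)"
proof -
  obtain \<phi> D where 1: "\<And>n. test_function \<Omega> (\<phi> n) (D n)" "L2_tendsto M \<phi> u" "L2_tendsto M D G"
    using assms(1) by (auto simp: H10_iff)
  obtain \<psi> E where 2: "\<And>n. test_function \<Omega> (\<psi> n) (E n)" "L2_tendsto M \<psi> v" "L2_tendsto M E H"
    using assms(2) by (auto simp: H10_iff)
  have "test_function \<Omega> (\<lambda>x. \<phi> n x + t *\<^sub>R \<psi> n x) (\<lambda>x. D n x + t *\<^sub>R E n x)" for n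
    using test_function_lincomb[OF 1(1)[of n] 2(1)[of n], of 1 t] by simp
  moreover have "L2_tendsto M (\<lambda>n x. \<phi> n x + t *\<^sub>R \<psi> n x) (\<lambda>x. u x + t *\<^sub>R v x)"
    "L2_tendsto M (\<lambda>n x. D n x + t *\<^sub>R E n x) (\<lambda>x. G x + t *\<^sub>R H x)"
    by (intro L2_tendsto_add L2_tendsto_scaleR 1 2)+
  ultimately show ?thesis unfolding H10_iff by (intro exI conjI allI)
qed

text \<open>All terms are continuous along the approximating sequence of an \<open>H10\<close>
  function. The four coefficients cover both uses: \<open>a = s = 0\<close> is the Poincare
  inequality, \<open>a = \<kappa>\<close> with \<open>b = 0\<close> and \<open>d = 1\<close> is the
  lower bound for the Rayleigh quotient.\<close>

lemma H10_limit_le: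
  assumes H: "H10 \<Omega> u G"
    and le: "\<And>\<phi> D. test_function \<Omega> \<phi> D \<Longrightarrow> a * wprod \<phi> \<phi> + b * L2_inner M \<phi> \<phi> \<le> d * L2_inner M D D + s * (wmean \<phi>)\<^sup>2"
  shows "a * wprod u u + b * L2_inner M u u \<le> d * L2_inner M G G + s * (wmean u)\<^sup>2"
proof -
  obtain \<phi> D where t: "\<And>n. test_function \<Omega> (\<phi> n) (D n)" and c: "L2_tendsto M \<phi> u" "L2_tendsto M D G"
    using H by (auto simp: H10_iff)
  have "(\<lambda>n. a * wprod (\<phi> n) (\<phi> n) + b * L2_inner M (\<phi> n) (\<phi> n)) \<longlonglongrightarrow> a * wprod u u + b * L2_inner M u u"
    by (intro tendsto_intros L2_tendsto_wprod L2_tendsto_L2_inner c)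
  moreover have "(\<lambda>n. d * L2_inner M (D n) (D n) + s * (wmean (\<phi> n))\<^sup>2) \<longlonglongrightarrow> d * L2_inner M G G + s * (wmean u)\<^sup>2"
    by (intro tendsto_intros L2_tendsto_wmean L2_tendsto_L2_inner c)
  ultimately show ?thesis by (rule LIMSEQ_le) (use le t in blast)
qed

lemma H10_poincare_strip:
  assumes strip: "\<And>z. z \<in> \<Omega> \<Longrightarrow> \<bar>q \<bullet> z + c\<bar> \<le> 1" and H: "H10 \<Omega> u G"
  shows "9 / 4 * (norm q)\<^sup>2 * L2_inner M u u \<le> L2_inner M G G"
proof -
  have "0 * wprod u u + (9 / 4 * (norm q)\<^sup>2) * L2_inner M u u \<le> 1 * L2_inner M G G + 0 * (wmean u)\<^sup>2"
    using poincare_strip[OF _ bounded_domain strip]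
    by (intro H10_limit_le[OF H]) (simp add: test_function_lebesgue_on)
  then show ?thesis by simp
qed

text \<open>Any bounded set lies in some strip, which yields a Poincare inequality with an
  unspecified constant; the \<open>+ 0\<close> matches the form of the strip hypothesis
  elsewhere.\<close>

lemma strip_exists: "\<exists>q::complex. q \<noteq> 0 \<and> (\<forall>z\<in>\<Omega>. \<bar>q \<bullet> z + 0\<bar> \<le> 1)"
proof -
  obtain R where R: "0 < R" "\<And>z. z \<in> \<Omega> \<Longrightarrow> norm z \<le> R" using bounded_domain bounded_pos by blast
  have "\<bar>complex_of_real (inverse R) \<bullet> z + 0\<bar> \<le> 1" if "z \<in> \<Omega>" for z
  proof -
    have "\<bar>complex_of_real (inverse R) \<bullet> z\<bar> \<le> norm (complex_of_real (inverse R)) * norm z" by (rule Cauchy_Schwarz_ineq2)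
    also have "\<dots> \<le> inverse R * R" using R that by (intro mult_mono) (auto simp: norm_inverse)
    finally show ?thesis using R by simp
  qed
  then show ?thesis using R(1) by (intro exI[of _ "complex_of_real (inverse R)"]) auto
qed

lemma H10_poincare: "\<exists>p>0. \<forall>u G. H10 \<Omega> u G \<longrightarrow> p * L2_inner M u u \<le> L2_inner M G G"
proof -
  obtain q :: complex where q: "q \<noteq> 0" "\<And>z. z \<in> \<Omega> \<Longrightarrow> \<bar>q \<bullet> z + 0\<bar> \<le> 1" using strip_exists by blast
  then show ?thesis using H10_poincare_strip[of q 0]
    by (intro exI[of _ "9 / 4 * (norm q)\<^sup>2"]) auto
qed

lemma H10_test_function: "test_function \<Omega> \<phi> D \<Longrightarrow> H10 \<Omega> \<phi> D"
  unfolding H10_iff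
  by (intro exI[of _ "\<lambda>_. \<phi>"] exI[of _ "\<lambda>_. D"]) (auto intro: L2_tendsto_const test_function_lebesgue_on)

text \<open>A minimizing sequence of the Rayleigh quotient is Cauchy in mean square by Rellich; the
  parallelogram law for the numerator then makes the gradients Cauchy as well.\<close>

lemma first_eigenfunction_exists:
  assumes s: "0 \<le> s"
  shows "\<exists>\<kappa> u G. H10 \<Omega> u G \<and> wprod u u = 1 \<and>
    (\<forall>v H. H10 \<Omega> v H \<longrightarrow> L2_inner M G H + s * wmean u * wmean v = \<kappa> * wprod u v) \<and>
    (\<forall>v H. H10 \<Omega> v H \<longrightarrow> \<kappa> * wprod v v \<le> L2_inner M H H + s * (wmean v)\<^sup>2)"
proof -
  define J where "J \<phi> D = L2_inner M D D + s * (wmean \<phi>)\<^sup>2" for \<phi> and D :: "complex \<Rightarrow> complex"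
  have J0: "0 \<le> J \<phi> D" for \<phi> D using s by (simp add: J_def L2_inner_self_nonneg)
  have J_lincomb: "J (\<lambda>x. \<phi> x + t *\<^sub>R \<psi> x) (\<lambda>x. D x + t *\<^sub>R E x)
      = J \<phi> D + 2 * t * (L2_inner M D E + s * wmean \<phi> * wmean \<psi>) + t\<^sup>2 * J \<psi> E"
    if "square_integrable M \<phi>" "square_integrable M \<psi>" "square_integrable M D" "square_integrable M E" for \<phi> \<psi> D E t
    unfolding J_def L2_inner_lincomb_self[OF that(3,4)] wmean_lincomb[OF that(1,2)]
    by (simp add: power2_eq_square algebra_simps)
  define S where "S = {J \<phi> D | \<phi> D. test_function \<Omega> \<phi> D \<and> wprod \<phi> \<phi> = 1}"
  define \<kappa> where "\<kappa> = Inf S"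
  note ts = test_function_lebesgue_on
  \<comment> \<open>Numerator and weighted square are both quadratic, so any test function with
    positive weighted square can be normalized without changing its quotient.\<close>
  have norm1: "\<exists>\<psi> E. test_function \<Omega> \<psi> E \<and> wprod \<psi> \<psi> = 1 \<and> J \<psi> E * wprod \<phi> \<phi> = J \<phi> D"
    if t: "test_function \<Omega> \<phi> D" and p: "0 < wprod \<phi> \<phi>" for \<phi> D
  proof -
    define a where "a = 1 / sqrt (wprod \<phi> \<phi>)"
    have a2: "a\<^sup>2 * wprod \<phi> \<phi> = 1" using p by (simp add: a_def power_divide)
    have t': "test_function \<Omega> (\<lambda>x. a *\<^sub>R \<phi> x) (\<lambda>x. a *\<^sub>R D x)"
      using test_function_lincomb[OF t t, of a 0] by simp
    have w: "wprod (\<lambda>x. a *\<^sub>R \<phi> x) \<psi> = a * wprod \<phi> \<psi>" for \<psi> by (rule wprod_scaleR_left)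
    have "wprod (\<lambda>x. a *\<^sub>R \<phi> x) (\<lambda>x. a *\<^sub>R \<phi> x) = a\<^sup>2 * wprod \<phi> \<phi>"
      unfolding w by (subst wprod_commute) (simp add: w[simplified] power2_eq_square)
    moreover have "J (\<lambda>x. a *\<^sub>R \<phi> x) (\<lambda>x. a *\<^sub>R D x) = a\<^sup>2 * J \<phi> D"
      unfolding J_def wmean_def w
      by (simp add: L2_inner_self power_mult_distrib algebra_simps)
    ultimately show ?thesis using t' a2 by (intro exI conjI) (auto simp: algebra_simps)
  qed
  have Sne: "S \<noteq> {}"
  proof -
    obtain z0 where "z0 \<in> \<Omega>" using nonempty_domain by auto
    then obtain \<phi> D r where b: "test_function \<Omega> \<phi> D" "0 < r" "ball z0 r \<subseteq> \<Omega>" "\<And>z. z \<in> ball z0 r \<Longrightarrow> 0 < \<phi> z"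
      using bump_test_function[OF open_domain] by blast
    have "\<not> trivial_on \<Omega> \<phi>"
    proof
      assume "trivial_on \<Omega> \<phi>"
      then have "AE x in lebesgue. x \<in> \<Omega> \<longrightarrow> \<phi> x = 0"
        unfolding trivial_on_def using domain_lebesgue by (subst (asm) AE_restrict_space_iff) auto
      then obtain N where N: "N \<in> null_sets lebesgue" "{x. \<not> (x \<in> \<Omega> \<longrightarrow> \<phi> x = 0)} \<subseteq> N"
        by (auto simp: eventually_ae_filter)
      have "ball z0 r \<subseteq> N" using b(3,4) N(2) by force
      then have "negligible (ball z0 r)"
        using N(1) negligible_iff_null_sets negligible_subset by blast
      then show False using b(2) open_not_negligible[of "ball z0 r"] by simp
    qed
    then show ?thesis using norm1[OF b(1) wprod_self_pos[OF ts(1)[OF b(1)]]] by (auto simp: S_def)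
  qed
  have Sbd: "bdd_below S" using J0 by (auto simp: S_def intro!: bdd_belowI[of _ 0])
  have \<kappa>0: "0 \<le> \<kappa>" unfolding \<kappa>_def using Sne J0 by (intro cInf_greatest) (auto simp: S_def)
  have low: "\<kappa> * wprod \<phi> \<phi> \<le> J \<phi> D" if t: "test_function \<Omega> \<phi> D" for \<phi> D
  proof (cases "wprod \<phi> \<phi> = 0")
    case False
    then have p: "0 < wprod \<phi> \<phi>" using wprod_self_nonneg[of \<phi>] by simp
    obtain \<psi> E where \<psi>: "test_function \<Omega> \<psi> E" "wprod \<psi> \<psi> = 1" "J \<psi> E * wprod \<phi> \<phi> = J \<phi> D"
      using norm1[OF t p] by blast
    have "\<kappa> \<le> J \<psi> E" unfolding \<kappa>_def using \<psi> Sbd by (intro cInf_lower) (auto simp: S_def)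
    then have "\<kappa> * wprod \<phi> \<phi> \<le> J \<psi> E * wprod \<phi> \<phi>" using p by (intro mult_right_mono) auto
    then show ?thesis using \<psi>(3) by simp
  qed (simp add: J0)
  have lowH: "\<kappa> * wprod v v \<le> J v H" if "H10 \<Omega> v H" for v H
    using H10_limit_le[OF that, of \<kappa> 0 1 s] low by (simp add: J_def)
  have "\<forall>n. \<exists>\<phi> D. test_function \<Omega> \<phi> D \<and> wprod \<phi> \<phi> = 1 \<and> J \<phi> D < \<kappa> + inverse (real (Suc n))"
  proof
    fix n
    have "Inf S < \<kappa> + inverse (real (Suc n))" by (simp add: \<kappa>_def)
    then obtain y where "y \<in> S" "y < \<kappa> + inverse (real (Suc n))" using cInf_lessD[OF Sne] by blast
    then show "\<exists>\<phi> D. test_function \<Omega> \<phi> D \<and> wprod \<phi> \<phi> = 1 \<and> J \<phi> D < \<kappa> + inverse (real (Suc n))"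
      by (auto simp: S_def)
  qed
  then obtain \<phi> D where t: "\<And>n. test_function \<Omega> (\<phi> n) (D n)" and n1: "\<And>n. wprod (\<phi> n) (\<phi> n) = 1"
    and Jn: "\<And>n. J (\<phi> n) (D n) < \<kappa> + inverse (real (Suc n))" by metis
  obtain p where p: "0 < p" "\<And>u G. H10 \<Omega> u G \<Longrightarrow> p * L2_inner M u u \<le> L2_inner M G G"
    using H10_poincare by blast
  have D1: "L2_inner M (D n) (D n) \<le> \<kappa> + 1" for n
  proof -
    have "inverse (real (Suc n)) \<le> 1" by (simp add: inverse_le_1_iff)
    moreover have "0 \<le> s * (wmean (\<phi> n))\<^sup>2" using s by simp
    ultimately show ?thesis using Jn[of n] unfolding J_def by linarith
  qed
  \<comment> \<open>\<open>J\<close> controls only the gradients; Rellich also needs bounded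
    functions in mean square, which the Poincare inequality supplies.\<close>
  have P1: "L2_inner M (\<phi> n) (\<phi> n) \<le> (\<kappa> + 1) / p" for n
    using p(2)[OF H10_test_function[OF t[of n]]] D1[of n] p(1) by (simp add: field_simps)
  define B where "B = max (\<kappa> + 1) ((\<kappa> + 1) / p)"
  have "\<exists>r. strict_mono (r :: nat \<Rightarrow> nat) \<and>
    (\<forall>e>0. \<exists>N. \<forall>m\<ge>N. \<forall>n\<ge>N. (LINT x|lborel. (\<phi> (r m) x - \<phi> (r n) x)\<^sup>2) < e)"
    using D1 P1 ts(3,4)[OF t]
    by (intro rellich_test_functions[OF t bounded_domain, where B = B]) (auto simp: B_def le_max_iff_disj)
  then obtain r :: "nat \<Rightarrow> nat" where r: "strict_mono r"
    "\<And>e. 0 < e \<Longrightarrow> \<exists>N. \<forall>m\<ge>N. \<forall>n\<ge>N. (LINT x|lborel. (\<phi> (r m) x - \<phi> (r n) x)\<^sup>2) < e" by blast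
  define f where "f n = \<phi> (r n)" for n
  define g where "g n = D (r n)" for n
  have tf: "test_function \<Omega> (f n) (g n)" "wprod (f n) (f n) = 1" "J (f n) (g n) < \<kappa> + inverse (real (Suc n))" for n
  proof -
    show "test_function \<Omega> (f n) (g n)" "wprod (f n) (f n) = 1" using t n1 by (auto simp: f_def g_def)
    have "inverse (real (Suc (r n))) \<le> inverse (real (Suc n))"
      using seq_suble[OF r(1), of n] by (simp add: le_imp_inverse_le)
    then show "J (f n) (g n) < \<kappa> + inverse (real (Suc n))" using Jn[of "r n"] unfolding f_def g_def by linarith
  qed
  note sf = ts(1)[OF tf(1)] and sg = ts(2)[OF tf(1)]
  have diff: "test_function \<Omega> (\<lambda>x. f m x + (-1) *\<^sub>R f n x) (\<lambda>x. g m x + (-1) *\<^sub>R g n x)" for m n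
    using test_function_lincomb[OF tf(1)[of m] tf(1)[of n], of 1 "-1"] by simp
  have plus: "test_function \<Omega> (\<lambda>x. f m x + 1 *\<^sub>R f n x) (\<lambda>x. g m x + 1 *\<^sub>R g n x)" for m n
    using test_function_lincomb[OF tf(1)[of m] tf(1)[of n], of 1 1] by simp
  have Cf: "\<exists>N. \<forall>m\<ge>N. \<forall>n\<ge>N. L2_inner M (\<lambda>x. f m x + (-1) *\<^sub>R f n x) (\<lambda>x. f m x + (-1) *\<^sub>R f n x) < e" if "0 < e" for e
    using r(2)[OF that] unfolding ts(3)[OF diff] by (simp add: f_def)
  \<comment> \<open>The sum \<open>f m + f n\<close> has quotient at least \<open>\<kappa>\<close>
    and weighted square \<open>4 - wprod d d\<close> for the difference \<open>d\<close>. In the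
    parallelogram identity the terms \<open>4 * \<kappa>\<close> cancel, and what remains for
    \<open>J\<close> of \<open>d\<close> is the slack of the two functions plus
    \<open>\<kappa> * wprod d d\<close>.\<close>
  have par: "L2_inner M (\<lambda>x. g m x + (-1) *\<^sub>R g n x) (\<lambda>x. g m x + (-1) *\<^sub>R g n x)
     \<le> 2 * inverse (real (Suc m)) + 2 * inverse (real (Suc n))
       + \<kappa> * \<bar>C\<bar> * L2_inner M (\<lambda>x. f m x + (-1) *\<^sub>R f n x) (\<lambda>x. f m x + (-1) *\<^sub>R f n x)" for m n
  proof -
    let ?d = "\<lambda>x. f m x + (-1) *\<^sub>R f n x" and ?d' = "\<lambda>x. g m x + (-1) *\<^sub>R g n x"
    have "\<kappa> * wprod (\<lambda>x. f m x + 1 *\<^sub>R f n x) (\<lambda>x. f m x + 1 *\<^sub>R f n x) \<le> J (\<lambda>x. f m x + 1 *\<^sub>R f n x) (\<lambda>x. g m x + 1 *\<^sub>R g n x)"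
      by (rule low[OF plus])
    moreover have "J ?d ?d' + J (\<lambda>x. f m x + 1 *\<^sub>R f n x) (\<lambda>x. g m x + 1 *\<^sub>R g n x) = 2 * J (f m) (g m) + 2 * J (f n) (g n)"
      unfolding J_lincomb[OF sf sf sg sg] by simp
    moreover have "wprod (\<lambda>x. f m x + 1 *\<^sub>R f n x) (\<lambda>x. f m x + 1 *\<^sub>R f n x) = 4 - wprod ?d ?d"
      unfolding wprod_lincomb_self[OF sf sf] tf(2) by simp
    moreover have "\<kappa> * wprod ?d ?d \<le> \<kappa> * (\<bar>C\<bar> * L2_inner M ?d ?d)"
      using \<kappa>0 by (intro mult_left_mono wprod_self_le ts(1)[OF diff])
    moreover have "L2_inner M ?d' ?d' \<le> J ?d ?d'" using s by (simp add: J_def)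
    ultimately show ?thesis using tf(3)[of m] tf(3)[of n] by (simp add: right_diff_distrib mult.assoc)
  qed
  have Cg: "\<exists>N. \<forall>m\<ge>N. \<forall>n\<ge>N. L2_inner M (\<lambda>x. g m x + (-1) *\<^sub>R g n x) (\<lambda>x. g m x + (-1) *\<^sub>R g n x) < e" if e: "0 < e" for e
  proof -
    obtain N1 where N1: "inverse (real (Suc N1)) < e / 8" using reals_Archimedean[of "e / 8"] e by auto
    \<comment> \<open>The added 1 keeps \<open>K\<close> positive even if \<open>\<kappa>\<close>
      vanishes, so that \<open>e / (2 * K)\<close> makes sense.\<close>
    define K where "K = \<kappa> * \<bar>C\<bar> + 1"
    have K: "0 < K" "\<kappa> * \<bar>C\<bar> \<le> K" using \<kappa>0 by (auto simp: K_def add_nonneg_pos)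
    obtain N2 where N2: "\<And>m n. N2 \<le> m \<Longrightarrow> N2 \<le> n \<Longrightarrow> L2_inner M (\<lambda>x. f m x + (-1) *\<^sub>R f n x) (\<lambda>x. f m x + (-1) *\<^sub>R f n x) < e / (2 * K)"
      using Cf[of "e / (2 * K)"] e K by auto
    have "L2_inner M (\<lambda>x. g m x + (-1) *\<^sub>R g n x) (\<lambda>x. g m x + (-1) *\<^sub>R g n x) < e" if mn: "max N1 N2 \<le> m" "max N1 N2 \<le> n" for m n
    proof -
      let ?L = "L2_inner M (\<lambda>x. f m x + (-1) *\<^sub>R f n x) (\<lambda>x. f m x + (-1) *\<^sub>R f n x)"
      have "inverse (real (Suc m)) \<le> inverse (real (Suc N1))" "inverse (real (Suc n)) \<le> inverse (real (Suc N1))"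
        using mn by (auto intro!: le_imp_inverse_le)
      moreover have "\<kappa> * \<bar>C\<bar> * ?L \<le> K * ?L" using K by (intro mult_right_mono L2_inner_self_nonneg) auto
      moreover have "K * ?L < e / 2" using N2[of m n] mn K by (simp add: field_simps)
      ultimately show ?thesis using par[of m n] N1 by linarith
    qed
    then show ?thesis by (intro exI[of _ "max N1 N2"]) blast
  qed
  have "\<exists>u. L2_tendsto M f u"
    by (rule L2_complete[OF sf]) (use Cf in \<open>simp add: L2_inner_self\<close>)
  moreover have "\<exists>G. L2_tendsto M g G"
    by (rule L2_complete[OF sg]) (use Cg in \<open>simp add: L2_inner_self\<close>)
  ultimately obtain u G where u: "L2_tendsto M f u" "L2_tendsto M g G" by blast
  have H: "H10 \<Omega> u G" unfolding H10_iff using tf(1) u by blast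
  have w1: "wprod u u = 1"
    using L2_tendsto_wprod[OF u(1) u(1)] LIMSEQ_unique[OF _ tendsto_const[of 1]] by (simp add: tf(2))
  have "(\<lambda>n. J (f n) (g n)) \<longlonglongrightarrow> J u G"
    unfolding J_def by (intro tendsto_intros L2_tendsto_L2_inner L2_tendsto_wmean u)
  moreover have "(\<lambda>n. \<kappa> + inverse (real (Suc n))) \<longlonglongrightarrow> \<kappa> + 0"
    by (intro tendsto_intros LIMSEQ_inverse_real_of_nat)
  ultimately have "J u G \<le> \<kappa> + 0"
    by (rule LIMSEQ_le) (use tf(3) in \<open>auto intro: less_imp_le\<close>)
  then have J\<kappa>: "J u G = \<kappa>" using lowH[OF H] w1 by simp
  have EL: "L2_inner M G E + s * wmean u * wmean v = \<kappa> * wprod u v" if v: "H10 \<Omega> v E" for v E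
  proof -
    note su = H10_square_integrable[OF H] and sv = H10_square_integrable[OF v]
    \<comment> \<open>The lower bound is attained at \<open>u\<close>, so in the inequality for
      \<open>u + t * v\<close> the constant terms cancel, and the coefficient linear in
      \<open>t\<close> has to vanish.\<close>
    have "0 \<le> 2 * t * (L2_inner M G E + s * wmean u * wmean v - \<kappa> * wprod u v) + t\<^sup>2 * (J v E - \<kappa> * wprod v v)" for t
    proof -
      have "\<kappa> * wprod (\<lambda>x. u x + t *\<^sub>R v x) (\<lambda>x. u x + t *\<^sub>R v x) \<le> J (\<lambda>x. u x + t *\<^sub>R v x) (\<lambda>x. G x + t *\<^sub>R E x)"
        by (rule lowH[OF H10_lincomb[OF H v]])
      then show ?thesis
        unfolding J_lincomb[OF su(1) sv(1) su(2) sv(2)] wprod_lincomb_self[OF su(1) sv(1)] J\<kappa> w1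
        by (simp add: algebra_simps)
    qed
    from linear_coefficient_zero[OF this] show ?thesis by simp
  qed
  show ?thesis using H w1 EL lowH by (intro exI[of _ \<kappa>] exI[of _ u] exI[of _ G]) (auto simp: J_def)
qed

end

section \<open>Positivity of the eigenvalues\<close>

lemma AE_lebesgue_on_open_exists:
  fixes S :: "'a::euclidean_space set"
  assumes "open S" "S \<noteq> {}" and ae: "AE x in lebesgue_on S. P x"
  shows "\<exists>x\<in>S. P x"
proof (rule ccontr)
  assume no: "\<not> (\<exists>x\<in>S. P x)"
  have "S \<in> sets lebesgue" using assms(1) by auto
  then have "AE x in lebesgue. x \<in> S \<longrightarrow> P x"
    using ae by (subst (asm) AE_restrict_space_iff) auto
  then obtain N where N: "N \<in> null_sets lebesgue" "{x. \<not> (x \<in> S \<longrightarrow> P x)} \<subseteq> N"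
    by (auto simp: eventually_ae_filter)
  have "S \<subseteq> N" using N(2) no by blast
  then have "negligible S" using N(1) negligible_iff_null_sets negligible_subset by blast
  then show False using open_not_negligible[OF assms(1,2)] by simp
qed

text \<open>For a continuous function the points violating the bound form an open set; being null,
  it is empty. This turns barrier inequalities known almost everywhere into containment of the
  domain.\<close>

lemma AE_lebesgue_on_open_le:
  fixes S :: "'a::euclidean_space set" and f :: "'a \<Rightarrow> real"
  assumes S: "open S" and f: "continuous_on UNIV f" and ae: "AE x in lebesgue_on S. f x \<le> c" and x: "x \<in> S"
  shows "f x \<le> c"
proof (rule ccontr)
  assume "\<not> f x \<le> c"
  define U where "U = S \<inter> {x. c < f x}"
  have U: "open U" unfolding U_def by (intro open_Int S open_Collect_less continuous_intros f)
  have "U \<noteq> {}" using x \<open>\<not> f x \<le> c\<close> by (auto simp: U_def)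
  have S': "S \<in> sets lebesgue" and U': "U \<in> sets lebesgue" using S U by auto
  have "AE x in lebesgue. x \<in> S \<longrightarrow> f x \<le> c" using ae S' by (subst (asm) AE_restrict_space_iff) auto
  then have "AE x in lebesgue. x \<in> U \<longrightarrow> f x \<le> c" by eventually_elim (auto simp: U_def)
  then have "AE x in lebesgue_on U. f x \<le> c" using U' by (subst AE_restrict_space_iff) auto
  from AE_lebesgue_on_open_exists[OF U \<open>U \<noteq> {}\<close> this] show False by (auto simp: U_def)
qed

context weighted_domain
begin

definition weak_eigenfunction :: "real \<Rightarrow> real \<Rightarrow> (complex \<Rightarrow> real) \<Rightarrow> bool" where
  "weak_eigenfunction s \<kappa> \<phi> \<longleftrightarrow> (\<exists>G. H10 \<Omega> \<phi> G \<and>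
     (\<forall>\<psi> H. H10 \<Omega> \<psi> H \<longrightarrow> L2_inner M G H + s * wmean \<phi> * wmean \<psi> = \<kappa> * wprod \<phi> \<psi>))"

text \<open>Test the equation with its own solution: the nonlocal term is \<open>s\<close> times a
  square, so the gradient integral is at most \<open>\<kappa>\<close> times the weighted square.
  Strictness comes from \<open>\<theta> < 1\<close> and a nonzero gradient, which the Poincare
  inequality guarantees for nontrivial \<open>\<phi>\<close>.\<close>

lemma weak_eigenvalue_gt:
  assumes s: "0 \<le> s" and \<theta>: "0 \<le> \<theta>" "\<theta> < 1"
    and le: "\<And>\<phi> G. H10 \<Omega> \<phi> G \<Longrightarrow> \<mu> * wprod \<phi> \<phi> \<le> \<theta> * L2_inner M G G"
    and e: "weak_eigenfunction s \<kappa> \<phi>" and nt: "\<not> trivial_on \<Omega> \<phi>"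
  shows "\<mu> < \<kappa>"
proof -
  obtain G where H: "H10 \<Omega> \<phi> G" and eq: "L2_inner M G G + s * wmean \<phi> * wmean \<phi> = \<kappa> * wprod \<phi> \<phi>"
    using e by (auto simp: weak_eigenfunction_def)
  note sq = H10_square_integrable[OF H]
  have W: "0 < wprod \<phi> \<phi>" by (rule wprod_self_pos[OF sq(1) nt])
  have "0 < L2_inner M \<phi> \<phi>"
    using W wprod_self_le[OF sq(1)] L2_inner_self_nonneg[of M \<phi>] by (cases "L2_inner M \<phi> \<phi> = 0") auto
  moreover obtain p where "0 < p" "p * L2_inner M \<phi> \<phi> \<le> L2_inner M G G" using H10_poincare H by blast
  ultimately have G: "0 < L2_inner M G G" by (meson less_le_trans mult_pos_pos)
  have "\<mu> * wprod \<phi> \<phi> \<le> \<theta> * L2_inner M G G" by (rule le[OF H])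
  also have "\<dots> < L2_inner M G G" using \<theta> G by simp
  also have "\<dots> \<le> \<kappa> * wprod \<phi> \<phi>"
  proof -
    have "0 \<le> s * wmean \<phi> * wmean \<phi>" using s by (simp add: mult.assoc)
    then show ?thesis using eq by linarith
  qed
  finally show ?thesis using W by simp
qed

text \<open>The minimum of the Rayleigh quotient is an eigenvalue, and no eigenvalue is smaller
  because an eigenfunction, tested with itself, has its eigenvalue as quotient.\<close>

lemma first_weak_eigenvalue:
  assumes s: "0 \<le> s"
  shows "\<exists>\<kappa>. (\<exists>\<phi>. weak_eigenfunction s \<kappa> \<phi> \<and> \<not> trivial_on \<Omega> \<phi>) \<and>
    (\<forall>\<kappa>' \<phi>. weak_eigenfunction s \<kappa>' \<phi> \<and> \<not> trivial_on \<Omega> \<phi> \<longrightarrow> \<kappa> \<le> \<kappa>')"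
proof -
  obtain \<kappa> u G where u: "H10 \<Omega> u G" "wprod u u = 1"
    "\<And>v H. H10 \<Omega> v H \<Longrightarrow> L2_inner M G H + s * wmean u * wmean v = \<kappa> * wprod u v"
    "\<And>v H. H10 \<Omega> v H \<Longrightarrow> \<kappa> * wprod v v \<le> L2_inner M H H + s * (wmean v)\<^sup>2"
    using first_eigenfunction_exists[OF s] by blast
  have "\<not> trivial_on \<Omega> u"
  proof
    assume "trivial_on \<Omega> u"
    then have "AE x in M. (w x *\<^sub>R u x) \<bullet> u x = 0"
      unfolding trivial_on_def by eventually_elim simp
    then have "wprod u u = 0" unfolding wprod_def L2_inner_def by (rule integral_eq_zero_AE)
    then show False using u(2) by simp
  qed
  moreover have "weak_eigenfunction s \<kappa> u" unfolding weak_eigenfunction_def using u(1,3) by blast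
  moreover have "\<kappa> \<le> \<kappa>'" if e: "weak_eigenfunction s \<kappa>' \<phi>" and nt: "\<not> trivial_on \<Omega> \<phi>" for \<kappa>' \<phi>
  proof -
    obtain H where H: "H10 \<Omega> \<phi> H" "L2_inner M H H + s * wmean \<phi> * wmean \<phi> = \<kappa>' * wprod \<phi> \<phi>"
      using e by (auto simp: weak_eigenfunction_def)
    have "\<kappa> * wprod \<phi> \<phi> \<le> \<kappa>' * wprod \<phi> \<phi>"
      using u(4)[OF H(1)] H(2) by (simp add: power2_eq_square mult.assoc)
    then show ?thesis using wprod_self_pos[OF H10_square_integrable(1)[OF H(1)] nt] by simp
  qed
  ultimately show ?thesis by blast
qed

text \<open>\<open>dirichlet_solution\<close> also asks that the right-hand side times each test
  function be integrable. The bounded weight provides this, so the equation with the bilinear forms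
  says the same.\<close>

lemma weak_eigenfunction_iff_dirichlet_solution:
  "weak_eigenfunction s \<kappa> \<phi> \<longleftrightarrow> dirichlet_solution \<Omega> (\<lambda>x. \<kappa> * (w x * \<phi> x) - s * wmean \<phi> * w x) \<phi>"
proof -
  have rhs: "integrable M (\<lambda>x. (\<kappa> * (w x * \<phi> x) - s * wmean \<phi> * w x) * \<psi> x) \<and>
      (LINT x|M. (\<kappa> * (w x * \<phi> x) - s * wmean \<phi> * w x) * \<psi> x) = \<kappa> * wprod \<phi> \<psi> - s * wmean \<phi> * wmean \<psi>"
    if \<phi>: "square_integrable M \<phi>" and \<psi>: "square_integrable M \<psi>" for \<psi>
  proof -
    have I: "integrable M (\<lambda>x. (w x *\<^sub>R \<phi> x) \<bullet> \<psi> x)" "integrable M (\<lambda>x. (w x *\<^sub>R \<psi> x) \<bullet> 1)"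
      by (intro integrable_inner_square_integrable square_integrable_weight \<phi> \<psi> square_integrable_const)+
    have e: "(\<kappa> * (w x * \<phi> x) - s * wmean \<phi> * w x) * \<psi> x
      = \<kappa> * ((w x *\<^sub>R \<phi> x) \<bullet> \<psi> x) - s * wmean \<phi> * ((w x *\<^sub>R \<psi> x) \<bullet> 1)" for x
      by (simp add: algebra_simps)
    have "(LINT x|M. \<kappa> * ((w x *\<^sub>R \<phi> x) \<bullet> \<psi> x) - s * wmean \<phi> * ((w x *\<^sub>R \<psi> x) \<bullet> 1))
      = \<kappa> * (LINT x|M. (w x *\<^sub>R \<phi> x) \<bullet> \<psi> x) - s * wmean \<phi> * (LINT x|M. (w x *\<^sub>R \<psi> x) \<bullet> 1)"
      using I by (subst Bochner_Integration.integral_diff) (simp_all only: integrable_mult_right integral_mult_right_zero)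
    also have "\<dots> = \<kappa> * wprod \<phi> \<psi> - s * wmean \<phi> * wmean \<psi>"
      unfolding wmean_def[of \<psi>] wprod_def L2_inner_def by simp
    finally show ?thesis unfolding e using I by (intro conjI Bochner_Integration.integrable_diff integrable_mult_right)
  qed
  show ?thesis
    unfolding weak_eigenfunction_def dirichlet_solution_def
  proof (intro ex_cong1 conj_cong refl all_cong1 imp_cong)
    fix G \<psi> H assume H: "H10 \<Omega> \<phi> G" "H10 \<Omega> \<psi> H"
    note R = rhs[OF H10_square_integrable(1)[OF H(1)] H10_square_integrable(1)[OF H(2)]]
    show "L2_inner M G H + s * wmean \<phi> * wmean \<psi> = \<kappa> * wprod \<phi> \<psi> \<longleftrightarrow>
      integrable M (\<lambda>x. (\<kappa> * (w x * \<phi> x) - s * wmean \<phi> * w x) * \<psi> x) \<and>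
      (LINT x|M. G x \<bullet> H x) = (LINT x|M. (\<kappa> * (w x * \<phi> x) - s * wmean \<phi> * w x) * \<psi> x)"
      using R unfolding L2_inner_def by auto
  qed
qed

end

text \<open>The bound \<open>K\<close> only makes \<open>exp u\<close> an admissible weight; the
  size that matters is in \<open>small\<close>, which combined with the strip inequality gives the
  ratio 8/9 independently of \<open>q\<close>.\<close>

lemma linearized_eigenvalues_positive:
  assumes dom: "open \<Omega>" "bounded \<Omega>" "\<Omega> \<noteq> {}"
    and u: "u \<in> borel_measurable (lebesgue_on \<Omega>)" "AE x in lebesgue_on \<Omega>. u x \<le> K"
    and lam: "lam = \<mu> * exp_integral \<Omega> u" "0 \<le> lam"
    and strip: "\<And>z. z \<in> \<Omega> \<Longrightarrow> \<bar>q \<bullet> z + c\<bar> \<le> 1"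
    and small: "AE x in lebesgue_on \<Omega>. \<mu> * exp (u x) \<le> 2 * (norm q)\<^sup>2"
  shows "(\<forall>\<phi>. linearized_P lam \<Omega> u 0 \<phi> \<longrightarrow> trivial_on \<Omega> \<phi>) \<and>
       (\<exists>\<tau>. first_eigenvalue_P lam \<Omega> u \<tau> \<and> 0 < \<tau>) \<and>
       (\<exists>\<nu>. first_eigenvalue_Q \<mu> \<Omega> u \<nu> \<and> 0 < \<nu>)"
proof -
  interpret weighted_domain \<Omega> "\<lambda>x. exp (u x)" "exp K"
    by unfold_locales (use dom u in \<open>auto simp: measurable_compose[OF _ borel_measurable_exp]\<close>)
  define E where "E = exp_integral \<Omega> u"
  have E: "E = wprod (\<lambda>_. 1) (\<lambda>_. 1)" by (simp add: E_def exp_integral_def wprod_def L2_inner_def)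
  have "\<not> trivial_on \<Omega> (\<lambda>_. 1)"
    using AE_lebesgue_on_open_exists[OF dom(1,3), of "\<lambda>_. (1::real) = 0"] by (auto simp: trivial_on_def)
  then have E0: "0 < E" unfolding E by (intro wprod_self_pos square_integrable_const)
  have lamE: "lam = \<mu> * E" using lam(1) by (simp add: E_def)
  have \<mu>0: "0 \<le> \<mu>" using lam(2) E0 unfolding lamE by (simp add: zero_le_mult_iff)
  have key: "\<mu> * wprod \<phi> \<phi> \<le> 8 / 9 * L2_inner M G G" if H: "H10 \<Omega> \<phi> G" for \<phi> G
  proof -
    note sq = H10_square_integrable(1)[OF H]
    have "\<mu> * wprod \<phi> \<phi> = (LINT x|M. \<mu> * ((exp (u x) *\<^sub>R \<phi> x) \<bullet> \<phi> x))"
      by (simp add: wprod_def L2_inner_def)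
    also have "\<dots> \<le> (LINT x|M. 2 * (norm q)\<^sup>2 * (\<phi> x \<bullet> \<phi> x))"
    proof (rule integral_mono_AE)
      show "integrable M (\<lambda>x. \<mu> * ((exp (u x) *\<^sub>R \<phi> x) \<bullet> \<phi> x))"
        by (intro integrable_mult_right integrable_inner_square_integrable square_integrable_weight sq)
      show "integrable M (\<lambda>x. 2 * (norm q)\<^sup>2 * (\<phi> x \<bullet> \<phi> x))"
        by (intro integrable_mult_right integrable_inner_square_integrable sq)
      show "AE x in M. \<mu> * ((exp (u x) *\<^sub>R \<phi> x) \<bullet> \<phi> x) \<le> 2 * (norm q)\<^sup>2 * (\<phi> x \<bullet> \<phi> x)"
        using small
      proof eventually_elim
        case (elim x)
        then have "\<mu> * exp (u x) * (\<phi> x * \<phi> x) \<le> 2 * (norm q)\<^sup>2 * (\<phi> x * \<phi> x)" by (intro mult_right_mono) auto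
        then show ?case by (simp add: mult.assoc)
      qed
    qed
    also have "\<dots> = 8 / 9 * (9 / 4 * (norm q)\<^sup>2 * L2_inner M \<phi> \<phi>)" by (simp add: L2_inner_def)
    also have "\<dots> \<le> 8 / 9 * L2_inner M G G" using H10_poincare_strip[OF strip H] by (intro mult_left_mono) auto
    finally show ?thesis .
  qed
  \<comment> \<open>One factor \<open>1 / E\<close> comes from the outer weight, the other from the
    weight inside the mean. In the same normalization an eigenvalue \<open>\<tau>\<close> becomes
    \<open>(lam + \<tau>) / E\<close>, and \<open>lam / E = \<mu>\<close>.\<close>
  define s where "s = lam / E\<^sup>2"
  have s0: "0 \<le> s" using lam(2) by (simp add: s_def)
  have Q: "linearized_Q \<mu> \<Omega> u \<nu> \<phi> \<longleftrightarrow> weak_eigenfunction 0 (\<mu> + \<nu>) \<phi>" for \<nu> \<phi>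
    unfolding linearized_Q_def weak_eigenfunction_iff_dirichlet_solution by (simp add: distrib_right mult.assoc)
  have P: "linearized_P lam \<Omega> u \<tau> \<phi> \<longleftrightarrow> weak_eigenfunction s ((lam + \<tau>) / E) \<phi>" for \<tau> \<phi>
  proof -
    have m: "weighted_mean \<Omega> u \<phi> = wmean \<phi> / E"
      by (simp add: weighted_mean_def weight_def E_def[symmetric] wmean_def wprod_def L2_inner_def)
    have "(\<lambda>x. lam * weight \<Omega> u x * \<phi> x - lam * weight \<Omega> u x * weighted_mean \<Omega> u \<phi> + \<tau> * weight \<Omega> u x * \<phi> x)
      = (\<lambda>x. (lam + \<tau>) / E * (exp (u x) * \<phi> x) - s * wmean \<phi> * exp (u x))"
      unfolding m using E0
      by (auto simp: weight_def E_def[symmetric] s_def fun_eq_iff field_simps power2_eq_square)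
    then show ?thesis unfolding linearized_P_def weak_eigenfunction_iff_dirichlet_solution by simp
  qed
  have gt: "\<mu> < \<kappa>" if "weak_eigenfunction t \<kappa> \<phi>" "\<not> trivial_on \<Omega> \<phi>" "0 \<le> t" for t \<kappa> \<phi>
    by (rule weak_eigenvalue_gt[OF that(3) _ _ key that(1,2)]) auto
  have "\<forall>\<phi>. linearized_P lam \<Omega> u 0 \<phi> \<longrightarrow> trivial_on \<Omega> \<phi>"
  proof (intro allI impI, rule ccontr)
    fix \<phi> assume "linearized_P lam \<Omega> u 0 \<phi>" "\<not> trivial_on \<Omega> \<phi>"
    \<comment> \<open>A solution for \<open>\<tau> = 0\<close> has
      \<open>\<kappa> = lam / E\<close>, which is exactly the excluded value
      \<open>\<mu>\<close>.\<close>
    then have "\<mu> < (lam + 0) / E" using gt[of s "(lam + 0) / E" \<phi>] s0 unfolding P by blast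
    then show False using E0 by (simp add: lamE)
  qed
  moreover have "\<exists>\<tau>. first_eigenvalue_P lam \<Omega> u \<tau> \<and> 0 < \<tau>"
  proof -
    obtain \<kappa> \<phi> where \<kappa>: "weak_eigenfunction s \<kappa> \<phi>" "\<not> trivial_on \<Omega> \<phi>"
      "\<And>\<kappa>' \<phi>. weak_eigenfunction s \<kappa>' \<phi> \<Longrightarrow> \<not> trivial_on \<Omega> \<phi> \<Longrightarrow> \<kappa> \<le> \<kappa>'"
      using first_weak_eigenvalue[OF s0] by blast
    define \<tau> where "\<tau> = E * \<kappa> - lam"
    have \<tau>: "(lam + \<tau>) / E = \<kappa>" using E0 by (simp add: \<tau>_def)
    have "\<tau> \<le> \<sigma>" if "weak_eigenfunction s ((lam + \<sigma>) / E) \<psi>" "\<not> trivial_on \<Omega> \<psi>" for \<sigma> \<psi>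
      using \<kappa>(3)[OF that] E0 by (simp add: \<tau>_def field_simps)
    then have "first_eigenvalue_P lam \<Omega> u \<tau>"
      unfolding first_eigenvalue_P_def eigenvalue_P_def P using \<kappa>(1,2) \<tau> by auto
    moreover have "0 < \<tau>" using gt[OF \<kappa>(1,2) s0] E0 by (simp add: \<tau>_def lamE mult.commute)
    ultimately show ?thesis by blast
  qed
  moreover have "\<exists>\<nu>. first_eigenvalue_Q \<mu> \<Omega> u \<nu> \<and> 0 < \<nu>"
  proof -
    obtain \<kappa> \<phi> where \<kappa>: "weak_eigenfunction 0 \<kappa> \<phi>" "\<not> trivial_on \<Omega> \<phi>"
      "\<And>\<kappa>' \<phi>. weak_eigenfunction 0 \<kappa>' \<phi> \<Longrightarrow> \<not> trivial_on \<Omega> \<phi> \<Longrightarrow> \<kappa> \<le> \<kappa>'"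
      using first_weak_eigenvalue[of 0] by auto
    have "\<kappa> - \<mu> \<le> \<sigma>" if "weak_eigenfunction 0 (\<mu> + \<sigma>) \<psi>" "\<not> trivial_on \<Omega> \<psi>" for \<sigma> \<psi>
      using \<kappa>(3)[OF that] by simp
    then have "first_eigenvalue_Q \<mu> \<Omega> u (\<kappa> - \<mu>)"
      unfolding first_eigenvalue_Q_def eigenvalue_Q_def Q using \<kappa>(1,2) by auto
    moreover have "0 < \<kappa> - \<mu>" using gt[OF \<kappa>(1,2)] by simp
    ultimately show ?thesis by blast
  qed
  ultimately show ?thesis by blast
qed

section \<open>From the barriers on the normalized domain to the eigenvalue bound on the domain
  itself\<close>

text \<open>The lower barrier is nonnegative and the upper one is negative outside the ellipse, so the order
  of the barriers alone confines the domain. In the convex case this replaces John's theorem.\<close>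

lemma normalized_solution_domain_bound:
  assumes S: "open S" and c: "0 < c" and \<rho>: "0 < \<rho>" "\<rho> \<le> 1" and m: "0 < m"
    and n: "normalized_solution S \<rho> c m u" and z: "z \<in> S"
  shows "ell \<rho> z \<le> 1"
proof (rule AE_lebesgue_on_open_le[OF S _ _ z])
  have ell0: "0 \<le> ell \<rho> z" for z by (simp add: ell_def)
  show "continuous_on UNIV (ell \<rho>)" unfolding ell_def[abs_def] by (intro continuous_intros)
  have m': "m \<le> mu_bar \<rho>" and ae: "AE x in lebesgue_on S. v_minus \<rho> c m x \<le> u x \<and> u x \<le> v_plus \<rho> m x"
    using n m by (auto simp: normalized_solution_def)
  define g where "g = (gamma_plus \<rho> m)\<^sup>2"
  have g: "0 < g" unfolding g_def by (rule gamma_plus_bounds(1)[OF \<rho> m m'])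
  have v: "0 \<le> v_minus \<rho> c m x" for x
  proof (cases "ell \<rho> x \<le> c")
    case True
    define h where "h = (gamma_minus \<rho> c m)\<^sup>2"
    have h: "0 \<le> h" by (simp add: h_def)
    have "h / c * ell \<rho> x \<le> h / c * c" using True h c by (intro mult_left_mono) auto
    then have "h / c * ell \<rho> x \<le> h" using c by simp
    moreover have "0 \<le> h / c * ell \<rho> x" using h c ell0 by simp
    ultimately have "1 \<le> (1 + h) / (1 + h / c * ell \<rho> x)" by (subst le_divide_eq) auto
    then show ?thesis using True by (simp add: v_minus_def h_def)
  qed (simp add: v_minus_def)
  show "AE x in lebesgue_on S. ell \<rho> x \<le> 1"
    using ae
  proof eventually_elim
    case (elim x)
    then have "0 \<le> v_plus \<rho> m x" using v[of x] by linarith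
    moreover have p: "0 < 1 + g * ell \<rho> x" using g ell0[of x] by (simp add: add_pos_nonneg)
    ultimately have "0 \<le> ln ((1 + g) / (1 + g * ell \<rho> x))" by (simp add: v_plus_def g_def)
    then have "1 \<le> (1 + g) / (1 + g * ell \<rho> x)" using p g by (subst (asm) ln_ge_zero_iff) auto
    then show ?case using p g by (simp add: le_divide_eq)
  qed
qed

text \<open>The upper barrier is largest at the center of the ellipse, where \<open>ell\<close>
  vanishes.\<close>

lemma exp_v_plus_le: "exp (v_plus \<rho> m z) \<le> (1 + (gamma_plus \<rho> m)\<^sup>2)\<^sup>2"
proof -
  define g where "g = (gamma_plus \<rho> m)\<^sup>2"
  have g: "0 \<le> g" by (simp add: g_def)
  have "0 \<le> ell \<rho> z" by (simp add: ell_def)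
  then have d: "1 \<le> 1 + g * ell \<rho> z" using g by simp
  have q: "0 < (1 + g) / (1 + g * ell \<rho> z)" using g d by (intro divide_pos_pos) auto
  have "(1 + g) / (1 + g * ell \<rho> z) \<le> (1 + g) / 1" using g d by (intro divide_left_mono) auto
  then have "((1 + g) / (1 + g * ell \<rho> z))\<^sup>2 \<le> (1 + g)\<^sup>2" using q by (intro power_mono) auto
  moreover have "exp (v_plus \<rho> m z) = ((1 + g) / (1 + g * ell \<rho> z))\<^sup>2"
    unfolding v_plus_def g_def[symmetric] using q by (simp add: exp_double)
  ultimately show ?thesis by (simp add: g_def)
qed

text \<open>The linearized problems stay on \<open>\<Omega>\<close>: instead of transporting weak
  solutions, the affine map transports the barriers, the strip and the integral of
  \<open>exp u\<close>. With \<open>m * exp u <= 2\<close> on the normalized side,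
  \<open>\<mu> = m / (norm a)^2\<close> and a strip with \<open>norm q = 1 / norm a\<close>, the
  factors of \<open>norm a\<close> cancel.\<close>

lemma branch_eigenvalues_positive:
  assumes dom: "open S" "bounded S" "S \<noteq> {}" and a: "a \<noteq> 0"
    and im: "\<Omega> = (\<lambda>z. t + a * z) ` S"
    and c: "0 < c" and \<rho>: "0 < \<rho>" "\<rho> \<le> 2 / 5"
    and n: "normalized_solution S \<rho> c m (\<lambda>z. u (t + a * z))"
    and lam: "lam = m * exp_integral S (\<lambda>z. u (t + a * z))" "lam = \<mu> * exp_integral \<Omega> u" "0 \<le> lam"
    and sQ: "solves_Q \<mu> \<Omega> u"
  shows "(\<forall>\<phi>. linearized_P lam \<Omega> u 0 \<phi> \<longrightarrow> trivial_on \<Omega> \<phi>) \<and>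
       (\<exists>\<tau>. first_eigenvalue_P lam \<Omega> u \<tau> \<and> 0 < \<tau>) \<and>
       (\<exists>\<nu>. first_eigenvalue_Q \<mu> \<Omega> u \<nu> \<and> 0 < \<nu>)"
proof -
  let ?T = "\<lambda>z. t + a * z"
  have T: "\<Omega> = (\<lambda>z. t + z) ` ((*) a ` S)" by (auto simp: im)
  have dom': "open \<Omega>" "bounded \<Omega>" "\<Omega> \<noteq> {}"
  proof -
    have "open ((*) a ` S)"
    proof -
      have "x \<in> (*) a ` S" if "inverse a * x \<in> S" for x
        by (rule image_eqI[OF _ that]) (use a in simp)
      then have "(*) a ` S = (\<lambda>z. inverse a * z) -` S" using a by (auto simp flip: mult.assoc)
      then show ?thesis using dom(1) by (simp add: open_vimage continuous_intros)
    qed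
    then show "open \<Omega>" unfolding T by (rule open_translation)
    have "bounded ((*) a ` S)" by (rule bounded_linear_image[OF dom(2) bounded_linear_mult_right])
    then show "bounded \<Omega>" unfolding T by (rule bounded_translation)
    show "\<Omega> \<noteq> {}" using dom(3) by (simp add: im)
  qed
  have meas: "S \<in> sets lebesgue" "?T ` S \<in> sets lebesgue" using dom(1) dom'(1) by (auto simp: im[symmetric])
  have um: "u \<in> borel_measurable (lebesgue_on \<Omega>)"
    using sQ by (auto simp: solves_Q_def dirichlet_solution_def H10_def L2_on_def)
  have I: "exp_integral \<Omega> u = (norm a)\<^sup>2 * exp_integral S (\<lambda>z. u (t + a * z))"
    unfolding exp_integral_def im
    by (rule integral_complex_affine[OF a meas(1) _ meas(2)]) (use um in \<open>simp add: im\<close>)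
  have na: "0 < (norm a)\<^sup>2" using a by simp
  show ?thesis
  proof (cases "m = 0")
    case True
    have "AE z in lebesgue_on S. u (t + a * z) = 0"
      using n True by (auto simp: normalized_solution_def trivial_on_def)
    then have u0: "AE x in lebesgue_on \<Omega>. u x = 0"
      unfolding im by (rule AE_complex_affine[OF a meas])
    interpret D: weighted_domain \<Omega> "\<lambda>_. 1" 1
      by unfold_locales (use dom' in auto)
    \<comment> \<open>For \<open>m = 0\<close> there are no barriers to confine the domain, but
      \<open>\<mu> = 0\<close> as well, so any strip containing the bounded domain suffices.\<close>
    obtain q :: complex where q: "\<And>z. z \<in> \<Omega> \<Longrightarrow> \<bar>q \<bullet> z + 0\<bar> \<le> 1" using D.strip_exists by blast
    have "exp_integral \<Omega> u = (LINT x|lebesgue_on \<Omega>. 1)"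
      unfolding exp_integral_def using u0 um
      by (intro integral_cong_AE) (auto elim: eventually_mono)
    also have "\<dots> = measure lebesgue \<Omega>" using dom'(1) by (simp add: measure_restrict_space)
    finally have e: "exp_integral \<Omega> u = measure lebesgue \<Omega>" .
    have "measure lebesgue \<Omega> \<noteq> 0"
      using D.domain_lmeasurable open_not_negligible[OF dom'(1,3)] by (simp add: negligible_iff_measure0)
    then have "\<mu> = 0" using lam True e by simp
    show ?thesis
      by (rule linearized_eigenvalues_positive[OF dom' um _ lam(2,3) q, of 0])
        (use u0 \<open>\<mu> = 0\<close> in \<open>auto elim: eventually_mono\<close>)
  next
    case False
    then have m: "0 < m" "m \<le> mu_bar \<rho>"
      and ae: "AE x in lebesgue_on S. v_minus \<rho> c m x \<le> u (t + a * x) \<and> u (t + a * x) \<le> v_plus \<rho> m x"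
      and sQ': "solves_Q m S (\<lambda>z. u (t + a * z))"
      using n by (auto simp: normalized_solution_def)
    define g where "g = (1 + (gamma_plus \<rho> m)\<^sup>2)\<^sup>2"
    have "0 < 1 + (gamma_plus \<rho> m)\<^sup>2" by (rule add_pos_nonneg) auto
    then have g: "0 < g" "m * g \<le> 2" using gamma_plus_bounds(2)[OF \<rho>(1) _ m \<rho>(2)] \<rho>
      by (simp_all add: g_def)
    have "AE x in lebesgue_on S. exp (u (t + a * x)) \<le> g"
      using ae by eventually_elim (metis exp_le_cancel_iff exp_v_plus_le g_def order_trans)
    then have ug: "AE x in lebesgue_on \<Omega>. exp (u x) \<le> g"
      unfolding im by (rule AE_complex_affine[OF a meas])
    have "exp_integral S (\<lambda>z. u (t + a * z)) \<noteq> 0"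
    proof
      assume z: "exp_integral S (\<lambda>z. u (t + a * z)) = 0"
      have "integrable (lebesgue_on S) (\<lambda>x. exp (u (t + a * x)))" using sQ' by (simp add: solves_Q_def)
      then have "AE x in lebesgue_on S. exp (u (t + a * x)) = 0"
        using z integral_nonneg_eq_0_iff_AE[of "lebesgue_on S" "\<lambda>x. exp (u (t + a * x))"]
        by (simp add: exp_integral_def)
      then show False using AE_lebesgue_on_open_exists[OF dom(1,3)] by fastforce
    qed
    \<comment> \<open>\<open>lam\<close> is written once with \<open>m\<close> on \<open>S\<close>
      and once with \<open>\<mu>\<close> on \<open>\<Omega>\<close>; the two exponential integrals
      differ by the Jacobian and are nonzero, so they can be divided out.\<close>
    then have \<mu>: "\<mu> = m / (norm a)\<^sup>2" using lam(1,2) na unfolding I by (simp add: field_simps)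
    \<comment> \<open>Chosen so that the inner product with \<open>q\<close> is
      \<open>Im (y / a)\<close>; up to the constant \<open>d\<close> it recovers the imaginary part
      in the normalized domain, which is at most 1 in modulus.\<close>
    define q where "q = \<i> / cnj a"
    define d where "d = - Im (t / a)"
    have nq: "norm q = 1 / norm a" by (simp add: q_def norm_divide)
    have q: "q \<bullet> (t + a * z) + d = Im z" for z
    proof -
      have "q \<bullet> y = Im (y / a)" for y
      proof -
        have "q \<bullet> y = Re (cnj q * y)" by (simp add: inner_complex_def)
        also have "cnj q * y = - (\<i> * (y / a))" by (simp add: q_def)
        finally show ?thesis by (simp only: uminus_complex.sel Re_i_times minus_minus)
      qed
      then show ?thesis using a by (simp add: d_def add_divide_distrib)
    qed
    show ?thesis
    proof (rule linearized_eigenvalues_positive[OF dom' um _ lam(2,3)])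
      show "AE x in lebesgue_on \<Omega>. u x \<le> ln g"
        using ug by eventually_elim (use g in \<open>simp add: ln_ge_iff\<close>)
      show "\<bar>q \<bullet> z + d\<bar> \<le> 1" if z: "z \<in> \<Omega>" for z
      proof -
        obtain y where y: "y \<in> S" "z = t + a * y" using z unfolding im by blast
        have "ell \<rho> y \<le> 1"
          by (rule normalized_solution_domain_bound[OF dom(1) c \<rho>(1) _ m(1) n y(1)]) (use \<rho> in simp)
        moreover have "0 \<le> \<rho>\<^sup>2 * (Re y)\<^sup>2" by simp
        ultimately have "(Im y)\<^sup>2 \<le> 1" unfolding ell_def by linarith
        then show ?thesis unfolding y(2) q by (simp add: abs_square_le_1)
      qed
      show "AE x in lebesgue_on \<Omega>. \<mu> * exp (u x) \<le> 2 * (norm q)\<^sup>2"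
        using ug
      proof eventually_elim
        case (elim x)
        then have "m * exp (u x) \<le> m * g" using m by (intro mult_left_mono) auto
        then have "m * exp (u x) \<le> 2" using g by linarith
        then show ?case using na by (simp add: \<mu> nq power_divide divide_right_mono)
      qed
    qed
  qed
qed


section \<open>Convex domains: from the isoperimetric ratio to the axis ratio\<close>

lemma arctan_le_self: "0 \<le> x \<Longrightarrow> arctan x \<le> (x::real)"
proof -
  assume x: "0 \<le> x"
  have "0 - arctan 0 \<le> x - arctan x"
  proof (rule DERIV_nonneg_imp_nondecreasing[OF x])
    fix y :: real assume "0 \<le> y" "y \<le> x"
    have "((\<lambda>x. x - arctan x) has_real_derivative 1 - inverse (1 + y\<^sup>2)) (at y)"
      by (auto intro!: derivative_eq_intros)
    moreover have "inverse (1 + y\<^sup>2) \<le> 1" by (simp add: inverse_le_1_iff)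
    ultimately show "\<exists>k. ((\<lambda>x. x - arctan x) has_real_derivative k) (at y) \<and> 0 \<le> k" by fastforce
  qed
  then show ?thesis by simp
qed

text \<open>Euler's formula pi / 4 = 5 arctan (1/7) + 2 arctan (3/79) together with arctan x <= x
  gives pi < 3.17. The bound serves to get 160 <= 512 / pi.\<close>

lemma pi_less_32_10: "pi < 32 / 10"
  using machin_Euler arctan_le_self[of "1/7"] arctan_le_self[of "3/79"] by simp

lemma regular_domainD:
  assumes "regular_domain \<Omega>"
  shows "open \<Omega>" "bounded \<Omega>" "\<Omega> \<noteq> {}" "\<exists>g. jordan_parametrization \<Omega> g"
proof -
  show "open \<Omega>" "bounded \<Omega>" and g: "\<exists>g. jordan_parametrization \<Omega> g"
    using assms by (auto simp: regular_domain_def simple_domain_def)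
  show "\<Omega> \<noteq> {}"
  proof
    assume "\<Omega> = {}"
    \<comment> \<open>The frontier of the empty set is empty, but the image of a path is
      not.\<close>
    then show False using g by (auto simp: jordan_parametrization_def)
  qed
qed

lemma rigid_motion_eq: "rigid_motion \<alpha> p = (\<lambda>z. p + cis \<alpha> * z)"
  by (auto simp: rigid_motion_def)

lemma inv_rigid_motion: "inv (rigid_motion \<alpha> p) z = cis (- \<alpha>) * (z - p)"
proof (rule inv_f_eq)
  have "x = y" if "rigid_motion \<alpha> p x = rigid_motion \<alpha> p y" for x y
    using that cis_neq_zero[of \<alpha>] by (simp add: rigid_motion_def)
  then show "inj (rigid_motion \<alpha> p)" by (rule injI)
  have e: "cis \<alpha> * (cis (- \<alpha>) * (z - p)) = z - p"
    unfolding mult.assoc[symmetric] cis_mult by simp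
  then show "rigid_motion \<alpha> p (cis (- \<alpha>) * (z - p)) = z" unfolding rigid_motion_def e by simp
qed

text \<open>The moved domain lies in a box with half sides \<open>2 * a\<close> and
  \<open>2 * b\<close>, so its boundary has length at most \<open>8 * (a + b)\<close>; it contains
  an open rectangle inscribed in the ellipse, of area \<open>2 * a * b\<close>. A rigid motion
  changes neither length nor area.\<close>

lemma convex_isoperimetric_ratio_le:
  assumes reg: "regular_domain \<Omega>" and conv: "convex \<Omega>" and ab: "0 < b" "b \<le> a"
    and john: "{z. (Re z)\<^sup>2 / a\<^sup>2 + (Im z)\<^sup>2 / b\<^sup>2 \<le> 1} \<subseteq> closure (rigid_motion \<alpha> p ` \<Omega>)"
    and outer: "rigid_motion \<alpha> p ` \<Omega> \<subseteq> {z. \<bar>Re z\<bar> \<le> 2 * a \<and> \<bar>Im z\<bar> \<le> 2 * b}"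
  shows "isoperimetric_ratio \<Omega> \<le> 32 * (a + b)\<^sup>2 / (a * b)"
proof -
  let ?R = "rigid_motion \<alpha> p"
  define X where "X = ?R ` \<Omega>"
  have R: "?R = (\<lambda>z. p + z) \<circ> (\<lambda>z. cis \<alpha> * z)" by (auto simp: rigid_motion_eq)
  have Re: "X = (\<lambda>z. p + z) ` ((\<lambda>z. cis \<alpha> * z) ` \<Omega>)" by (simp add: X_def R image_comp)
  have lin: "linear (\<lambda>z. cis \<alpha> * z)" by (intro linearI) (auto simp: algebra_simps)
  have inj: "inj (\<lambda>z. cis \<alpha> * z)" by (auto simp: inj_def)
  have surj: "surj (\<lambda>z. cis \<alpha> * z)" 
    by (rule surjI[of _ "\<lambda>z. cis (- \<alpha>) * z"]) (simp add: cis_mult flip: mult.assoc)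
  note \<Omega> = regular_domainD[OF reg]
  have X: "open X" "convex X" "X \<noteq> {}" "bounded X"
  proof -
    show "open X" unfolding Re by (intro open_translation open_surjective_linear_image \<Omega>(1) lin surj)
    show "convex X" unfolding Re by (intro convex_translation convex_linear_image lin conv)
    show "X \<noteq> {}" using \<Omega>(3) by (simp add: X_def)
    show "bounded X" unfolding Re
      by (intro bounded_translation bounded_linear_image[OF \<Omega>(2)] linear_conv_bounded_linear[THEN iffD1, OF lin])
  qed
  define g where "g = (SOME g. jordan_parametrization \<Omega> g)"
  have g: "jordan_parametrization \<Omega> g" unfolding g_def using \<Omega>(4) by (rule someI_ex)
  have dR: "dist (?R x) (?R y) = dist x y" for x y
    by (simp add: rigid_motion_def dist_norm norm_mult flip: right_diff_distrib)
  have injR: "inj ?R" using dR by (metis dist_eq_0_iff injI)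
  have "curve_length (?R \<circ> g) \<le> ennreal (4 * (2 * a) + 4 * (2 * b))"
  proof (rule curve_length_convex_le[OF X])
    have "continuous_on S ?R" for S unfolding rigid_motion_eq by (intro continuous_intros)
    then show "simple_path (?R \<circ> g)"
      using g injR by (intro simple_path_continuous_image) (auto simp: jordan_parametrization_def inj_on_def)
    have "frontier X = ?R ` frontier \<Omega>"
    proof -
      have "?R ` frontier \<Omega> = (\<lambda>z. p + z) ` ((\<lambda>z. cis \<alpha> * z) ` frontier \<Omega>)" by (simp add: R image_comp)
      also have "(\<lambda>z. cis \<alpha> * z) ` frontier \<Omega> = frontier ((\<lambda>z. cis \<alpha> * z) ` \<Omega>)"
        by (simp add: frontier_def image_set_diff[OF inj] closure_injective_linear_image[OF lin inj]
            interior_bijective_linear_image[OF lin bijI[OF inj surj]])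
      finally show ?thesis unfolding Re frontier_translation ..
    qed
    then show "path_image (?R \<circ> g) = frontier X"
      using g by (simp add: jordan_parametrization_def path_image_compose)
    show "X \<subseteq> {z. \<bar>Re z\<bar> \<le> 2 * a \<and> \<bar>Im z\<bar> \<le> 2 * b}" using outer by (simp add: X_def)
  qed
  moreover have "curve_length (?R \<circ> g) = curve_length g" by (simp add: curve_length_def dR)
  ultimately have "boundary_length \<Omega> \<le> 8 * (a + b)"
    unfolding boundary_length_def g_def[symmetric] using ab by (intro enn2real_leI) (auto simp: algebra_simps)
  then have L: "(boundary_length \<Omega>)\<^sup>2 \<le> (8 * (a + b))\<^sup>2"
    by (intro power_mono) (auto simp: boundary_length_def)
  \<comment> \<open>The inscribed rectangle with half sides \<open>a / sqrt 2\<close> and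
    \<open>b / sqrt 2\<close> has its corners on the ellipse and is the largest one with sides along
    the axes.\<close>
  define h where "h = 1 / sqrt (2::real)"
  have h: "0 < h" "h\<^sup>2 = 1 / 2" by (auto simp: h_def power_divide)
  define B where "B = cbox (Complex (- h * a) (- h * b)) (Complex (h * a) (h * b))"
  have BE: "B \<subseteq> {z. (Re z)\<^sup>2 / a\<^sup>2 + (Im z)\<^sup>2 / b\<^sup>2 \<le> 1}"
  proof
    fix z assume "z \<in> B"
    then have "\<bar>Re z\<bar> \<le> h * a" "\<bar>Im z\<bar> \<le> h * b"
      by (auto simp: B_def cbox_def Basis_complex_def abs_le_iff)
    then have "(Re z)\<^sup>2 \<le> (h * a)\<^sup>2" "(Im z)\<^sup>2 \<le> (h * b)\<^sup>2"
      using power_mono[of "\<bar>Re z\<bar>" "h * a" 2] power_mono[of "\<bar>Im z\<bar>" "h * b" 2] by auto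
    then have "(Re z)\<^sup>2 / a\<^sup>2 \<le> 1 / 2" "(Im z)\<^sup>2 / b\<^sup>2 \<le> 1 / 2"
      using ab h by (auto simp: power_mult_distrib divide_le_eq)
    then show "z \<in> {z. (Re z)\<^sup>2 / a\<^sup>2 + (Im z)\<^sup>2 / b\<^sup>2 \<le> 1}" unfolding mem_Collect_eq by linarith
  qed
  have "interior B \<subseteq> X"
  proof -
    \<comment> \<open>The ellipse is only known to lie in the closure; taking interiors returns to
      the open convex set itself.\<close>
    have "interior B \<subseteq> interior (closure X)" using BE john by (intro interior_mono) (auto simp: X_def)
    then show ?thesis using convex_interior_closure[OF X(2)] X(1) by (simp add: interior_open)
  qed
  then have "measure lebesgue (interior B) \<le> measure lebesgue X"
    using X by (intro measure_mono_fmeasurable) (auto intro!: lmeasurable_open)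
  moreover have "measure lebesgue (interior B) = 2 * (a * b)"
  proof -
    have "measure lebesgue (interior B) = measure lborel (box (Complex (- h * a) (- h * b)) (Complex (h * a) (h * b)))"
      by (simp add: B_def)
    also have "\<dots> = (2 * (h * a)) * (2 * (h * b))"
      using ab h by (subst measure_lborel_box) (auto simp: Basis_complex_def)
    also have "\<dots> = 4 * h\<^sup>2 * (a * b)" by (simp add: power2_eq_square)
    finally show ?thesis using h by simp
  qed
  moreover have "measure lebesgue X = measure lebesgue \<Omega>"
    unfolding X_def rigid_motion_eq using \<Omega>(1) X(1)
    by (intro measure_complex_rigid) (auto simp: X_def rigid_motion_eq)
  ultimately have A: "2 * (a * b) \<le> measure lebesgue \<Omega>" by simp
  have "isoperimetric_ratio \<Omega> \<le> (8 * (a + b))\<^sup>2 / (2 * (a * b))"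
    unfolding isoperimetric_ratio_def using L A ab by (intro frac_le) auto
  also have "\<dots> = 32 * (a + b)\<^sup>2 / (a * b)" unfolding power_mult_distrib by simp
  finally show ?thesis .
qed

text \<open>With \<open>N_bar > 160\<close> the ratio \<open>x = b / a\<close> satisfies
  \<open>(1 + x)^2 > 5 * x\<close>; for \<open>x <= 1\<close> this means
  \<open>x < (3 - sqrt 5) / 2\<close>, which is below 2/5.\<close>

lemma axis_ratio_le:
  assumes ab: "0 < b" "b \<le> a" and N: "N_bar < 32 * (a + b)\<^sup>2 / (a * b)"
  shows "b / a \<le> 2 / (5::real)"
proof (rule ccontr)
  assume "\<not> b / a \<le> 2 / 5"
  then have b: "2 * a < 5 * b" using ab by (simp add: field_simps)
  have "160 \<le> 512 / pi" using pi_less_32_10 by (simp add: field_simps)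
  then have "160 < 32 * (a + b)\<^sup>2 / (a * b)" using N N_bar_gt by linarith
  then have "160 * (a * b) < 32 * (a + b)\<^sup>2" using ab by (simp add: field_simps)
  \<comment> \<open>The product expands to \<open>75 * a * b - 25 * b^2 - 26 * a^2\<close>. Its
    nonnegativity gives \<open>25 * (3 * a * b - a^2 - b^2) >= a^2 > 0\<close>, against
    \<open>a^2 + b^2 > 3 * a * b\<close> from the line before.\<close>
  moreover have "(5 * b - 2 * a) * (13 * a - 5 * b) \<ge> 0" using b ab by (intro mult_nonneg_nonneg) auto
  moreover have "0 < a * a" using ab by simp
  ultimately show False by (simp add: power2_eq_square algebra_simps)
qed

theorem proposition4p1:
  shows
   "(\<forall>c \<rho> \<beta>m \<beta>p lam \<mu> \<Lambda> \<Omega> u.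
       0 < c \<and> c \<le> 1 \<and> 0 < \<beta>m \<and> 0 < \<beta>p \<and> \<beta>m\<^sup>2 / \<beta>p\<^sup>2 = c \<and>
       0 < \<rho> \<and> \<rho> \<le> rho_star c \<and>
       regular_domain \<Omega> \<and>
       {z. ell \<rho> z \<le> \<beta>m\<^sup>2} \<subseteq> closure \<Omega> \<and> \<Omega> \<subseteq> {z. ell \<rho> z \<le> \<beta>p\<^sup>2} \<and>
       branch_threshold \<Omega> \<rho> c \<beta>p \<Lambda> \<and> 0 \<le> lam \<and> lam \<le> \<Lambda> \<and>
       branch_solution \<Omega> \<rho> c \<beta>p lam u \<and>
       lam = \<mu> * exp_integral \<Omega> u \<and> solves_P lam \<Omega> u \<and> solves_Q \<mu> \<Omega> u
       \<longrightarrow>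
       (\<forall>\<phi>. linearized_P lam \<Omega> u 0 \<phi> \<longrightarrow> trivial_on \<Omega> \<phi>) \<and>
       (\<exists>\<tau>. first_eigenvalue_P lam \<Omega> u \<tau> \<and> 0 < \<tau>) \<and>
       (\<exists>\<nu>. first_eigenvalue_Q \<mu> \<Omega> u \<nu> \<and> 0 < \<nu>))
    \<and>
    (\<forall>\<alpha> p a b lam \<mu> \<Lambda> \<Omega> u.
       regular_domain \<Omega> \<and> convex \<Omega> \<and> isoperimetric_ratio \<Omega> > N_bar \<and>
       0 < b \<and> b \<le> a \<and>
       john_ellipse (rigid_motion \<alpha> p ` \<Omega>) {z. (Re z)\<^sup>2 / a\<^sup>2 + (Im z)\<^sup>2 / b\<^sup>2 \<le> 1} \<and>
       branch_threshold (rigid_motion \<alpha> p ` \<Omega>) (b / a) (1 / 4) (2 * b) \<Lambda> \<and>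
       0 \<le> lam \<and> lam \<le> \<Lambda> \<and>
       branch_solution (rigid_motion \<alpha> p ` \<Omega>) (b / a) (1 / 4) (2 * b) lam
         (u \<circ> inv (rigid_motion \<alpha> p)) \<and>
       lam = \<mu> * exp_integral \<Omega> u \<and> solves_P lam \<Omega> u \<and> solves_Q \<mu> \<Omega> u
       \<longrightarrow>
       (\<exists>\<tau>. first_eigenvalue_P lam \<Omega> u \<tau> \<and> 0 < \<tau>) \<and>
       (\<exists>\<nu>. first_eigenvalue_Q \<mu> \<Omega> u \<nu> \<and> 0 < \<nu>))"
proof (rule conjI; intro allI impI; elim conjE)
  fix c \<rho> \<beta>m \<beta>p lam \<mu> \<Lambda> :: real and \<Omega> u
  assume c: "0 < c" "c \<le> 1" and \<beta>p: "0 < \<beta>p" and \<rho>: "0 < \<rho>" "\<rho> \<le> rho_star c"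
    and reg: "regular_domain \<Omega>" and lam: "0 \<le> lam" and br: "branch_solution \<Omega> \<rho> c \<beta>p lam u"
    and lam': "lam = \<mu> * exp_integral \<Omega> u" and sQ: "solves_Q \<mu> \<Omega> u"
  have \<rho>': "\<rho> \<le> 2 / 5" using \<rho>(2) rho_star_bounds(2)[OF c] rho_max_bounds(2) by linarith
  note \<Omega> = regular_domainD[OF reg]
  define S where "S = (\<lambda>z. z /\<^sub>R \<beta>p) ` \<Omega>"
  \<comment> \<open>The dilation written as an affine complex map with zero translation, the form in
    which the common lemma expects it.\<close>
  have sc: "\<beta>p *\<^sub>R z = 0 + of_real \<beta>p * z" for z :: complex by (simp add: scaleR_conv_of_real)
  obtain m where m: "normalized_solution S \<rho> c m (\<lambda>z. u (0 + of_real \<beta>p * z))"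
    "lam = m * exp_integral S (\<lambda>z. u (0 + of_real \<beta>p * z))"
    using br unfolding branch_solution_def S_def[symmetric] sc by blast
  have "\<Omega> = (\<lambda>z. \<beta>p *\<^sub>R z) ` S" using \<beta>p by (simp add: S_def image_image)
  then have im: "\<Omega> = (\<lambda>z. 0 + of_real \<beta>p * z) ` S" unfolding sc .
  have S: "open S" "bounded S" "S \<noteq> {}"
    using \<Omega> \<beta>p by (auto simp: S_def intro: open_scaling bounded_scaling)
  show "(\<forall>\<phi>. linearized_P lam \<Omega> u 0 \<phi> \<longrightarrow> trivial_on \<Omega> \<phi>) \<and>
       (\<exists>\<tau>. first_eigenvalue_P lam \<Omega> u \<tau> \<and> 0 < \<tau>) \<and>
       (\<exists>\<nu>. first_eigenvalue_Q \<mu> \<Omega> u \<nu> \<and> 0 < \<nu>)"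
    by (rule branch_eigenvalues_positive[OF S _ im c(1) \<rho>(1) \<rho>' m lam' lam sQ]) (use \<beta>p in simp)
next
  fix \<alpha> a b lam \<mu> \<Lambda> :: real and p :: complex and \<Omega> u
  assume reg: "regular_domain \<Omega>" and conv: "convex \<Omega>" and N: "N_bar < isoperimetric_ratio \<Omega>"
    and ab: "0 < b" "b \<le> a"
    and john: "john_ellipse (rigid_motion \<alpha> p ` \<Omega>) {z. (Re z)\<^sup>2 / a\<^sup>2 + (Im z)\<^sup>2 / b\<^sup>2 \<le> 1}"
    and thr: "branch_threshold (rigid_motion \<alpha> p ` \<Omega>) (b / a) (1 / 4) (2 * b) \<Lambda>"
    and lam: "0 \<le> lam"
    and br: "branch_solution (rigid_motion \<alpha> p ` \<Omega>) (b / a) (1 / 4) (2 * b) lam (u \<circ> inv (rigid_motion \<alpha> p))"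
    and lam': "lam = \<mu> * exp_integral \<Omega> u" and sQ: "solves_Q \<mu> \<Omega> u"
  note \<Omega> = regular_domainD[OF reg]
  let ?R = "rigid_motion \<alpha> p"
  define S where "S = (\<lambda>z. z /\<^sub>R (2 * b)) ` (?R ` \<Omega>)"
  \<comment> \<open>Undoing the rigid motion after dilating by \<open>2 * b\<close> is the map
    \<open>t + k * z\<close>: \<open>k\<close> combines the inverse rotation with the dilation,
    \<open>t\<close> undoes the translation.\<close>
  define k where "k = cis (- \<alpha>) * of_real (2 * b)"
  define t where "t = - (cis (- \<alpha>) * p)"
  have k: "k \<noteq> 0" using ab by (simp add: k_def)
  have T: "inv ?R ((2 * b) *\<^sub>R z) = t + k * z" for z
    by (simp add: inv_rigid_motion k_def t_def scaleR_conv_of_real algebra_simps)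
  obtain m where m: "normalized_solution S (b / a) (1 / 4) m (\<lambda>z. u (t + k * z))"
    "lam = m * exp_integral S (\<lambda>z. u (t + k * z))"
    using br unfolding branch_solution_def S_def[symmetric] comp_def T by blast
  have injR: "inj ?R" by (auto simp: inj_def rigid_motion_def)
  have "t + k * ((?R z) /\<^sub>R (2 * b)) = z" for z
  proof -
    have e: "(2 * b) *\<^sub>R (?R z /\<^sub>R (2 * b)) = ?R z" using ab by simp
    show ?thesis unfolding T[symmetric] e by (rule inv_f_f[OF injR])
  qed
  then have im: "\<Omega> = (\<lambda>z. t + k * z) ` S" by (simp add: S_def image_image)
  have S0: "S = (\<lambda>z. (z - t) / k) ` \<Omega>" using k unfolding im by (simp add: image_image)
  have SV: "S = (\<lambda>z. t + k * z) -` \<Omega>"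
  proof -
    have "z \<in> S" if "t + k * z \<in> \<Omega>" for z
      unfolding S0 by (rule image_eqI[OF _ that]) (use k in simp)
    then show ?thesis unfolding im by auto
  qed
  have S: "open S" "bounded S" "S \<noteq> {}"
  proof -
    show "open S" unfolding SV by (intro open_vimage \<Omega>(1) continuous_intros)
    show "S \<noteq> {}" using \<Omega>(3) by (simp add: S0)
    have "S \<subseteq> (\<lambda>z. (z - t) / k) ` closure \<Omega>" unfolding S0 using closure_subset by (rule image_mono)
    moreover have "compact ((\<lambda>z. (z - t) / k) ` closure \<Omega>)"
      using \<Omega>(2) k by (intro compact_continuous_image continuous_intros) (auto simp: compact_closure)
    ultimately show "bounded S" using bounded_subset compact_imp_bounded by blast
  qed
  have ba: "0 < b / a" "b / a \<le> 1" using ab by auto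
  have "0 < 1 + (b / a)\<^sup>2" by (rule add_pos_nonneg) auto
  then have mu: "0 < mu_bar (b / a)" unfolding mu_bar_def by simp
  have outer: "?R ` \<Omega> \<subseteq> {z. \<bar>Re z\<bar> \<le> 2 * a \<and> \<bar>Im z\<bar> \<le> 2 * b}"
  proof
    fix y assume y: "y \<in> ?R ` \<Omega>"
    \<comment> \<open>The solution at the threshold is used here, not the one under study: its
      parameter \<open>mu_bar\<close> is positive, so its barriers confine the domain even when
      \<open>lam = 0\<close>, where the given solution has none.\<close>
    obtain v where v: "normalized_solution S (b / a) (1 / 4) (mu_bar (b / a)) v"
      using thr unfolding branch_threshold_def S_def[symmetric] by blast
    have "y /\<^sub>R (2 * b) \<in> S" using y by (auto simp: S_def)
    then have "ell (b / a) (y /\<^sub>R (2 * b)) \<le> 1"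
      using normalized_solution_domain_bound[OF S(1) _ ba mu v] by simp
    then have "(Re y / (2 * a))\<^sup>2 + (Im y / (2 * b))\<^sup>2 \<le> 1"
      using ab by (simp add: ell_def power_mult_distrib power_divide field_simps)
    then have "(Re y / (2 * a))\<^sup>2 \<le> 1" "(Im y / (2 * b))\<^sup>2 \<le> 1"
      using zero_le_power2[of "Re y / (2 * a)"] zero_le_power2[of "Im y / (2 * b)"] by linarith+
    then have "\<bar>Re y / (2 * a)\<bar> \<le> 1" "\<bar>Im y / (2 * b)\<bar> \<le> 1" unfolding abs_square_le_1 .
    then show "y \<in> {z. \<bar>Re z\<bar> \<le> 2 * a \<and> \<bar>Im z\<bar> \<le> 2 * b}" using ab by (simp add: abs_divide)
  qed
  have \<rho>: "b / a \<le> 2 / 5"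
  proof (rule axis_ratio_le[OF ab])
    show "N_bar < 32 * (a + b)\<^sup>2 / (a * b)"
      using N convex_isoperimetric_ratio_le[OF reg conv ab _ outer] john
      by (auto simp: john_ellipse_def)
  qed
  have "0 < (1 / 4 :: real)" by simp
  from branch_eigenvalues_positive[OF S k im this ba(1) \<rho> m lam' lam sQ]
  show "(\<exists>\<tau>. first_eigenvalue_P lam \<Omega> u \<tau> \<and> 0 < \<tau>) \<and>
       (\<exists>\<nu>. first_eigenvalue_Q \<mu> \<Omega> u \<nu> \<and> 0 < \<nu>)" by blast
qed

end
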